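(* Let $G(V,E)$ be a finite connected graph (loops and multiple edges allowed, $|E|\ge 1$) with all edges of length $1$, each edge $e_j$ parametrized by $x\in(0,1)$ (which gives an orientation on $G$), and let $q_j\in L^1(0,1)$ be a real-valued potential on $e_j$ for each $j=1,\dots,|E|$. Then the spectral determinant of the Schrödinger operator on $G$ with potential $(q_j)$ and standard matching conditions has a sequence of roots which asymptotically differ by the mean value $\frac{1}{|E|}\sum_j\int_0^1 q_j$ of the potential from the corresponding sequence of roots of the spectral determinant of the free Schrödinger operator (the case where all $q_j=0$). Precisely, the eigenvalue problem $-y''+q_j(x)y=\lambda y$ on $e_j$ (for all $j$) with standard matching conditions at the vertices has a sequence of eigenvalues $$\lambda_k=(2k\pi)^2+\frac{1}{|E|}\sum_{j}\int_0^{1}q_j\,dx+o(1)\qquad (k\in\mathbb{Z}^+,\ k\to\infty).$$ Moreover, if $G$ is bipartite, the same eigenvalue problem has a sequence of eigenvalues $$\lambda_k=(k\pi)^2+\frac{1}{|E|}\sum_{j}\int_0^{1}q_j\,dx+o(1)\qquad (k\in\mathbb{Z}^+,\ k\to\infty).$$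
   Context: Standard matching (Neumann/Kirchhoff) conditions: a function $y=(y_j)_{j}$ on $G$, with $y_j$ defined on $e_j\cong(0,1)$, satisfies (i) continuity: at each vertex $v$ all the boundary values of $y$ at $v$ coincide, i.e. $y_j(\kappa_j)=y_k(\kappa_k)$ whenever $e_j,e_k$ are attached to $v$, where $\kappa=0$ for an edge leaving $v$, $\kappa=1$ for an edge entering $v$ (both $0$ and $1$ occur for a loop); and (ii) for every vertex $v$, $\sum_{e_j\text{ leaves }v}y_j'(0)=\sum_{e_j\text{ enters }v}y_j'(1)$, with loops counted on both sides. Solutions of the differential equation are understood with $y_j,y_j'$ absolutely continuous. An eigenvalue is a $\lambda$ for which there is a nonzero $y$ satisfying the equation on every edge together with (i) and (ii). The spectral determinant (characteristic function) of this problem is a function of $\lambda$ whose zeros coincide with the spectrum of the problem. For the free operator, the corresponding sequence of roots is $(2k\pi)^2$ (respectively $(k\pi)^2$ in the bipartite case). *)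

theory Defs
  imports
    "HOL-Analysis.Analysis"
    "HOL-Library.Landau_Symbols"
    "Graph_Theory.Digraph"
    "Graph_Theory.Digraph_Component"
begin

text \<open>
  Graphs are \<open>pre_digraph\<close> records: the arcs are the oriented edges, the edge \<open>e\<close> running from
  \<open>tail G e\<close> (its point \<open>x = 0\<close>) to \<open>head G e\<close> (its point \<open>x = 1\<close>).  Loops and multiple
  edges are allowed.  Connectivity is \<open>Digraph_Component.connected\<close>, which ignores orientation.
\<close>

definition bipartite :: "('v, 'e) pre_digraph \<Rightarrow> bool" where
  "bipartite G \<longleftrightarrow>
    (\<exists>A B. A \<union> B = verts G \<and> A \<inter> B = {} \<and>
      (\<forall>e\<in>arcs G. tail G e \<in> A \<and> head G e \<in> B \<or> tail G e \<in> B \<and> head G e \<in> A))"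

text \<open>
  The sets \<open>D\<close> below range over the finite families of non-overlapping closed subintervals
  of \<open>{a..b}\<close>.
\<close>

definition abs_continuous_on_Icc ::
    "real \<Rightarrow> real \<Rightarrow> (real \<Rightarrow> 'a::real_normed_vector) \<Rightarrow> bool" where
  "abs_continuous_on_Icc a b f \<longleftrightarrow>
    (\<forall>\<epsilon>>0. \<exists>\<delta>>0. \<forall>D. D division_of \<Union>D \<and> \<Union>D \<subseteq> {a..b} \<and> (\<Sum>K\<in>D. Sup K - Inf K) < \<delta> \<longrightarrow>
      (\<Sum>K\<in>D. norm (f (Sup K) - f (Inf K))) < \<epsilon>)"

text \<open>
  \<open>y\<close> solves \<open>- y'' + q y = \<mu> y\<close> almost everywhere on the unit interval, with \<open>y\<close> and its
  derivative \<open>y'\<close> absolutely continuous.  Both functions are taken on the closed interval, so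
  that \<open>y 0\<close>, \<open>y 1\<close>, \<open>y' 0\<close>, \<open>y' 1\<close> are the boundary values; \<open>y' 0\<close> and \<open>y' 1\<close> are the
  one-sided derivatives.
\<close>

definition edge_solution ::
    "(real \<Rightarrow> real) \<Rightarrow> complex \<Rightarrow> (real \<Rightarrow> complex) \<Rightarrow> (real \<Rightarrow> complex) \<Rightarrow> bool" where
  "edge_solution q \<mu> y y' \<longleftrightarrow>
    abs_continuous_on_Icc 0 1 y \<and>
    abs_continuous_on_Icc 0 1 y' \<and>
    (\<forall>x\<in>{0..1}. (y has_vector_derivative y' x) (at x within {0..1})) \<and>
    (AE x in lebesgue. x \<in> {0<..<1} \<longrightarrow>
      (\<exists>y''. (y' has_vector_derivative y'') (at x) \<and>
             - y'' + complex_of_real (q x) * y x = \<mu> * y x))"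

text \<open>The pairs \<open>(e, \<kappa>)\<close> such that the end \<open>x = \<kappa>\<close> of \<open>e\<close> is attached to \<open>v\<close>; a loop occurs twice.\<close>

definition edge_ends_at :: "('v, 'e) pre_digraph \<Rightarrow> 'v \<Rightarrow> ('e \<times> real) set" where
  "edge_ends_at G v = out_arcs G v \<times> {0} \<union> in_arcs G v \<times> {1}"

definition standard_matching ::
    "('v, 'e) pre_digraph \<Rightarrow> ('e \<Rightarrow> real \<Rightarrow> complex) \<Rightarrow> ('e \<Rightarrow> real \<Rightarrow> complex) \<Rightarrow> bool" where
  "standard_matching G y y' \<longleftrightarrow>
    (\<forall>v\<in>verts G.
      (\<forall>(j, \<kappa>)\<in>edge_ends_at G v. \<forall>(k, \<kappa>')\<in>edge_ends_at G v. y j \<kappa> = y k \<kappa>') \<and>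
      (\<Sum>j\<in>out_arcs G v. y' j 0) = (\<Sum>j\<in>in_arcs G v. y' j 1))"

definition graph_eigenvalue ::
    "('v, 'e) pre_digraph \<Rightarrow> ('e \<Rightarrow> real \<Rightarrow> real) \<Rightarrow> complex \<Rightarrow> bool" where
  "graph_eigenvalue G q \<mu> \<longleftrightarrow>
    (\<exists>y y'. (\<forall>e\<in>arcs G. edge_solution (q e) \<mu> (y e) (y' e)) \<and>
            standard_matching G y y' \<and>
            (\<exists>e\<in>arcs G. \<exists>x\<in>{0<..<1}. y e x \<noteq> 0))"

text \<open>
  A spectral determinant is determined only up to normalisation; any function whose zeros are
  exactly the spectrum counts.
\<close>

definition spectral_determinant ::
    "('v, 'e) pre_digraph \<Rightarrow> ('e \<Rightarrow> real \<Rightarrow> real) \<Rightarrow> (complex \<Rightarrow> complex) \<Rightarrow> bool" where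
  "spectral_determinant G q \<Delta> \<longleftrightarrow> (\<forall>\<mu>. \<Delta> \<mu> = 0 \<longleftrightarrow> graph_eigenvalue G q \<mu>)"

definition mean_potential :: "('v, 'e) pre_digraph \<Rightarrow> ('e \<Rightarrow> real \<Rightarrow> real) \<Rightarrow> real" where
  "mean_potential G q = (1 / card (arcs G)) * (\<Sum>e\<in>arcs G. integral {0<..<1} (q e))"

end

theory Submission
  imports Defs "HOL-Complex_Analysis.Great_Picard" "HOL-Real_Asymp.Real_Asymp"
begin

text \<open>
  Let \<open>m\<close> be the mean potential, \<open>Q = q - m\<close>, \<open>z = n \<pi>\<close>, and let \<open>\<sigma>\<close> be a choice of signs at the
  vertices with \<open>\<sigma> (head e) = cos z \<cdot> \<sigma> (tail e)\<close>: constant if \<open>n\<close> is even, the two colours of a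
  bipartite graph if \<open>n\<close> is odd.  Then \<open>\<psi> = \<sigma> (tail e) cos (z x)\<close> satisfies the matching conditions.
  Suppose that \<open>z\<^sup>2 + m\<close> is not an eigenvalue, and let \<open>u\<close> be the image of \<open>\<psi>\<close> under the resolvent \<open>R\<close>
  at \<open>z\<^sup>2 + m\<close>.  Integration by parts gives \<open>\<langle>\<psi>, \<psi>\<rangle> = \<Sum>\<^sub>e \<integral> Q \<psi> u\<close>.  For large \<open>z\<close>,
  \<open>u\<close> is on every edge a combination of \<open>cos (z x)\<close> and \<open>sin (z x)\<close> up to \<open>O(1/z)\<close>, and \<open>\<sigma> u\<close> is constant
  on the vertices up to \<open>O(1/z)\<close>.  Hence the right hand side is a multiple of \<open>\<Sum>\<^sub>e \<integral> Q = 0\<close> up to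
  \<open>o(1) (\<parallel>u\<parallel> + \<parallel>\<psi>\<parallel>)\<close>, by the Riemann-Lebesgue lemma.  So \<open>\<parallel>R \<psi>\<parallel> \<ge> \<parallel>\<psi>\<parallel> / \<epsilon>\<close> for every
  \<open>\<epsilon>\<close> and all large \<open>n\<close>.  As \<open>R\<close> is compact and symmetric, it has an eigenvalue of modulus at least
  \<open>1 / \<epsilon>\<close>, which is an eigenvalue of the graph problem at distance at most \<open>\<epsilon>\<close> from \<open>z\<^sup>2 + m\<close>.

  All functions are real-valued and continuous; the \<open>L\<^sup>2\<close> norm is used on them without completing
  the space.
\<close>

text \<open>Treating \<psi> as an approximate eigenfunction fails: its residual is
  \<open>Q \<psi>\<close>, which is not small and, for merely integrable \<open>Q\<close>, need not
  be square integrable. Only its pairing with solutions \<open>u\<close> can be small. Perturbation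
  of the free eigenvalue \<open>z\<^sup>2\<close> meets another obstacle: it may be multiple, with
  sines among its eigenfunctions, and these may move by other amounts. The pairing separates \<psi>
  from them. The product of cosine and sine is half of \<open>sin (2 z x)\<close>, so the sine part
  of \<open>u\<close> meets \<open>Q\<close> in an oscillating integral only, whereas the square of
  the cosine has mean 1/2. The cosine coefficients are values at vertices; as
  \<open>sin z = 0\<close>, an edge transports them by the factor \<open>cos z\<close>, which
  \<sigma> compensates. The error terms are at first proportional to the Cauchy data of
  \<open>u\<close>, not to its norm. At \<open>sin z = 0\<close> cosine and sine are orthogonal on
  each edge and of equal norm, so the data are bounded in turn by the L2 norms of \<open>u\<close>
  and \<psi>. Symmetry of \<open>R\<close> is what turns a large value on one vector into a large
  eigenvalue.\<close>

section \<open>Indefinite integrals\<close>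

text \<open>
  Where the difference quotients stay away from \<open>f x\<close>, there are arbitrarily short intervals
  violating the estimate of Henstock's lemma; by Vitali's covering lemma they cover little.
\<close>

lemma indefinite_integral_derivative_ae:
  fixes f :: "real \<Rightarrow> real"
  assumes f: "f integrable_on {a..b}"
  shows "negligible {x \<in> {a<..<b}. \<not> ((\<lambda>y. integral {a..y} f) has_real_derivative f x) (at x)}"
proof -
  define F where "F = (\<lambda>y. integral {a..y} f)"
  define B where "B = (\<lambda>m::nat. {x \<in> {a<..<b}. \<forall>\<delta>>0. \<exists>y\<in>{a..b}. 0 < \<bar>y - x\<bar> \<and> \<bar>y - x\<bar> < \<delta> \<and>
      \<bar>F y - F x - f x * (y - x)\<bar> > \<bar>y - x\<bar> / Suc m})"
  have "negligible (B m)" for m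
    unfolding negligible_outer_le
  proof (intro allI impI)
    fix e :: real assume "e > 0"
    \<comment> \<open>The 5 pays for the enlargement of the balls in Vitali's lemma,
      \<open>Suc m\<close> for the threshold in \<open>B m\<close>.\<close>
    then have e5: "e / (5 * Suc m) > 0" by simp
    obtain \<gamma> where \<gamma>: "gauge \<gamma>"
      and hen: "\<And>p. \<lbrakk>p tagged_partial_division_of (cbox a b); \<gamma> fine p\<rbrakk> \<Longrightarrow>
             (\<Sum>(x,k)\<in>p. norm(measure lborel k *\<^sub>R f x - integral k f)) < e / (5 * Suc m)"
      by (rule Henstock_lemma[OF f[folded box_real(2)] e5]) (rule that)
    \<comment> \<open>The ball is the interval between \<open>x\<close> and \<open>y\<close>, given
      by its midpoint because the covering lemma is about balls; the tag \<open>x\<close> is an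
      endpoint of it.\<close>
    have "\<exists>y\<in>{a..b}. y \<noteq> x \<and> cball ((x + y) / 2) (\<bar>y - x\<bar> / 2) \<subseteq> \<gamma> x \<and>
      \<bar>F y - F x - f x * (y - x)\<bar> > \<bar>y - x\<bar> / Suc m" if x: "x \<in> B m" for x
    proof -
      obtain \<delta> where \<delta>: "\<delta> > 0" "ball x \<delta> \<subseteq> \<gamma> x"
        using \<gamma> unfolding gauge_def by (meson openE)
      then obtain y where y: "y \<in> {a..b}" "0 < \<bar>y - x\<bar>" "\<bar>y - x\<bar> < \<delta>"
        "\<bar>F y - F x - f x * (y - x)\<bar> > \<bar>y - x\<bar> / Suc m"
        using x unfolding B_def by blast
      moreover have "cball ((x + y) / 2) (\<bar>y - x\<bar> / 2) \<subseteq> ball x \<delta>"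
        using y(3) by (auto simp: dist_real_def abs_if field_simps split: if_splits)
      ultimately show ?thesis using \<delta> by (intro bexI[of _ y]) auto
    qed
    then obtain Y where Y: "\<And>x. x \<in> B m \<Longrightarrow> Y x \<in> {a..b}" "\<And>x. x \<in> B m \<Longrightarrow> Y x \<noteq> x"
      "\<And>x. x \<in> B m \<Longrightarrow> cball ((x + Y x) / 2) (\<bar>Y x - x\<bar> / 2) \<subseteq> \<gamma> x"
      "\<And>x. x \<in> B m \<Longrightarrow> \<bar>F (Y x) - F x - f x * (Y x - x)\<bar> > \<bar>Y x - x\<bar> / Suc m"
      by metis
    define K where "K x = cball ((x + Y x) / 2) (\<bar>Y x - x\<bar> / 2)" for x
    have Kmm: "K x = cbox (min x (Y x)) (max x (Y x))" for x
      by (auto simp: K_def dist_real_def min_def max_def abs_if field_simps split: if_splits)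
    have Bab: "x \<in> {a<..<b}" if "x \<in> B m" for x using that by (simp add: B_def)
    have Kx: "x \<in> K x" for x by (simp add: Kmm)
    have "B m \<subseteq> (\<Union>x\<in>B m. cball ((x + Y x) / 2) (\<bar>Y x - x\<bar> / 2))"
      using Kx unfolding K_def by blast
    moreover have "0 < \<bar>Y x - x\<bar> / 2 \<and> \<bar>Y x - x\<bar> / 2 \<le> b - a" if "x \<in> B m" for x
      using Y(1,2)[OF that] Bab[OF that] by (auto simp: abs_if)
    ultimately obtain C where C: "countable C" "C \<subseteq> B m"
      "pairwise (\<lambda>i j. disjnt (K i) (K j)) C"
      "B m \<subseteq> (\<Union>i\<in>C. cball ((i + Y i) / 2) (5 * (\<bar>Y i - i\<bar> / 2)))"
      unfolding K_def by (rule Vitali_covering_lemma_cballs)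
    define T where "T i = cball ((i + Y i) / 2) (5 * (\<bar>Y i - i\<bar> / 2))" for i
    have mT: "measure lebesgue (T i) = 5 * \<bar>Y i - i\<bar>" for i
      unfolding T_def cball_eq_atLeastAtMost by (simp add: field_simps)
    have bound: "measure lebesgue (\<Union>i\<in>D. T i) \<le> e" if D: "D \<subseteq> C" "finite D" for D
    proof -
      let ?p = "(\<lambda>x. (x, K x)) ` D"
      have inj: "inj_on (\<lambda>x. (x, K x)) D" by (auto simp: inj_on_def)
      have "?p tagged_partial_division_of (cbox a b)"
        unfolding tagged_partial_division_of_def
      proof (intro conjI allI impI)
        show "finite ?p" using D by simp
      next
        fix x L assume "(x, L) \<in> ?p"
        then have x: "x \<in> B m" "L = K x" using D C by auto
        then show "x \<in> L" "\<exists>a b. L = cbox a b" using Kx Kmm by blast+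
        show "L \<subseteq> cbox a b" using x Y(1)[of x] Bab[of x] by (auto simp: Kmm)
      next
        fix x1 K1 x2 K2 assume "(x1, K1) \<in> ?p \<and> (x2, K2) \<in> ?p \<and> (x1, K1) \<noteq> (x2, K2)"
        then obtain i j where "i \<in> C" "j \<in> C" "i \<noteq> j" "K1 = K i" "K2 = K j"
          using D(1) by blast
        then have "disjnt K1 K2" using C(3) by (simp add: pairwise_def)
        then show "interior K1 \<inter> interior K2 = {}"
          using interior_subset unfolding disjnt_def by blast
      qed
      moreover have "\<gamma> fine ?p"
        using Y(3) D C by (auto simp: fine_def K_def)
      ultimately have s: "sum (\<lambda>(x,k). norm(measure lborel k *\<^sub>R f x - integral k f)) ?p < e / (5 * Suc m)"
        by (rule hen)
      \<comment> \<open>Each chosen interval contributes at least its length over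
        \<open>Suc m\<close> to the Henstock sum, so that sum bounds the total length.\<close>
      have "(\<Sum>i\<in>D. \<bar>Y i - i\<bar> / Suc m) \<le> (\<Sum>i\<in>D. norm(measure lborel (K i) *\<^sub>R f i - integral (K i) f))"
      proof (rule sum_mono)
        fix i assume "i \<in> D"
        then have i: "i \<in> B m" using D C by auto
        have ab: "a < i" "i < b" "a \<le> Y i" "Y i \<le> b" using Bab[OF i] Y(1)[OF i] by auto
        have comb: "integral {a..u} f + integral {u..v} f = integral {a..v} f"
          if "a \<le> u" "u \<le> v" "v \<le> b" for u v
          using that by (intro Henstock_Kurzweil_Integration.integral_combine integrable_on_subinterval[OF f]) auto
        have "norm(measure lborel (K i) *\<^sub>R f i - integral (K i) f) = \<bar>F (Y i) - F i - f i * (Y i - i)\<bar>"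
        proof (cases "i \<le> Y i")
          case True
          then show ?thesis using comb[of i "Y i"] ab by (simp add: Kmm F_def min_def max_def algebra_simps abs_minus_commute)
        next
          case False
          then show ?thesis using comb[of "Y i" i] ab by (simp add: Kmm F_def min_def max_def algebra_simps abs_minus_commute)
        qed
        then show "\<bar>Y i - i\<bar> / Suc m \<le> norm(measure lborel (K i) *\<^sub>R f i - integral (K i) f)"
          using Y(4)[OF i] by linarith
      qed
      also have "\<dots> = sum (\<lambda>(x,k). norm(measure lborel k *\<^sub>R f x - integral k f)) ?p"
        by (subst sum.reindex[OF inj]) simp
      finally have "(\<Sum>i\<in>D. \<bar>Y i - i\<bar>) / Suc m < e / (5 * Suc m)"
        using s by (simp add: sum_divide_distrib)
      then have "(\<Sum>i\<in>D. \<bar>Y i - i\<bar>) < e / (5 * Suc m) * Suc m"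
        by (simp only: pos_divide_less_eq of_nat_0_less_iff zero_less_Suc)
      also have "\<dots> = e / 5" by (simp only: of_nat_mult) (simp del: of_nat_Suc)
      finally have *: "5 * (\<Sum>i\<in>D. \<bar>Y i - i\<bar>) < e" by simp
      have "measure lebesgue (\<Union>i\<in>D. T i) \<le> (\<Sum>i\<in>D. measure lebesgue (T i))"
        using D by (intro measure_UNION_le) (auto simp: T_def)
      also have "\<dots> = 5 * (\<Sum>i\<in>D. \<bar>Y i - i\<bar>)" by (simp add: mT sum_distrib_left)
      finally show ?thesis using * by simp
    qed
    \<comment> \<open>The bound is the same for all finite subsets of \<open>C\<close>, so it passes
      to the countable union.\<close>
    have "T i \<in> lmeasurable" for i by (simp add: T_def)
    then have "(\<Union>i\<in>C. T i) \<in> lmeasurable" "measure lebesgue (\<Union>i\<in>C. T i) \<le> e"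
      using fmeasurable_UN_bound[OF C(1) _ bound] measure_UN_bound[OF C(1) _ bound] by auto
    then show "\<exists>T. B m \<subseteq> T \<and> T \<in> lmeasurable \<and> measure lebesgue T \<le> e"
      using C(4) unfolding T_def by blast
  qed
  then have "negligible (\<Union>m. B m)" by (intro negligible_countable_Union) auto
  moreover have "{x \<in> {a<..<b}. \<not> (F has_real_derivative f x) (at x)} \<subseteq> (\<Union>m. B m)"
  proof (rule subsetI, rule ccontr)
    fix x assume x: "x \<in> {x \<in> {a<..<b}. \<not> (F has_real_derivative f x) (at x)}" "x \<notin> (\<Union>m. B m)"
    have "(F has_derivative (\<lambda>h. h * f x)) (at x)"
      unfolding has_derivative_at_alt
    proof (intro conjI allI impI)
      show "bounded_linear (\<lambda>h. h * f x)" by (rule bounded_linear_mult_left)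
      fix e :: real assume "e > 0"
      then obtain m where m: "inverse (real (Suc m)) < e" using reals_Archimedean by blast
      have "x \<notin> B m" "x \<in> {a<..<b}" using x by blast+
      then have "\<exists>\<delta>>0. \<forall>y\<in>{a..b}. \<not> (0 < \<bar>y - x\<bar> \<and> \<bar>y - x\<bar> < \<delta> \<and>
          \<bar>F y - F x - f x * (y - x)\<bar> > \<bar>y - x\<bar> / Suc m)"
        unfolding B_def by blast
      then obtain \<delta> where \<delta>: "\<delta> > 0" and D0: "\<And>y. y \<in> {a..b} \<Longrightarrow> \<not> (0 < \<bar>y - x\<bar> \<and> \<bar>y - x\<bar> < \<delta> \<and>
          \<bar>F y - F x - f x * (y - x)\<bar> > \<bar>y - x\<bar> / Suc m)"
        by blast
      have D: "\<bar>F y - F x - f x * (y - x)\<bar> \<le> \<bar>y - x\<bar> / Suc m"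
        if "y \<in> {a..b}" "0 < \<bar>y - x\<bar>" "\<bar>y - x\<bar> < \<delta>" for y
        using D0[OF that(1)] that(2,3) by linarith
      show "\<exists>d>0. \<forall>y. norm (y - x) < d \<longrightarrow> norm (F y - F x - (y - x) * f x) \<le> e * norm (y - x)"
      proof (intro exI[of _ "min \<delta> (min (x - a) (b - x))"] conjI allI impI)
        show "0 < min \<delta> (min (x - a) (b - x))" using \<delta> x by auto
        fix y assume y: "norm (y - x) < min \<delta> (min (x - a) (b - x))"
        show "norm (F y - F x - (y - x) * f x) \<le> e * norm (y - x)"
        proof (cases "y = x")
          case False
          have "\<bar>F y - F x - f x * (y - x)\<bar> \<le> \<bar>y - x\<bar> / Suc m"
            using y False by (intro D) (auto simp: abs_if split: if_splits)
          also have "\<dots> \<le> e * \<bar>y - x\<bar>"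
            using m mult_right_mono[of "inverse (real (Suc m))" e "\<bar>y - x\<bar>"] 
            by (simp add: field_simps del: of_nat_Suc)
          finally show ?thesis by (simp add: mult.commute)
        qed simp
      qed
    qed
    then show False using x by (simp add: has_field_derivative_def mult.commute[of _ "f x"])
  qed
  ultimately show ?thesis unfolding F_def by (rule negligible_subset)
qed

text \<open>Density of continuous functions in L1, by two dominated limits: \<open>f\<close> is
  truncated at a level \<open>m\<close>, with |f| as majorant, and the truncation is approximated by
  continuous functions truncated at the same level, with the constant \<open>2 * m\<close> as
  majorant.\<close>

lemma absolutely_integrable_approx_continuous:
  fixes f :: "real \<Rightarrow> real"
  assumes f: "f absolutely_integrable_on {a..b}" and "e > 0"
  obtains g where "continuous_on UNIV g" "integral {a..b} (\<lambda>x. \<bar>f x - g x\<bar>) < e"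
proof -
  define c where "c m t = max (- real m) (min (real m) t)" for m :: nat and t
  have absf: "(\<lambda>x. \<bar>f x\<bar>) integrable_on {a..b}"
    using f unfolding absolutely_integrable_on_def by simp
  have fm: "(\<lambda>x. c m (f x)) absolutely_integrable_on {a..b}" for m
    unfolding c_def by (intro absolutely_integrable_max_1 absolutely_integrable_min_1 f absolutely_integrable_on_const) auto
  have d: "(\<lambda>x. \<bar>f x - c m (f x)\<bar>) integrable_on {a..b}" for m
    using set_integral_diff(1)[OF f fm[of m]] unfolding absolutely_integrable_on_def by simp
  have "(\<lambda>m. integral {a..b} (\<lambda>x. \<bar>f x - c m (f x)\<bar>)) \<longlonglongrightarrow> integral {a..b} (\<lambda>x. 0)"
  proof (rule dominated_convergence(2)[OF d absf])
    fix x show "(\<lambda>m. \<bar>f x - c m (f x)\<bar>) \<longlonglongrightarrow> 0"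
    proof (rule tendsto_eventually)
      obtain N where "\<bar>f x\<bar> \<le> real N" using real_arch_simple by blast
      then show "\<forall>\<^sub>F m in sequentially. \<bar>f x - c m (f x)\<bar> = 0"
        by (intro eventually_sequentiallyI[of N]) (auto simp: c_def max_def min_def)
    qed
  qed (auto simp: c_def max_def min_def abs_if)
  then have "\<forall>\<^sub>F m in sequentially. integral {a..b} (\<lambda>x. \<bar>f x - c m (f x)\<bar>) < e / 2"
    using \<open>e > 0\<close> by (intro order_tendstoD(2)) auto
  then obtain m where m: "integral {a..b} (\<lambda>x. \<bar>f x - c m (f x)\<bar>) < e / 2"
    by (auto simp: eventually_sequentially)
  have "f \<in> borel_measurable (lebesgue_on {a..b})"
    using absolutely_integrable_imp_borel_measurable[OF f] by simp
  then have "f measurable_on {a..b}" by (simp add: measurable_on_iff_borel_measurable)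
  then obtain N g where N: "negligible N" and g: "\<And>n. continuous_on UNIV (g n)"
    and lim: "\<And>x. x \<notin> N \<Longrightarrow> (\<lambda>n. g n x) \<longlonglongrightarrow> (if x \<in> {a..b} then f x else 0)"
    unfolding measurable_on_def by blast
  have cg: "continuous_on UNIV (\<lambda>x. c m (g n x))" for n
    unfolding c_def by (intro continuous_intros g)
  then have cgi: "(\<lambda>x. c m (g n x)) absolutely_integrable_on {a..b}" for n
    by (intro absolutely_integrable_continuous_real continuous_on_subset[OF cg]) auto
  have d2: "(\<lambda>x. \<bar>c m (f x) - c m (g n x)\<bar>) integrable_on {a..b}" for n
    using set_integral_diff(1)[OF fm[of m] cgi[of n]] unfolding absolutely_integrable_on_def by simp
  \<comment> \<open>Pointwise convergence is known only off \<open>N\<close>, hence the detour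
    through \<open>{a..b} - N\<close>.\<close>
  have d3: "(\<lambda>x. \<bar>c m (f x) - c m (g n x)\<bar>) integrable_on ({a..b} - N)" for n
    by (rule integrable_spike_set[OF d2[of n]]; rule negligible_subset[OF N]) auto
  have "(\<lambda>x. 2 * real m) integrable_on ({a..b} - N)"
    by (rule integrable_spike_set[OF integrable_const_ivl[of "2 * real m" a b]]; rule negligible_subset[OF N]) auto
  then have "(\<lambda>n. integral ({a..b} - N) (\<lambda>x. \<bar>c m (f x) - c m (g n x)\<bar>)) \<longlonglongrightarrow> integral ({a..b} - N) (\<lambda>x. 0)"
  proof (rule dominated_convergence(2)[OF d3])
    fix x assume "x \<in> {a..b} - N"
    then have "(\<lambda>n. g n x) \<longlonglongrightarrow> f x" using lim[of x] by simp
    then have "(\<lambda>n. \<bar>c m (f x) - c m (g n x)\<bar>) \<longlonglongrightarrow> \<bar>c m (f x) - c m (f x)\<bar>"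
      unfolding c_def by (intro tendsto_intros)
    then show "(\<lambda>n. \<bar>c m (f x) - c m (g n x)\<bar>) \<longlonglongrightarrow> 0" by simp
  qed (auto simp: c_def max_def min_def abs_if)
  moreover have "integral ({a..b} - N) (\<lambda>x. \<bar>c m (f x) - c m (g n x)\<bar>) = integral {a..b} (\<lambda>x. \<bar>c m (f x) - c m (g n x)\<bar>)" for n
    by (rule integral_spike_set; rule negligible_subset[OF N]) auto
  ultimately have "(\<lambda>n. integral {a..b} (\<lambda>x. \<bar>c m (f x) - c m (g n x)\<bar>)) \<longlonglongrightarrow> 0" by simp
  then have "\<forall>\<^sub>F n in sequentially. integral {a..b} (\<lambda>x. \<bar>c m (f x) - c m (g n x)\<bar>) < e / 2"
    using \<open>e > 0\<close> by (intro order_tendstoD(2)) auto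
  then obtain n where n: "integral {a..b} (\<lambda>x. \<bar>c m (f x) - c m (g n x)\<bar>) < e / 2"
    by (auto simp: eventually_sequentially)
  have 1: "integral {a..b} (\<lambda>x. \<bar>f x - c m (g n x)\<bar>) \<le>
    integral {a..b} (\<lambda>x. \<bar>f x - c m (f x)\<bar> + \<bar>c m (f x) - c m (g n x)\<bar>)"
  proof (rule integral_le)
    show "(\<lambda>x. \<bar>f x - c m (g n x)\<bar>) integrable_on {a..b}"
      using set_integral_diff(1)[OF f cgi[of n]] unfolding absolutely_integrable_on_def by simp
    show "(\<lambda>x. \<bar>f x - c m (f x)\<bar> + \<bar>c m (f x) - c m (g n x)\<bar>) integrable_on {a..b}"
      by (rule integrable_add[OF d d2])
  qed linarith
  have 2: "integral {a..b} (\<lambda>x. \<bar>f x - c m (f x)\<bar> + \<bar>c m (f x) - c m (g n x)\<bar>) = integral {a..b} (\<lambda>x. \<bar>f x - c m (f x)\<bar>) + integral {a..b} (\<lambda>x. \<bar>c m (f x) - c m (g n x)\<bar>)"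
    by (rule integral_add[OF d d2])
  from 1 2 m n have "integral {a..b} (\<lambda>x. \<bar>f x - c m (g n x)\<bar>) < e" by linarith
  with cg show ?thesis by (rule that)
qed

text \<open>
  No differentiability of \<open>integral {a..x} h\<close> is needed: the difference \<open>D\<close> of the two sides has
  derivative \<open>0\<close> at every point.
\<close>

lemma integral_by_parts_indefinite:
  fixes h w w' :: "real \<Rightarrow> real"
  assumes h: "h absolutely_integrable_on {a..b}"
    and w: "\<And>x. x \<in> {a..b} \<Longrightarrow> (w has_real_derivative w' x) (at x within {a..b})"
    and w': "continuous_on {a..b} w'"
    and x: "x \<in> {a..b}"
  shows "integral {a..x} (\<lambda>t. w t * h t) =
    w x * integral {a..x} h - integral {a..x} (\<lambda>t. w' t * integral {a..t} h)"
proof -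
  define H where "H t = integral {a..t} h" for t
  define A where "A t = integral {a..t} (\<lambda>t. \<bar>h t\<bar>)" for t
  have hi: "h integrable_on {a..b}" and ha: "(\<lambda>t. \<bar>h t\<bar>) integrable_on {a..b}"
    using h unfolding absolutely_integrable_on_def by auto
  have cw: "continuous_on {a..b} w"
    using w by (meson DERIV_continuous continuous_on_eq_continuous_within)
  have cH: "continuous_on {a..b} H" and cA: "continuous_on {a..b} A"
    unfolding H_def A_def by (intro indefinite_integral_continuous_1 hi ha)+
  have bw: "bounded (w ` {a..b})" by (intro compact_imp_bounded compact_continuous_image cw) auto
  have wh: "(\<lambda>t. w t * h t) absolutely_integrable_on {a..b}"
    by (rule absolutely_integrable_bounded_measurable_product_real[OF _ _ bw h])
      (auto intro: continuous_imp_measurable_on_sets_lebesgue cw)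
  then have whi: "(\<lambda>t. w t * h t) integrable_on {a..b}"
    unfolding absolutely_integrable_on_def by auto
  have "bounded (w' ` {a..b})" by (intro compact_imp_bounded compact_continuous_image w') auto
  then obtain L where L: "\<And>t. t \<in> {a..b} \<Longrightarrow> \<bar>w' t\<bar> \<le> L"
    unfolding bounded_iff by (metis image_eqI real_norm_def)
  have lip: "\<bar>w t - w s\<bar> \<le> L * \<bar>t - s\<bar>" if "t \<in> {a..b}" "s \<in> {a..b}" for t s
    using field_differentiable_bound[of "{a..b}" w w' L t s] w L that by auto
  define D where "D y = integral {a..y} (\<lambda>t. w t * h t) - w y * H y + integral {a..y} (\<lambda>t. w' t * H t)" for y
  have "(D has_real_derivative 0) (at x within {a..b})" if x: "x \<in> {a..b}" for x
  proof -
    \<comment> \<open>\<open>D\<close> is \<open>E\<close> plus a function that is differentiable in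
      the classical sense. Freezing \<open>H x\<close> makes \<open>E\<close> flat at
      \<open>x\<close>: its increment is bounded by \<open>L\<close> times |y - x| times an
      increment of the continuous function \<open>A\<close>.\<close>
    define E where "E y = integral {a..y} (\<lambda>t. w t * h t) - w y * (H y - H x)" for y
    have ord: "\<bar>integral {u..v} (\<lambda>t. w t * h t) - w c * (H v - H u)\<bar> \<le> L * (v - u) * \<bar>A v - A u\<bar>"
      if "a \<le> u" "u \<le> v" "v \<le> b" "c \<in> {u..v}" for u v c
    proof -
      have i: "(\<lambda>t. w t * h t) integrable_on {u..v}" "h integrable_on {u..v}" "(\<lambda>t. \<bar>h t\<bar>) integrable_on {u..v}"
        using that by (auto intro: integrable_on_subinterval[OF whi] integrable_on_subinterval[OF hi] integrable_on_subinterval[OF ha])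
      have 2: "H u + integral {u..v} h = H v"
        unfolding H_def using that by (intro Henstock_Kurzweil_Integration.integral_combine integrable_on_subinterval[OF hi]) auto
      have 3: "A u + integral {u..v} (\<lambda>t. \<bar>h t\<bar>) = A v"
        unfolding A_def using that by (intro Henstock_Kurzweil_Integration.integral_combine integrable_on_subinterval[OF ha]) auto
      have "integral {u..v} (\<lambda>t. w t * h t) - w c * (H v - H u) = integral {u..v} (\<lambda>t. w t * h t) - w c * integral {u..v} h"
        by (simp flip: 2)
      also have "\<dots> = integral {u..v} (\<lambda>t. w t * h t - w c * h t)"
        using integral_diff[OF i(1) integrable_cmul[OF i(2), of "w c"]] by simp
      also have "\<bar>\<dots>\<bar> \<le> integral {u..v} (\<lambda>t. L * (v - u) * \<bar>h t\<bar>)"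
        unfolding real_norm_def[symmetric]
      proof (rule integral_norm_bound_integral)
        show "(\<lambda>t. w t * h t - w c * h t) integrable_on {u..v}"
          using i by (intro integrable_diff integrable_on_mult_right)
        show "(\<lambda>t. L * (v - u) * norm (h t)) integrable_on {u..v}"
          using i by (intro integrable_on_mult_right) simp
        fix t assume t: "t \<in> {u..v}"
        have "\<bar>w t - w c\<bar> \<le> L * \<bar>t - c\<bar>" using lip t that by auto
        also have "\<dots> \<le> L * (v - u)"
          using t that L[of u] by (intro mult_left_mono) auto
        finally show "norm (w t * h t - w c * h t) \<le> L * (v - u) * norm (h t)"
          by (simp add: left_diff_distrib[symmetric] abs_mult mult_right_mono)
      qed
      also have "\<dots> = L * (v - u) * (A v - A u)" using 3 by auto
      also have "\<dots> \<le> L * (v - u) * \<bar>A v - A u\<bar>"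
        using that L[of u] by (intro mult_left_mono) auto
      finally show ?thesis .
    qed
    have comb: "integral {a..u} (\<lambda>t. w t * h t) + integral {u..v} (\<lambda>t. w t * h t) = integral {a..v} (\<lambda>t. w t * h t)"
      if "a \<le> u" "u \<le> v" "v \<le> b" for u v
      using that by (intro Henstock_Kurzweil_Integration.integral_combine integrable_on_subinterval[OF whi]) auto
    have bnd: "\<bar>E y - E x\<bar> \<le> L * \<bar>y - x\<bar> * \<bar>A y - A x\<bar>" if y: "y \<in> {a..b}" for y
    proof (cases "x \<le> y")
      case True
      then have "E y - E x = integral {x..y} (\<lambda>t. w t * h t) - w y * (H y - H x)"
        unfolding E_def using comb[of x y] x y by simp
      then show ?thesis using ord[of x y y] x y True by simp
    next
      case False
      then have "E x - E y = integral {y..x} (\<lambda>t. w t * h t) - w y * (H x - H y)"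
        unfolding E_def using comb[of y x] x y by (simp add: algebra_simps)
      then show ?thesis using ord[of y x y] x y False by (simp add: abs_minus_commute)
    qed
    have "(E has_real_derivative 0) (at x within {a..b})"
      unfolding has_field_derivative_iff
    proof (rule Lim_null_comparison)
      show "\<forall>\<^sub>F y in at x within {a..b}. norm ((E y - E x) / (y - x)) \<le> L * \<bar>A y - A x\<bar>"
        unfolding eventually_at_filter
      proof (rule always_eventually, intro allI impI)
        fix y assume "y \<noteq> x" "y \<in> {a..b}"
        then show "norm ((E y - E x) / (y - x)) \<le> L * \<bar>A y - A x\<bar>"
          using bnd[of y] by (simp add: divide_le_eq algebra_simps)
      qed
      have "((\<lambda>y. L * \<bar>A y - A x\<bar>) \<longlongrightarrow> L * \<bar>A x - A x\<bar>) (at x within {a..b})"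
        using cA x unfolding continuous_on_def by (intro tendsto_intros) auto
      then show "((\<lambda>y. L * \<bar>A y - A x\<bar>) \<longlongrightarrow> 0) (at x within {a..b})" by simp
    qed
    moreover have "((\<lambda>y. integral {a..y} (\<lambda>t. w' t * H t)) has_real_derivative w' x * H x) (at x within {a..b})"
      by (intro integral_has_real_derivative continuous_intros w' cH x)
    ultimately have "((\<lambda>y. E y + (integral {a..y} (\<lambda>t. w' t * H t) - w y * H x)) has_real_derivative
        0 + (w' x * H x - w' x * H x)) (at x within {a..b})"
      by (intro derivative_intros DERIV_cmult_right w[OF x])
    moreover have "(\<lambda>y. E y + (integral {a..y} (\<lambda>t. w' t * H t) - w y * H x)) = D"
      by (auto simp: D_def E_def algebra_simps)
    ultimately show ?thesis by simp
  qed
  then obtain c where "\<And>y. y \<in> {a..b} \<Longrightarrow> D y = c"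
    using has_field_derivative_zero_constant[of "{a..b}" D] by auto
  moreover have "D a = 0" by (simp add: D_def H_def)
  ultimately have "D x = 0" using x by auto
  then show ?thesis by (simp add: D_def H_def)
qed

text \<open>Approximation in L1 by a bounded \<open>k\<close> splits the variation:
  \<open>g - k\<close> contributes less than \<open>\<epsilon> / 2\<close> on any family of
  intervals, and \<open>k\<close> at most \<open>M\<close> times their total length.\<close>

lemma abs_continuous_indefinite_integral:
  fixes g f :: "real \<Rightarrow> real"
  assumes g: "g absolutely_integrable_on {a..b}"
    and f: "\<And>x. x \<in> {a..b} \<Longrightarrow> f x = c + integral {a..x} g"
  shows "abs_continuous_on_Icc a b (\<lambda>x. complex_of_real (f x))"
  unfolding abs_continuous_on_Icc_def
proof (intro allI impI)
  fix \<epsilon> :: real assume "\<epsilon> > 0"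
  then obtain k where k: "continuous_on UNIV k" "integral {a..b} (\<lambda>x. \<bar>g x - k x\<bar>) < \<epsilon> / 2"
    using absolutely_integrable_approx_continuous[OF g, of "\<epsilon> / 2"] by auto
  have ck: "continuous_on {a..b} k" using k(1) continuous_on_subset by blast
  have "bounded (k ` {a..b})" by (intro compact_imp_bounded compact_continuous_image ck) auto
  then obtain M where M: "M > 0" "\<And>t. t \<in> {a..b} \<Longrightarrow> \<bar>k t\<bar> \<le> M"
    unfolding bounded_pos by auto
  have gk: "(\<lambda>x. \<bar>g x - k x\<bar>) integrable_on {a..b}"
    using set_integral_diff(1)[OF g absolutely_integrable_continuous_real[OF ck]]
    unfolding absolutely_integrable_on_def by simp
  have gi: "g integrable_on {a..b}" using g unfolding absolutely_integrable_on_def by simp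
  show "\<exists>\<delta>>0. \<forall>D. D division_of \<Union> D \<and> \<Union> D \<subseteq> {a..b} \<and> (\<Sum>K\<in>D. Sup K - Inf K) < \<delta> \<longrightarrow>
             (\<Sum>K\<in>D. norm (complex_of_real (f (Sup K)) - complex_of_real (f (Inf K)))) < \<epsilon>"
  proof (intro exI[of _ "\<epsilon> / (2 * M)"] conjI allI impI)
    show "0 < \<epsilon> / (2 * M)" using \<open>\<epsilon> > 0\<close> M by simp
    fix D assume D: "D division_of \<Union> D \<and> \<Union> D \<subseteq> {a..b} \<and> (\<Sum>K\<in>D. Sup K - Inf K) < \<epsilon> / (2 * M)"
    then have div: "D division_of \<Union> D" and sub: "\<Union> D \<subseteq> {a..b}" by auto
    have K: "norm (complex_of_real (f (Sup K)) - complex_of_real (f (Inf K))) \<le>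
      integral K (\<lambda>x. \<bar>g x - k x\<bar>) + M * (Sup K - Inf K)" if KD: "K \<in> D" for K
    proof -
      obtain u v where "K = cbox u v" using division_ofD(4)[OF div KD] by blast
      moreover have "K \<noteq> {}" using division_ofD(3)[OF div KD] .
      moreover have "K \<subseteq> {a..b}" using KD sub by blast
      ultimately have uv: "K = {u..v}" "u \<le> v" "{u..v} \<subseteq> {a..b}" by auto
      then have *: "a \<le> u" "v \<le> b" by auto
      have i: "g integrable_on {u..v}" "(\<lambda>x. \<bar>g x - k x\<bar>) integrable_on {u..v}"
        by (rule integrable_on_subinterval[OF gi] integrable_on_subinterval[OF gk], use uv in auto)+
      have "integral {a..u} g + integral {u..v} g = integral {a..v} g"
        using uv * by (intro Henstock_Kurzweil_Integration.integral_combine integrable_on_subinterval[OF gi]) auto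
      then have "f v - f u = integral {u..v} g" using f[of u] f[of v] uv * by auto
      moreover have "norm (integral {u..v} g) \<le> integral {u..v} (\<lambda>x. \<bar>g x - k x\<bar> + M)"
      proof (rule integral_norm_bound_integral)
        show "g integrable_on {u..v}" by (rule i)
        show "(\<lambda>x. \<bar>g x - k x\<bar> + M) integrable_on {u..v}"
          by (intro integrable_add i integrable_const_ivl)
        fix x assume "x \<in> {u..v}"
        then have "\<bar>k x\<bar> \<le> M" using M uv by auto
        then show "norm (g x) \<le> \<bar>g x - k x\<bar> + M" by (simp add: abs_if split: if_splits)
      qed
      moreover have "integral {u..v} (\<lambda>x. \<bar>g x - k x\<bar> + M) = integral {u..v} (\<lambda>x. \<bar>g x - k x\<bar>) + M * (v - u)"
        using uv by (subst integral_add[OF i(2) integrable_const_ivl]) simp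
      ultimately have "\<bar>f v - f u\<bar> \<le> integral {u..v} (\<lambda>x. \<bar>g x - k x\<bar>) + M * (v - u)"
        by (metis real_norm_def)
      moreover have "norm (complex_of_real (f v) - complex_of_real (f u)) = \<bar>f v - f u\<bar>"
        by (metis norm_of_real of_real_diff)
      ultimately show ?thesis using uv by simp
    qed
    have gU: "(\<lambda>x. \<bar>g x - k x\<bar>) integrable_on \<Union> D"
      by (rule integrable_on_subdivision[OF div gk sub])
    have "(\<Sum>K\<in>D. norm (complex_of_real (f (Sup K)) - complex_of_real (f (Inf K)))) \<le>
      (\<Sum>K\<in>D. integral K (\<lambda>x. \<bar>g x - k x\<bar>) + M * (Sup K - Inf K))"
      by (rule sum_mono) (rule K)
    also have "\<dots> = integral (\<Union> D) (\<lambda>x. \<bar>g x - k x\<bar>) + M * (\<Sum>K\<in>D. Sup K - Inf K)"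
      by (simp add: sum.distrib sum_distrib_left integral_combine_division_topdown[OF gU div])
    also have "\<dots> \<le> integral {a..b} (\<lambda>x. \<bar>g x - k x\<bar>) + M * (\<Sum>K\<in>D. Sup K - Inf K)"
      by (intro add_right_mono integral_subset_le sub gU gk) auto
    also have "M * (\<Sum>K\<in>D. Sup K - Inf K) < M * (\<epsilon> / (2 * M))"
      using D M by (intro mult_strict_left_mono) auto
    also have "M * (\<epsilon> / (2 * M)) = \<epsilon> / 2" using M by simp
    finally show "(\<Sum>K\<in>D. norm (complex_of_real (f (Sup K)) - complex_of_real (f (Inf K)))) < \<epsilon>"
      using k(2) by simp
  qed
qed

text \<open>Approximating \<open>Q\<close> in L1 by a continuous function, and this one uniformly by
  a polynomial, allows an integration by parts in which the bounded primitive \<open>F\<close> gains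
  the factor \<open>1 / w\<close>. With \<open>f\<close> and \<open>F\<close> abstract, cosine and
  sine are treated together.\<close>

lemma Riemann_Lebesgue_trig:
  fixes Q f F :: "real \<Rightarrow> real"
  assumes Q: "Q absolutely_integrable_on {0..1}"
    and F: "\<And>x. (F has_real_derivative f x) (at x)"
    and F1: "\<And>x. \<bar>F x\<bar> \<le> 1" and f1: "\<And>x. \<bar>f x\<bar> \<le> 1"
    and f: "continuous_on UNIV f"
    and om: "filterlim \<omega> at_top sequentially"
  shows "(\<lambda>n. integral {0..1} (\<lambda>x. Q x * f (\<omega> n * x))) \<longlonglongrightarrow> 0"
proof (rule tendstoI)
  fix e :: real assume e: "e > 0"
  obtain g where g: "continuous_on UNIV g" "integral {0..1} (\<lambda>x. \<bar>Q x - g x\<bar>) < e / 3"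
    using absolutely_integrable_approx_continuous[OF Q, of "e / 3"] e by auto
  have g01: "continuous_on {0..1} g" using g(1) continuous_on_subset by blast
  obtain p where p: "real_polynomial_function p" "\<And>x. x \<in> {0..1} \<Longrightarrow> \<bar>g x - p x\<bar> < e / 3"
    using Stone_Weierstrass_real_polynomial_function[of "{0..1::real}" g "e / 3"] g01 e by auto
  obtain p' where p': "real_polynomial_function p'" "\<And>x. (p has_real_derivative p' x) (at x)"
    using has_real_derivative_polynomial_function[OF p(1)] by auto
  have cp: "continuous_on {0..1} p" "continuous_on {0..1} p'"
    using p(1) p'(1) by (auto intro!: continuous_on_polymonial_function simp: real_polynomial_function_eq)
  have "bounded (p ` {0..1})" "bounded (p' ` {0..1})"
    by (intro compact_imp_bounded compact_continuous_image cp; simp)+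
  then obtain M1 M2 where M1: "\<And>t. t \<in> {0..1} \<Longrightarrow> \<bar>p t\<bar> \<le> M1" and M2: "\<And>t. t \<in> {0..1} \<Longrightarrow> \<bar>p' t\<bar> \<le> M2"
    unfolding bounded_iff image_iff real_norm_def by blast
  \<comment> \<open>Two boundary terms bounded by \<open>M1\<close>, and the integral of
    \<open>p' F\<close> bounded by \<open>M2\<close>.\<close>
  define M where "M = 2 * M1 + M2"
  have M: "M \<ge> 0" using M1[of 0] M2[of 0] by (simp add: M_def)
  have FC: "continuous_on UNIV F" using F by (meson DERIV_continuous continuous_at_imp_continuous_on)
  have part: "\<bar>integral {0..1} (\<lambda>x. p x * f (w * x))\<bar> \<le> M / w" if w: "w > 0" for w
  proof -
    have cF: "continuous_on {0..1} (\<lambda>x. F (w * x))" "continuous_on {0..1} (\<lambda>x. f (w * x))"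
      by (rule continuous_on_compose2[OF FC] continuous_on_compose2[OF f]; auto intro!: continuous_intros)+
    have i1: "(\<lambda>x. p' x * F (w * x)) integrable_on {0..1}" "(\<lambda>x. p x * f (w * x)) integrable_on {0..1}"
      by (intro integrable_continuous_real continuous_intros cp cF)+
    have "((\<lambda>x. p' x * (F (w * x) / w) + p x * f (w * x)) has_integral
        p 1 * (F (w * 1) / w) - p 0 * (F (w * 0) / w)) {0..1}"
    proof (rule fundamental_theorem_of_calculus)
      fix x :: real
      have "((\<lambda>x. F (w * x)) has_real_derivative f (w * x) * w) (at x within {0..1})"
        by (rule DERIV_chain2[OF F]) (auto intro!: derivative_eq_intros)
      then have "((\<lambda>x. F (w * x) / w) has_real_derivative f (w * x) * w / w) (at x within {0..1})"
        by (rule DERIV_cdivide)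
      then have d: "((\<lambda>x. F (w * x) / w) has_real_derivative f (w * x)) (at x within {0..1})"
        using w by simp
      have "((\<lambda>x. p x * (F (w * x) / w)) has_real_derivative p' x * (F (w * x) / w) + f (w * x) * p x) (at x within {0..1})"
        by (rule DERIV_mult[OF has_field_derivative_at_within[OF p'(2)] d])
      then show "((\<lambda>x. p x * (F (w * x) / w)) has_vector_derivative p' x * (F (w * x) / w) + p x * f (w * x)) (at x within {0..1})"
        by (simp add: has_real_derivative_iff_has_vector_derivative mult.commute)
    qed simp
    then have "integral {0..1} (\<lambda>x. p' x * (F (w * x) / w) + p x * f (w * x)) = 
       p 1 * (F (w * 1) / w) - p 0 * (F (w * 0) / w)"
      by (rule integral_unique)
    moreover have "integral {0..1} (\<lambda>x. p' x * (F (w * x) / w) + p x * f (w * x)) =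
        integral {0..1} (\<lambda>x. p' x * F (w * x) / w) + integral {0..1} (\<lambda>x. p x * f (w * x))"
      using integral_add[OF integrable_on_divide[OF i1(1), of w] i1(2)] by simp
    ultimately have eq: "integral {0..1} (\<lambda>x. p x * f (w * x)) =
      (p 1 * F w - p 0 * F 0 - integral {0..1} (\<lambda>x. p' x * F (w * x))) / w"
      by (simp add: diff_divide_distrib)
    have "norm (integral {0..1} (\<lambda>x. p' x * F (w * x))) \<le> integral {0..1} (\<lambda>x::real. M2)"
    proof (rule integral_norm_bound_integral[OF i1(1)])
      fix x :: real assume "x \<in> {0..1}"
      then show "norm (p' x * F (w * x)) \<le> M2"
        using mult_mono[OF M2[of x] F1[of "w * x"]] M2[of 0] by (simp add: abs_mult)
    qed auto
    moreover have "\<bar>p 1 * F w\<bar> \<le> M1" "\<bar>p 0 * F 0\<bar> \<le> M1"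
      using mult_mono[OF M1[of 1] F1[of w]] mult_mono[OF M1[of 0] F1[of 0]] M1[of 0] by (auto simp: abs_mult)
    ultimately have "\<bar>p 1 * F w - p 0 * F 0 - integral {0..1} (\<lambda>x. p' x * F (w * x))\<bar> \<le> M"
      by (simp add: M_def abs_if split: if_splits)
    then show ?thesis using w by (simp add: eq divide_right_mono)
  qed
  have gi: "g absolutely_integrable_on {0..1}" and pi: "p absolutely_integrable_on {0..1}"
    by (intro absolutely_integrable_continuous_real g01 cp)+
  have Qg: "(\<lambda>x. \<bar>Q x - g x\<bar>) integrable_on {0..1}" and gp: "(\<lambda>x. \<bar>g x - p x\<bar>) integrable_on {0..1}"
    using set_integral_diff(1)[OF Q gi] set_integral_diff(1)[OF gi pi]
    unfolding absolutely_integrable_on_def by simp_all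
  have cf: "continuous_on {0..1} (\<lambda>x. f (w * x))" for w
    by (rule continuous_on_compose2[OF f]; auto intro!: continuous_intros)
  have "(\<lambda>x. f (w * x) * Q x) absolutely_integrable_on {0..1}" for w
    using f1 by (intro absolutely_integrable_bounded_measurable_product_real[OF _ _ _ Q]
      continuous_imp_measurable_on_sets_lebesgue cf) (auto simp: bounded_iff)
  then have Qf: "(\<lambda>x. Q x * f (w * x)) integrable_on {0..1}" for w
    unfolding absolutely_integrable_on_def by (simp add: mult.commute[of "Q _"])
  have pf: "(\<lambda>x. p x * f (w * x)) integrable_on {0..1}" for w
    by (intro integrable_continuous_real continuous_intros cp cf)
  have diff: "\<bar>integral {0..1} (\<lambda>x. Q x * f (w * x)) - integral {0..1} (\<lambda>x. p x * f (w * x))\<bar> < 2 * e / 3" for w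
  proof -
    have "norm (integral {0..1} (\<lambda>x. Q x * f (w * x) - p x * f (w * x))) \<le>
        integral {0..1} (\<lambda>x. \<bar>Q x - g x\<bar> + e / 3)"
    proof (rule integral_norm_bound_integral)
      show "(\<lambda>x. Q x * f (w * x) - p x * f (w * x)) integrable_on {0..1}"
        by (rule integrable_diff[OF Qf pf])
      show "(\<lambda>x. \<bar>Q x - g x\<bar> + e / 3) integrable_on {0..1}"
        by (intro integrable_add Qg integrable_const_ivl)
      fix x :: real assume x: "x \<in> {0..1}"
      have "norm (Q x * f (w * x) - p x * f (w * x)) = \<bar>Q x - p x\<bar> * \<bar>f (w * x)\<bar>"
        by (simp add: left_diff_distrib[symmetric] abs_mult)
      also have "\<dots> \<le> \<bar>Q x - p x\<bar> * 1" by (intro mult_left_mono f1) simp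
      also have "\<dots> \<le> \<bar>Q x - g x\<bar> + e / 3"
        using p(2)[OF x] abs_triangle_ineq[of "Q x - g x" "g x - p x"] by simp
      finally show "norm (Q x * f (w * x) - p x * f (w * x)) \<le> \<bar>Q x - g x\<bar> + e / 3" .
    qed
    also have "\<dots> = integral {0..1} (\<lambda>x. \<bar>Q x - g x\<bar>) + e / 3"
      by (subst integral_add[OF Qg integrable_const_ivl]) simp
    finally show ?thesis using g(2) by (simp add: integral_diff[OF Qf pf])
  qed
  have "\<forall>\<^sub>F n in sequentially. \<omega> n > max 1 (3 * M / e)"
    using om unfolding filterlim_at_top_dense by blast
  then show "\<forall>\<^sub>F n in sequentially. dist (integral {0..1} (\<lambda>x. Q x * f (\<omega> n * x))) 0 < e"
  proof eventually_elim
    case (elim n)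
    then have w: "\<omega> n > 0" "3 * M / e < \<omega> n" by auto
    then have "M / \<omega> n < e / 3" using e by (simp add: field_simps)
    then have "\<bar>integral {0..1} (\<lambda>x. p x * f (\<omega> n * x))\<bar> < e / 3"
      using part[OF w(1)] by linarith
    then have "\<bar>integral {0..1} (\<lambda>x. Q x * f (\<omega> n * x))\<bar> < e" using diff[of "\<omega> n"] by linarith
    then show ?case by simp
  qed
qed

text \<open>The only passage from the integrated form of the equation, in which the analysis is
  done, to the form that holds almost everywhere. The exceptional set is where the indefinite
  integral of \<open>g\<close> fails to have derivative \<open>g\<close>.\<close>

lemma edge_solution_of_real:
  fixes g w w' :: "real \<Rightarrow> real"
  assumes g: "g absolutely_integrable_on {0..1}"
    and w: "\<And>x. x \<in> {0..1} \<Longrightarrow> (w has_real_derivative w' x) (at x within {0..1})"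
    and w': "\<And>x. x \<in> {0..1} \<Longrightarrow> w' x = w' 0 + integral {0..x} g"
    and eq: "\<And>x. x \<in> {0<..<1} \<Longrightarrow> g x = (q x - \<mu>) * w x"
  shows "edge_solution q (of_real \<mu>) (\<lambda>x. of_real (w x)) (\<lambda>x. of_real (w' x))"
  unfolding edge_solution_def
proof (intro conjI ballI)
  have gi: "g integrable_on {0..1}" using g unfolding absolutely_integrable_on_def by simp
  have "continuous_on {0..1} (\<lambda>x. w' 0 + integral {0..x} g)"
    by (intro continuous_intros indefinite_integral_continuous_1 gi)
  then have cw': "continuous_on {0..1} w'" by (rule continuous_on_eq) (rule w'[symmetric])
  show "abs_continuous_on_Icc 0 1 (\<lambda>x. complex_of_real (w x))"
  proof (rule abs_continuous_indefinite_integral[where g = w' and c = "w 0"])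
    show "w' absolutely_integrable_on {0..1}" by (rule absolutely_integrable_continuous_real[OF cw'])
    fix x :: real assume x: "x \<in> {0..1}"
    have "(w' has_integral w x - w 0) {0..x}"
    proof (rule fundamental_theorem_of_calculus)
      fix y assume "y \<in> {0..x}"
      then show "(w has_vector_derivative w' y) (at y within {0..x})"
        using DERIV_subset[OF w[of y], of "{0..x}"] x 
        by (simp add: has_real_derivative_iff_has_vector_derivative subset_iff)
    qed (use x in auto)
    then show "w x = w 0 + integral {0..x} w'" by (simp add: integral_unique)
  qed
  show "abs_continuous_on_Icc 0 1 (\<lambda>x. complex_of_real (w' x))"
    by (rule abs_continuous_indefinite_integral[OF g w'])
  show "((\<lambda>x. complex_of_real (w x)) has_vector_derivative complex_of_real (w' x)) (at x within {0..1})"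
    if "x \<in> {0..1}" for x
    using w[OF that] by (rule has_vector_derivative_of_real)
  let ?N = "{x \<in> {0<..<1}. \<not> ((\<lambda>y. integral {0..y} g) has_real_derivative g x) (at x)}"
  have "negligible ?N" by (rule indefinite_integral_derivative_ae[OF gi])
  then have "AE x in lebesgue. x \<notin> ?N"
    by (intro AE_not_in) (simp add: negligible_iff_null_sets)
  then show "AE x in lebesgue. x \<in> {0<..<1} \<longrightarrow> (\<exists>y''. ((\<lambda>x. complex_of_real (w' x)) has_vector_derivative y'') (at x) \<and>
      - y'' + complex_of_real (q x) * complex_of_real (w x) = complex_of_real \<mu> * complex_of_real (w x))"
  proof (rule AE_mp, intro AE_I2 impI)
    fix x assume "x \<notin> ?N" and x: "x \<in> {0<..<1::real}"
    then have "((\<lambda>y. integral {0..y} g) has_real_derivative g x) (at x)" by simp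
    then have "((\<lambda>y. w' 0 + integral {0..y} g) has_real_derivative g x) (at x)"
      by (auto intro: derivative_eq_intros)
    then have "(w' has_real_derivative g x) (at x)"
    proof (rule has_field_derivative_transform_within_open)
      show "w' 0 + integral {0..y} g = w' y" if "y \<in> {0<..<1}" for y
        using that by (intro w'[symmetric]) auto
    qed (use x in auto)
    then have "((\<lambda>x. complex_of_real (w' x)) has_vector_derivative of_real (g x)) (at x)"
      by (rule has_vector_derivative_of_real)
    moreover have "- complex_of_real (g x) + complex_of_real (q x) * complex_of_real (w x) = complex_of_real \<mu> * complex_of_real (w x)"
      unfolding eq[OF x] by (simp add: algebra_simps)
    ultimately show "\<exists>y''. ((\<lambda>x. complex_of_real (w' x)) has_vector_derivative y'') (at x) \<and>
      - y'' + complex_of_real (q x) * complex_of_real (w x) = complex_of_real \<mu> * complex_of_real (w x)" by blast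
  qed
qed

section \<open>The Schroedinger equation on an edge\<close>

lemma absolutely_integrable_continuous_mult:
  fixes f h :: "real \<Rightarrow> real"
  assumes "continuous_on {a..b} f" "h absolutely_integrable_on {a..b}"
  shows "(\<lambda>x. f x * h x) absolutely_integrable_on {a..b}"
  using assms
  by (intro absolutely_integrable_bounded_measurable_product_real continuous_imp_measurable_on_sets_lebesgue
      compact_imp_bounded compact_continuous_image) auto

lemma integrable_on_initial:
  fixes f :: "real \<Rightarrow> real"
  assumes "f integrable_on {0..1}" "x \<in> {0..1}"
  shows "f integrable_on {0..x}"
  using assms by (intro integrable_on_subinterval[OF assms(1)]) auto

abbreviation (input) l1 :: "(real \<Rightarrow> real) \<Rightarrow> real" where
  "l1 f \<equiv> integral {0..1} (\<lambda>t. \<bar>f t\<bar>)"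

text \<open>The equation \<open>- u'' + Q u = z\<^sup>2 u + \<phi>\<close>, integrated once so that
  \<open>u''\<close> never has to exist pointwise. The source \<phi> makes \<open>u\<close> an image
  under the resolvent; the source \<open>\<kappa> u\<close> amounts to an eigenvalue moved by
  \<kappa>.\<close>

definition schroedinger_sol ::
  "(real \<Rightarrow> real) \<Rightarrow> real \<Rightarrow> (real \<Rightarrow> real) \<Rightarrow> (real \<Rightarrow> real) \<Rightarrow> (real \<Rightarrow> real) \<Rightarrow> bool" where
  "schroedinger_sol Q z \<phi> u u' \<longleftrightarrow>
    (\<forall>x\<in>{0..1}. (u has_real_derivative u' x) (at x within {0..1})) \<and>
    (\<forall>x\<in>{0..1}. u' x = u' 0 + integral {0..x} (\<lambda>t. (Q t - z\<^sup>2) * u t - \<phi> t))"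

lemma schroedinger_solD:
  assumes "schroedinger_sol Q z \<phi> u u'" "x \<in> {0..1}"
  shows "(u has_real_derivative u' x) (at x within {0..1})"
    and "u' x = u' 0 + integral {0..x} (\<lambda>t. (Q t - z\<^sup>2) * u t - \<phi> t)"
  using assms unfolding schroedinger_sol_def by blast+

section \<open>Identities, bounds and existence on one edge\<close>

context
  fixes Q :: "real \<Rightarrow> real"
  assumes Q: "Q absolutely_integrable_on {0..1}"
begin

lemma Q_integrable: "Q integrable_on {0..1}" "(\<lambda>x. \<bar>Q x\<bar>) integrable_on {0..1}"
  using Q unfolding absolutely_integrable_on_def by auto

lemma rhs_absolutely_integrable:
  assumes "continuous_on {0..1} u" "continuous_on {0..1} \<phi>"
  shows "(\<lambda>t. (Q t - s) * u t - \<phi> t) absolutely_integrable_on {0..1}"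
proof -
  have "(\<lambda>t. Q t - s) absolutely_integrable_on {0..1}"
    by (rule set_integral_diff(1)[OF Q]) (auto intro: absolutely_integrable_on_const)
  from absolutely_integrable_continuous_mult[OF assms(1) this]
  have "(\<lambda>t. u t * (Q t - s) - \<phi> t) absolutely_integrable_on {0..1}"
    by (rule set_integral_diff(1)) (rule absolutely_integrable_continuous_real[OF assms(2)])
  then show ?thesis by (simp add: mult.commute)
qed

lemma schroedinger_sol_continuous:
  assumes "schroedinger_sol Q z \<phi> u u'" "continuous_on {0..1} \<phi>"
  shows "continuous_on {0..1} u" "continuous_on {0..1} u'"
proof -
  show u: "continuous_on {0..1} u"
    using schroedinger_solD(1)[OF assms(1)]
    by (meson DERIV_continuous continuous_on_eq_continuous_within)
  have "(\<lambda>t. (Q t - z\<^sup>2) * u t - \<phi> t) integrable_on {0..1}"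
    using rhs_absolutely_integrable[OF u assms(2)] unfolding absolutely_integrable_on_def by auto
  then have "continuous_on {0..1} (\<lambda>x. u' 0 + integral {0..x} (\<lambda>t. (Q t - z\<^sup>2) * u t - \<phi> t))"
    by (intro continuous_intros indefinite_integral_continuous_1)
  then show "continuous_on {0..1} u'"
    by (rule continuous_on_eq) (rule schroedinger_solD(2)[OF assms(1), symmetric])
qed

lemma schroedinger_sol_linear:
  assumes "schroedinger_sol Q z \<phi> u u'" "schroedinger_sol Q z \<psi> w w'"
    and "continuous_on {0..1} \<phi>" "continuous_on {0..1} \<psi>"
  shows "schroedinger_sol Q z (\<lambda>x. a * \<phi> x + b * \<psi> x) (\<lambda>x. a * u x + b * w x) (\<lambda>x. a * u' x + b * w' x)"
  unfolding schroedinger_sol_def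
proof (intro conjI ballI)
  fix x :: real assume x: "x \<in> {0..1}"
  show "((\<lambda>x. a * u x + b * w x) has_real_derivative a * u' x + b * w' x) (at x within {0..1})"
    by (intro DERIV_add DERIV_cmult schroedinger_solD(1)[OF assms(1) x] schroedinger_solD(1)[OF assms(2) x])
  let ?U = "\<lambda>t. (Q t - z\<^sup>2) * u t - \<phi> t" and ?W = "\<lambda>t. (Q t - z\<^sup>2) * w t - \<psi> t"
  have "?U integrable_on {0..1}" "?W integrable_on {0..1}"
    using rhs_absolutely_integrable schroedinger_sol_continuous(1) assms
    unfolding absolutely_integrable_on_def by blast+
  then have i: "?U integrable_on {0..x}" "?W integrable_on {0..x}"
    using x integrable_on_initial by auto
  have "integral {0..x} (\<lambda>t. (Q t - z\<^sup>2) * (a * u t + b * w t) - (a * \<phi> t + b * \<psi> t)) =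
      integral {0..x} (\<lambda>t. a * ?U t + b * ?W t)"
    by (simp add: algebra_simps)
  also have "\<dots> = a * integral {0..x} ?U + b * integral {0..x} ?W"
    by (subst integral_add) (use i in \<open>auto intro: integrable_on_mult_right\<close>)
  finally have *: "integral {0..x} (\<lambda>t. (Q t - z\<^sup>2) * (a * u t + b * w t) - (a * \<phi> t + b * \<psi> t)) =
      a * integral {0..x} ?U + b * integral {0..x} ?W" .
  have "u' x = u' 0 + integral {0..x} ?U" "w' x = w' 0 + integral {0..x} ?W"
    using schroedinger_solD(2)[OF assms(1) x] schroedinger_solD(2)[OF assms(2) x] by blast+
  then show "a * u' x + b * w' x = a * u' 0 + b * w' 0 +
      integral {0..x} (\<lambda>t. (Q t - z\<^sup>2) * (a * u t + b * w t) - (a * \<phi> t + b * \<psi> t))"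
    unfolding * by (simp only: distrib_left)
qed

text \<open>Weak form: integration by parts against a test function with continuous derivative,
  valid although \<open>Q u\<close> is merely integrable. The Lagrange identity and the variation of
  constants both rest on it.\<close>

lemma schroedinger_sol_weak:
  assumes sol: "schroedinger_sol Q z \<phi> u u'" and \<phi>: "continuous_on {0..1} \<phi>"
    and w: "\<And>x. x \<in> {0..1} \<Longrightarrow> (w has_real_derivative w' x) (at x within {0..1})"
    and w': "continuous_on {0..1} w'"
    and x: "x \<in> {0..1}"
  shows "integral {0..x} (\<lambda>t. w t * ((Q t - z\<^sup>2) * u t - \<phi> t)) =
    w x * u' x - w 0 * u' 0 - integral {0..x} (\<lambda>t. w' t * u' t)"
proof -
  let ?h = "\<lambda>t. (Q t - z\<^sup>2) * u t - \<phi> t"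
  note c = schroedinger_sol_continuous[OF sol \<phi>]
  have u': "integral {0..t} ?h = u' t - u' 0" if "t \<in> {0..1}" for t
    using schroedinger_solD(2)[OF sol that] by linarith
  have c0: "continuous_on {0..x} w'" "continuous_on {0..x} u'"
    using c w' x by (auto intro: continuous_on_subset)
  have i: "(\<lambda>t. w' t * u' t) integrable_on {0..x}" "w' integrable_on {0..x}"
    by (intro integrable_continuous_real continuous_intros c0)+
  have W: "integral {0..x} w' = w x - w 0"
  proof (rule integral_unique, rule fundamental_theorem_of_calculus)
    fix y assume "y \<in> {0..x}"
    then show "(w has_vector_derivative w' y) (at y within {0..x})"
      using DERIV_subset[OF w[of y], of "{0..x}"] x
      by (simp add: has_real_derivative_iff_has_vector_derivative subset_iff)
  qed (use x in auto)
  have "integral {0..x} (\<lambda>t. w t * ?h t) =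
      w x * integral {0..x} ?h - integral {0..x} (\<lambda>t. w' t * integral {0..t} ?h)"
    by (rule integral_by_parts_indefinite[OF rhs_absolutely_integrable[OF c(1) \<phi>] w w' x])
  also have "integral {0..x} (\<lambda>t. w' t * integral {0..t} ?h) = integral {0..x} (\<lambda>t. w' t * u' t - w' t * u' 0)"
    by (rule integral_cong) (use x in \<open>simp add: u' right_diff_distrib\<close>)
  also have "\<dots> = integral {0..x} (\<lambda>t. w' t * u' t) - (w x - w 0) * u' 0"
    by (subst integral_diff) (use i in \<open>auto intro: integrable_on_mult_left simp: W\<close>)
  finally show ?thesis unfolding u'[OF x] by (simp only: left_diff_distrib right_diff_distrib)
qed

text \<open>Each solution is tested against the other; the terms with \<open>Q - z\<^sup>2\<close>
  and with \<open>u' w'\<close> cancel in the difference. The boundary terms that remain will cancel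
  after summation over the graph.\<close>

lemma schroedinger_sol_Lagrange:
  assumes sol: "schroedinger_sol Q z \<phi> u u'" and \<phi>: "continuous_on {0..1} \<phi>"
    and sol': "schroedinger_sol Q z \<psi> w w'" and \<psi>: "continuous_on {0..1} \<psi>"
  shows "integral {0..1} (\<lambda>t. u t * \<psi> t) - integral {0..1} (\<lambda>t. \<phi> t * w t) =
    (w 1 * u' 1 - u 1 * w' 1) - (w 0 * u' 0 - u 0 * w' 0)"
proof -
  note c = schroedinger_sol_continuous[OF sol \<phi>] schroedinger_sol_continuous[OF sol' \<psi>]
  let ?U = "\<lambda>t. w t * ((Q t - z\<^sup>2) * u t - \<phi> t)" and ?W = "\<lambda>t. u t * ((Q t - z\<^sup>2) * w t - \<psi> t)"
  have 1: "integral {0..1} ?U = w 1 * u' 1 - w 0 * u' 0 - integral {0..1} (\<lambda>t. w' t * u' t)"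
    by (rule schroedinger_sol_weak[OF sol \<phi> schroedinger_solD(1)[OF sol'] c(4)]) simp_all
  have 2: "integral {0..1} ?W = u 1 * w' 1 - u 0 * w' 0 - integral {0..1} (\<lambda>t. u' t * w' t)"
    by (rule schroedinger_sol_weak[OF sol' \<psi> schroedinger_solD(1)[OF sol] c(2)]) simp_all
  have i: "?U integrable_on {0..1}" "?W integrable_on {0..1}"
    using absolutely_integrable_continuous_mult[OF c(3) rhs_absolutely_integrable[OF c(1) \<phi>]]
      absolutely_integrable_continuous_mult[OF c(1) rhs_absolutely_integrable[OF c(3) \<psi>]]
    unfolding absolutely_integrable_on_def by auto
  have "integral {0..1} ?U - integral {0..1} ?W = integral {0..1} (\<lambda>t. ?U t - ?W t)"
    by (rule integral_diff[OF i, symmetric])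
  also have "\<dots> = integral {0..1} (\<lambda>t. u t * \<psi> t - \<phi> t * w t)"
    by (simp add: algebra_simps)
  also have "\<dots> = integral {0..1} (\<lambda>t. u t * \<psi> t) - integral {0..1} (\<lambda>t. \<phi> t * w t)"
    by (intro integral_diff integrable_continuous_real continuous_intros c \<phi> \<psi>)
  finally show ?thesis unfolding 1 2 by (simp add: mult.commute[of "w' _"])
qed

text \<open>A test function with \<open>w'' = - z\<^sup>2 w\<close> admits a second integration by
  parts, which cancels the terms with \<open>z\<^sup>2\<close>.\<close>

lemma schroedinger_sol_test:
  assumes sol: "schroedinger_sol Q z \<phi> u u'" and \<phi>: "continuous_on {0..1} \<phi>"
    and w: "\<And>x. (w has_real_derivative w' x) (at x)" and w': "\<And>x. (w' has_real_derivative - z\<^sup>2 * w x) (at x)"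
    and x: "x \<in> {0..1}"
  shows "integral {0..x} (\<lambda>t. w t * (Q t * u t - \<phi> t)) =
    (w x * u' x - w' x * u x) - (w 0 * u' 0 - w' 0 * u 0)"
proof -
  note c = schroedinger_sol_continuous[OF sol \<phi>]
  have cw: "continuous_on S w" "continuous_on S w'" for S
    using w w' by (meson DERIV_continuous continuous_at_imp_continuous_on)+
  have c0: "continuous_on {0..x} u" "continuous_on {0..x} u'"
    using c x by (auto intro: continuous_on_subset)
  let ?h = "\<lambda>t. (Q t - z\<^sup>2) * u t - \<phi> t"
  have 1: "integral {0..x} (\<lambda>t. w t * ?h t) = w x * u' x - w 0 * u' 0 - integral {0..x} (\<lambda>t. w' t * u' t)"
    by (rule schroedinger_sol_weak[OF sol \<phi> _ cw(2) x]) (rule has_field_derivative_at_within[OF w])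
  have "((\<lambda>t. w' t * u' t + - z\<^sup>2 * w t * u t) has_integral w' x * u x - w' 0 * u 0) {0..x}"
  proof (rule fundamental_theorem_of_calculus)
    fix y assume y: "y \<in> {0..x}"
    have "(u has_real_derivative u' y) (at y within {0..x})"
      using x y by (intro DERIV_subset[OF schroedinger_solD(1)[OF sol, of y]]) auto
    then have "((\<lambda>x. w' x * u x) has_real_derivative - z\<^sup>2 * w y * u y + u' y * w' y) (at y within {0..x})"
      by (rule DERIV_mult[OF has_field_derivative_at_within[OF w']])
    then show "((\<lambda>x. w' x * u x) has_vector_derivative w' y * u' y + - z\<^sup>2 * w y * u y) (at y within {0..x})"
      by (simp add: has_real_derivative_iff_has_vector_derivative algebra_simps)
  qed (use x in auto)
  then have "integral {0..x} (\<lambda>t. w' t * u' t + - z\<^sup>2 * w t * u t) = w' x * u x - w' 0 * u 0"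
    by (rule integral_unique)
  moreover have "integral {0..x} (\<lambda>t. w' t * u' t + - z\<^sup>2 * w t * u t) =
      integral {0..x} (\<lambda>t. w' t * u' t) + integral {0..x} (\<lambda>t. - z\<^sup>2 * w t * u t)"
    by (intro integral_add integrable_continuous_real continuous_intros cw c0)
  moreover have "integral {0..x} (\<lambda>t. w t * (Q t * u t - \<phi> t)) =
     integral {0..x} (\<lambda>t. w t * ?h t) - integral {0..x} (\<lambda>t. - z\<^sup>2 * w t * u t)"
  proof -
    have "(\<lambda>t. w t * ?h t) integrable_on {0..1}"
      using absolutely_integrable_continuous_mult[OF cw(1) rhs_absolutely_integrable[OF c(1) \<phi>]]
      unfolding absolutely_integrable_on_def by auto
    then have i1: "(\<lambda>t. w t * ?h t) integrable_on {0..x}" using x by (rule integrable_on_initial)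
    have i2: "(\<lambda>t. - z\<^sup>2 * w t * u t) integrable_on {0..x}"
      by (intro integrable_continuous_real continuous_intros cw c0)
    have "integral {0..x} (\<lambda>t. w t * ?h t - - z\<^sup>2 * w t * u t) =
       integral {0..x} (\<lambda>t. w t * ?h t) - integral {0..x} (\<lambda>t. - z\<^sup>2 * w t * u t)"
      by (rule integral_diff[OF i1 i2])
    then show ?thesis by (simp add: algebra_simps)
  qed
  ultimately show ?thesis using 1 by simp
qed

text \<open>Variation of constants: the test function \<open>sin (z * (x - t))\<close> vanishes at
  the upper end \<open>t = x\<close> and has derivative \<open>- z\<close> there, which isolates
  \<open>z * u x\<close>.\<close>

lemma schroedinger_sol_variation:
  assumes sol: "schroedinger_sol Q z \<phi> u u'" and \<phi>: "continuous_on {0..1} \<phi>" and x: "x \<in> {0..1}"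
  shows "z * u x = z * u 0 * cos (z * x) + u' 0 * sin (z * x) +
    integral {0..x} (\<lambda>t. sin (z * (x - t)) * (Q t * u t - \<phi> t))"
proof -
  have "((\<lambda>t. sin (z * (x - t))) has_real_derivative - z * cos (z * (x - t))) (at t)" for t
    by (auto intro!: derivative_eq_intros)
  moreover have "((\<lambda>t. - z * cos (z * (x - t))) has_real_derivative - z\<^sup>2 * sin (z * (x - t))) (at t)" for t
    by (auto intro!: derivative_eq_intros simp: power2_eq_square)
  ultimately show ?thesis
    using schroedinger_sol_test[OF sol \<phi> _ _ x, of "\<lambda>t. sin (z * (x - t))" "\<lambda>t. - z * cos (z * (x - t))"]
    by simp
qed

lemma kernel_integral_bound:
  assumes u: "continuous_on {0..1} u" and \<phi>: "continuous_on {0..1} \<phi>" and x: "x \<in> {0..1}"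
    and w: "continuous_on {0..1} w" "\<And>t. t \<in> {0..1} \<Longrightarrow> \<bar>w t\<bar> \<le> 1"
    and S: "\<And>t. t \<in> {0..1} \<Longrightarrow> \<bar>u t\<bar> \<le> S"
  shows "\<bar>integral {0..x} (\<lambda>t. w t * (Q t * u t - \<phi> t))\<bar> \<le> l1 Q * S + integral {0..1} (\<lambda>t. \<bar>\<phi> t\<bar>)"
proof -
  have i: "(\<lambda>t. w t * (Q t * u t - \<phi> t)) integrable_on {0..1}"
    using absolutely_integrable_continuous_mult[OF w(1) rhs_absolutely_integrable[OF u \<phi>, of 0]]
    unfolding absolutely_integrable_on_def by auto
  have i1: "(\<lambda>t. \<bar>Q t\<bar> * S) integrable_on {0..1}" "(\<lambda>t. \<bar>\<phi> t\<bar>) integrable_on {0..1}"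
    by (intro integrable_on_mult_left Q_integrable integrable_continuous_real continuous_intros \<phi>)+
  have "norm (integral {0..x} (\<lambda>t. w t * (Q t * u t - \<phi> t))) \<le> integral {0..x} (\<lambda>t. \<bar>Q t\<bar> * S + \<bar>\<phi> t\<bar>)"
  proof (rule integral_norm_bound_integral)
    show "(\<lambda>t. w t * (Q t * u t - \<phi> t)) integrable_on {0..x}" by (rule integrable_on_initial[OF i x])
    show "(\<lambda>t. \<bar>Q t\<bar> * S + \<bar>\<phi> t\<bar>) integrable_on {0..x}"
      by (intro integrable_on_initial[OF _ x] integrable_add i1)
    fix t :: real assume t: "t \<in> {0..x}"
    then have t01: "t \<in> {0..1}" using x by auto
    have "norm (w t * (Q t * u t - \<phi> t)) \<le> 1 * \<bar>Q t * u t - \<phi> t\<bar>"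
      unfolding real_norm_def abs_mult by (intro mult_right_mono w t01) simp
    also have "\<dots> \<le> \<bar>Q t * u t\<bar> + \<bar>\<phi> t\<bar>" by simp
    also have "\<bar>Q t * u t\<bar> \<le> \<bar>Q t\<bar> * S"
      unfolding abs_mult by (intro mult_left_mono S t01) simp
    finally show "norm (w t * (Q t * u t - \<phi> t)) \<le> \<bar>Q t\<bar> * S + \<bar>\<phi> t\<bar>" by simp
  qed
  also have "\<dots> \<le> integral {0..1} (\<lambda>t. \<bar>Q t\<bar> * S + \<bar>\<phi> t\<bar>)"
  proof (rule integral_subset_le)
    show "(\<lambda>t. \<bar>Q t\<bar> * S + \<bar>\<phi> t\<bar>) integrable_on {0..x}"
      by (intro integrable_on_initial[OF _ x] integrable_add i1)
    show "(\<lambda>t. \<bar>Q t\<bar> * S + \<bar>\<phi> t\<bar>) integrable_on {0..1}" by (intro integrable_add i1)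
    show "\<forall>t\<in>{0..1}. 0 \<le> \<bar>Q t\<bar> * S + \<bar>\<phi> t\<bar>"
      using order_trans[OF abs_ge_zero S] by (intro ballI add_nonneg_nonneg mult_nonneg_nonneg) auto
  qed (use x in auto)
  also have "\<dots> = l1 Q * S + integral {0..1} (\<lambda>t. \<bar>\<phi> t\<bar>)"
    by (subst integral_add[OF i1]) simp
  finally show ?thesis by simp
qed

text \<open>At a maximum point of \<open>\<bar>u\<bar>\<close> the term with \<open>Q\<close> in the
  variation formula is at most half of the left-hand side, by \<open>2 * l1 Q \<le> z\<close>, and
  is absorbed; hence the factor 2.\<close>

lemma schroedinger_sol_sup_bound:
  assumes sol: "schroedinger_sol Q z \<phi> u u'" and \<phi>: "continuous_on {0..1} \<phi>"
    and z: "z \<ge> 1" "2 * l1 Q \<le> z" and x: "x \<in> {0..1}"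
  shows "\<bar>u x\<bar> \<le> 2 * (\<bar>u 0\<bar> + \<bar>u' 0\<bar> / z + integral {0..1} (\<lambda>t. \<bar>\<phi> t\<bar>))"
proof -
  note c = schroedinger_sol_continuous[OF sol \<phi>]
  obtain y where y: "y \<in> {0..1}" "\<And>t. t \<in> {0..1} \<Longrightarrow> \<bar>u t\<bar> \<le> \<bar>u y\<bar>"
    using continuous_attains_sup[of "{0..1}" "\<lambda>t. \<bar>u t\<bar>"] continuous_on_rabs[OF c(1)] by auto
  let ?P = "integral {0..1} (\<lambda>t. \<bar>\<phi> t\<bar>)"
  have P: "?P \<ge> 0" by (intro integral_nonneg integrable_continuous_real continuous_intros \<phi>) auto
  have "\<bar>integral {0..y} (\<lambda>t. sin (z * (y - t)) * (Q t * u t - \<phi> t))\<bar> \<le> l1 Q * \<bar>u y\<bar> + ?P"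
    by (intro kernel_integral_bound c \<phi> y continuous_intros) auto
  moreover have "\<bar>z * u 0 * cos (z * y)\<bar> \<le> z * \<bar>u 0\<bar>"
    using z mult_left_mono[OF abs_cos_le_one[of "z * y"], of "z * \<bar>u 0\<bar>"] by (simp add: abs_mult)
  moreover have "\<bar>u' 0 * sin (z * y)\<bar> \<le> \<bar>u' 0\<bar>"
    using mult_left_mono[OF abs_sin_le_one[of "z * y"], of "\<bar>u' 0\<bar>"] by (simp add: abs_mult)
  ultimately have "\<bar>z * u y\<bar> \<le> z * \<bar>u 0\<bar> + \<bar>u' 0\<bar> + (l1 Q * \<bar>u y\<bar> + ?P)"
    unfolding schroedinger_sol_variation[OF sol \<phi> y(1)] by linarith
  moreover have "l1 Q * \<bar>u y\<bar> \<le> z / 2 * \<bar>u y\<bar>" using z by (intro mult_right_mono) auto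
  ultimately have "z * \<bar>u y\<bar> \<le> 2 * (z * \<bar>u 0\<bar> + \<bar>u' 0\<bar> + ?P)" using z by (simp add: abs_mult)
  then have "\<bar>u y\<bar> \<le> 2 * (z * \<bar>u 0\<bar> + \<bar>u' 0\<bar> + ?P) / z" using z by (simp add: field_simps)
  also have "\<dots> = 2 * (\<bar>u 0\<bar> + \<bar>u' 0\<bar> / z + ?P / z)" using z by (simp add: field_simps)
  also have "\<dots> \<le> 2 * (\<bar>u 0\<bar> + \<bar>u' 0\<bar> / z + ?P)"
    using z P mult_left_mono[of 1 z ?P] by (simp add: divide_le_eq)
  finally show ?thesis using y(2)[OF x] by simp
qed

text \<open>The sup bound put back into the variation formula: up to a relative error of order
  \<open>1 / z\<close>, \<open>u\<close> is the free solution with the same data at 0.\<close>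

lemma schroedinger_sol_remainder:
  assumes sol: "schroedinger_sol Q z \<phi> u u'" and \<phi>: "continuous_on {0..1} \<phi>"
    and z: "z \<ge> 1" "2 * l1 Q \<le> z" and x: "x \<in> {0..1}"
  shows "\<bar>u x - (u 0 * cos (z * x) + u' 0 / z * sin (z * x))\<bar> \<le>
    (2 * l1 Q + 1) * (\<bar>u 0\<bar> + \<bar>u' 0\<bar> / z + integral {0..1} (\<lambda>t. \<bar>\<phi> t\<bar>)) / z"
proof -
  note c = schroedinger_sol_continuous[OF sol \<phi>]
  let ?P = "integral {0..1} (\<lambda>t. \<bar>\<phi> t\<bar>)"
  let ?N = "\<bar>u 0\<bar> + \<bar>u' 0\<bar> / z + ?P"
  let ?I = "integral {0..x} (\<lambda>t. sin (z * (x - t)) * (Q t * u t - \<phi> t))"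
  have "\<bar>?I\<bar> \<le> l1 Q * (2 * ?N) + ?P"
    by (intro kernel_integral_bound c \<phi> x continuous_intros schroedinger_sol_sup_bound[OF sol \<phi> z]) auto
  also have "\<dots> \<le> l1 Q * (2 * ?N) + ?N" using z by simp
  also have "\<dots> = (2 * l1 Q + 1) * ?N" by (simp add: algebra_simps)
  finally have I: "\<bar>?I\<bar> \<le> (2 * l1 Q + 1) * ?N" .
  have "u x - (u 0 * cos (z * x) + u' 0 / z * sin (z * x)) = ?I / z"
    using schroedinger_sol_variation[OF sol \<phi> x] z by (simp add: field_simps)
  then show ?thesis using I z by (simp add: divide_right_mono)
qed

text \<open>Banach's fixed point theorem for the variation formula; since
  \<open>l1 Q / z \<le> 1 / 2\<close>, there is a contraction on the whole interval at once. The
  kernel integral is first integrated by parts (\<open>kernel\<close>): then \<open>A\<close> and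
  \<open>B\<close> integrate continuous functions and are differentiable at every point.\<close>

lemma schroedinger_sol_exists:
  assumes \<phi>: "continuous_on {0..1} \<phi>" and z: "z \<ge> 1" "2 * l1 Q \<le> z"
  obtains u u' where "schroedinger_sol Q z \<phi> u u'" "u 0 = a" "u' 0 = b"
proof -
  define H where "H u x = integral {0..x} (\<lambda>t. Q t * u t - \<phi> t)" for u and x :: real
  define A where "A u x = integral {0..x} (\<lambda>t. cos (z * t) * H u t)" for u and x :: real
  define B where "B u x = integral {0..x} (\<lambda>t. sin (z * t) * H u t)" for u and x :: real
  define T where "T u x = a * cos (z * x) + b / z * sin (z * x) + (cos (z * x) * A u x + sin (z * x) * B u x)" for u x
  have h: "(\<lambda>t. Q t * u t - \<phi> t) absolutely_integrable_on {0..1}" if "continuous_on {0..1} u" for u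
    using rhs_absolutely_integrable[OF that \<phi>, of 0] by simp
  have cH: "continuous_on {0..1} (H u)" if "continuous_on {0..1} u" for u
    unfolding H_def using h[OF that]
    by (intro indefinite_integral_continuous_1) (simp add: absolutely_integrable_on_def)
  have dA: "(A u has_real_derivative cos (z * x) * H u x) (at x within {0..1})"
    if "continuous_on {0..1} u" "x \<in> {0..1}" for u x
    unfolding A_def using cH[OF that(1)] that(2) by (intro integral_has_real_derivative continuous_intros)
  have dB: "(B u has_real_derivative sin (z * x) * H u x) (at x within {0..1})"
    if "continuous_on {0..1} u" "x \<in> {0..1}" for u x
    unfolding B_def using cH[OF that(1)] that(2) by (intro integral_has_real_derivative continuous_intros)
  have cT: "continuous_on {0..1} (T u)" if "continuous_on {0..1} u" for u
  proof -
    have "continuous_on {0..1} (A u)" "continuous_on {0..1} (B u)"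
      using dA[OF that] dB[OF that] by (meson DERIV_continuous continuous_on_eq_continuous_within)+
    then show ?thesis unfolding T_def by (intro continuous_intros)
  qed
  have kernel: "cos (z * x) * A u x + sin (z * x) * B u x =
      integral {0..x} (\<lambda>t. sin (z * (x - t)) * (Q t * u t - \<phi> t)) / z"
    if u: "continuous_on {0..1} u" and x: "x \<in> {0..1}" for u x
  proof -
    have cHx: "continuous_on {0..x} (H u)" using cH[OF u] x by (auto intro: continuous_on_subset)
    have "integral {0..x} (\<lambda>t. sin (z * (x - t)) * (Q t * u t - \<phi> t)) =
        sin (z * (x - x)) * integral {0..x} (\<lambda>t. Q t * u t - \<phi> t) - integral {0..x} (\<lambda>t. - z * cos (z * (x - t)) * H u t)"
      unfolding H_def
      by (rule integral_by_parts_indefinite[OF h[OF u] _ _ x])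
        (auto intro!: derivative_eq_intros continuous_intros)
    also have "\<dots> = z * integral {0..x} (\<lambda>t. cos (z * (x - t)) * H u t)"
      by (simp add: mult.assoc)
    also have "integral {0..x} (\<lambda>t. cos (z * (x - t)) * H u t) =
       integral {0..x} (\<lambda>t. cos (z * x) * (cos (z * t) * H u t) + sin (z * x) * (sin (z * t) * H u t))"
      by (simp add: right_diff_distrib cos_diff algebra_simps)
    also have "\<dots> = cos (z * x) * A u x + sin (z * x) * B u x"
      unfolding A_def B_def
      by (subst integral_add) (auto intro!: integrable_continuous_real continuous_intros cHx)
    finally show ?thesis using z by simp
  qed
  have contr: "\<bar>T u x - T v x\<bar> \<le> 1 / 2 * S"
    if u: "continuous_on {0..1} u" and v: "continuous_on {0..1} v" and x: "x \<in> {0..1}"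
      and S: "\<And>t. t \<in> {0..1} \<Longrightarrow> \<bar>u t - v t\<bar> \<le> S" for u v x S
  proof -
    let ?k = "\<lambda>t. sin (z * (x - t))"
    have ck: "continuous_on {0..1} ?k" by (intro continuous_intros)
    have i: "(\<lambda>t. ?k t * (Q t * w t - \<phi> t)) integrable_on {0..x}" if "continuous_on {0..1} w" for w
      using absolutely_integrable_continuous_mult[OF ck h[OF that]]
      by (intro integrable_on_initial[OF _ x]) (simp add: absolutely_integrable_on_def)
    have "T u x - T v x = (integral {0..x} (\<lambda>t. ?k t * (Q t * u t - \<phi> t)) - integral {0..x} (\<lambda>t. ?k t * (Q t * v t - \<phi> t))) / z"
      unfolding T_def kernel[OF u x] kernel[OF v x] by (simp add: diff_divide_distrib)
    also have "\<dots> = integral {0..x} (\<lambda>t. ?k t * (Q t * u t - \<phi> t) - ?k t * (Q t * v t - \<phi> t)) / z"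
      by (simp only: integral_diff[OF i[OF u] i[OF v]])
    also have "(\<lambda>t. ?k t * (Q t * u t - \<phi> t) - ?k t * (Q t * v t - \<phi> t)) = (\<lambda>t. ?k t * (Q t * (u t - v t) - 0))"
      by (auto simp: algebra_simps)
    finally have T: "\<bar>T u x - T v x\<bar> = \<bar>integral {0..x} (\<lambda>t. ?k t * (Q t * (u t - v t) - 0))\<bar> / z"
      using z by simp
    have "\<bar>integral {0..x} (\<lambda>t. ?k t * (Q t * (u t - v t) - 0))\<bar> \<le> l1 Q * S + integral {0..1} (\<lambda>t::real. \<bar>0\<bar>)"
      by (rule kernel_integral_bound) (auto intro!: continuous_intros u v S x simp: x[simplified])
    also have "\<dots> \<le> S / 2 * z"
      using S[of 0] mult_right_mono[OF z(2), of S] by (simp add: algebra_simps)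
    finally show ?thesis using z by (simp add: T divide_le_eq)
  qed
  \<comment> \<open>Bounded continuous functions of the type used have the whole line as domain;
    composing with the retraction onto the unit interval extends \<open>T\<close> to them.\<close>
  define clip :: "real \<Rightarrow> real" where "clip x = max 0 (min 1 x)" for x
  have clip: "clip x \<in> {0..1}" "x \<in> {0..1} \<Longrightarrow> clip x = x" for x by (auto simp: clip_def)
  have cclip: "continuous_on UNIV clip" unfolding clip_def by (intro continuous_intros)
  define F :: "(real \<Rightarrow>\<^sub>C real) \<Rightarrow> (real \<Rightarrow>\<^sub>C real)" where "F f = Bcontfun (\<lambda>x. T (apply_bcontfun f) (clip x))" for f
  have F: "apply_bcontfun (F f) x = T (apply_bcontfun f) (clip x)" for f x
  proof -
    have c: "continuous_on {0..1} (T (apply_bcontfun f))" by (intro cT) simp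
    have "continuous_on UNIV (\<lambda>x. T (apply_bcontfun f) (clip x))"
      by (rule continuous_on_compose2[OF c cclip]) (use clip in auto)
    moreover have "bounded (T (apply_bcontfun f) ` {0..1})"
      by (intro compact_imp_bounded compact_continuous_image c) auto
    then have "bounded (range (\<lambda>x. T (apply_bcontfun f) (clip x)))"
      by (rule bounded_subset) (use clip in auto)
    ultimately show ?thesis unfolding F_def by (subst Bcontfun_inverse) (auto simp: bcontfun_def)
  qed
  have "dist (F f) (F g) \<le> 1 / 2 * dist f g" for f g
  proof (rule dist_bound)
    fix x
    show "dist (apply_bcontfun (F f) x) (apply_bcontfun (F g) x) \<le> 1 / 2 * dist f g"
      unfolding F dist_real_def
      by (rule contr[OF _ _ clip(1)]) (use dist_bounded[of f _ g] in \<open>auto simp: dist_real_def\<close>)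
  qed
  then obtain f where f: "F f = f" using banach_fix_type[of "1/2" F] by auto
  define u where "u = T (apply_bcontfun f)"
  have cf: "continuous_on {0..1} (apply_bcontfun f)" by simp
  have fu: "apply_bcontfun f t = u t" if "t \<in> {0..1}" for t
    using F[of f t] clip(2)[OF that] by (simp add: f u_def)
  have cu: "continuous_on {0..1} u" unfolding u_def by (rule cT[OF cf])
  have HH: "H u x = H (apply_bcontfun f) x" if "x \<in> {0..1}" for x
    unfolding H_def by (rule integral_cong) (use that fu in auto)
  have AB: "A u x = A (apply_bcontfun f) x" "B u x = B (apply_bcontfun f) x" if "x \<in> {0..1}" for x
    unfolding A_def B_def by (rule integral_cong, use that HH in auto)+
  have u: "u x = a * cos (z * x) + b / z * sin (z * x) + (cos (z * x) * A u x + sin (z * x) * B u x)"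
    if "x \<in> {0..1}" for x
    unfolding AB[OF that] by (simp add: u_def T_def)
  \<comment> \<open>\<open>v\<close> is the part of \<open>u'\<close> that is differentiable
    everywhere, with derivative \<open>- z\<^sup>2 u\<close>; the other part \<open>H u\<close>
    carries the integrable potential.\<close>
  define v where "v x = - z * a * sin (z * x) + b * cos (z * x) + z * (cos (z * x) * B u x - sin (z * x) * A u x)" for x
  define u' where "u' x = v x + H u x" for x
  have v': "(v has_real_derivative - z\<^sup>2 * u x) (at x within {0..1})" if x: "x \<in> {0..1}" for x
  proof -
    have "(v has_real_derivative - z * a * (cos (z * x) * z) + b * (- sin (z * x) * z) +
      z * ((- sin (z * x) * z * B u x + sin (z * x) * H u x * cos (z * x)) - (cos (z * x) * z * A u x + cos (z * x) * H u x * sin (z * x)))) (at x within {0..1})"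
      unfolding v_def by (rule derivative_eq_intros dA[OF cu x] dB[OF cu x] refl | simp)+
    also have "- z * a * (cos (z * x) * z) + b * (- sin (z * x) * z) +
      z * ((- sin (z * x) * z * B u x + sin (z * x) * H u x * cos (z * x)) - (cos (z * x) * z * A u x + cos (z * x) * H u x * sin (z * x)))
      = - z\<^sup>2 * u x"
      unfolding u[OF x] using z by (simp add: algebra_simps power2_eq_square)
    finally show ?thesis .
  qed
  show ?thesis
  proof
    show "u 0 = a" using u[of 0] by (simp add: A_def)
    show u'0: "u' 0 = b" by (simp add: u'_def v_def H_def B_def)
    show "schroedinger_sol Q z \<phi> u u'"
      unfolding schroedinger_sol_def
    proof (intro conjI ballI)
      fix x :: real assume x: "x \<in> {0..1}"
      have "((\<lambda>x. a * cos (z * x) + b / z * sin (z * x) + (cos (z * x) * A u x + sin (z * x) * B u x)) has_real_derivative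
        a * (- sin (z * x) * z) + b / z * (cos (z * x) * z) + ((- sin (z * x) * z * A u x + cos (z * x) * H u x * cos (z * x))
          + (cos (z * x) * z * B u x + sin (z * x) * H u x * sin (z * x)))) (at x within {0..1})"
        by (rule derivative_eq_intros dA[OF cu x] dB[OF cu x] refl | simp)+
      also have "a * (- sin (z * x) * z) + b / z * (cos (z * x) * z) + ((- sin (z * x) * z * A u x + cos (z * x) * H u x * cos (z * x))
          + (cos (z * x) * z * B u x + sin (z * x) * H u x * sin (z * x))) =
          v x + H u x"
      proof -
        have "H u x * (cos (x * z) * cos (x * z)) + H u x * (sin (x * z) * sin (x * z)) = H u x"
          by (simp flip: distrib_left power2_eq_square)
        then show ?thesis unfolding v_def using z by (simp add: algebra_simps)
      qed
      finally show "(u has_real_derivative u' x) (at x within {0..1})"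
        unfolding u'_def using u x
        by (intro has_field_derivative_transform_within[OF _ zero_less_one x, of _ _ u]) simp_all
      have "((\<lambda>t. - z\<^sup>2 * u t) has_integral v x - v 0) {0..x}"
      proof (rule fundamental_theorem_of_calculus)
        fix y assume y: "y \<in> {0..x}"
        then show "(v has_vector_derivative - z\<^sup>2 * u y) (at y within {0..x})"
          unfolding has_real_derivative_iff_has_vector_derivative[symmetric]
          using x by (intro DERIV_subset[OF v'[of y]]) auto
      qed (use x in auto)
      then have "integral {0..x} (\<lambda>t. - z\<^sup>2 * u t) = v x - v 0" by (rule integral_unique)
      moreover have "v 0 = b" by (simp add: v_def B_def)
      ultimately have v: "v x = b + integral {0..x} (\<lambda>t. - z\<^sup>2 * u t)" by linarith
      have "(\<lambda>t. Q t * u t - \<phi> t) integrable_on {0..x}"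
        using h[OF cu] by (intro integrable_on_initial[OF _ x]) (simp add: absolutely_integrable_on_def)
      moreover have "(\<lambda>t. - z\<^sup>2 * u t) integrable_on {0..x}"
        by (intro integrable_on_initial[OF _ x] integrable_continuous_real continuous_intros cu)
      ultimately have "integral {0..x} (\<lambda>t. Q t * u t - \<phi> t + - z\<^sup>2 * u t) = H u x + integral {0..x} (\<lambda>t. - z\<^sup>2 * u t)"
        unfolding H_def by (rule integral_add)
      moreover have "(\<lambda>t. Q t * u t - \<phi> t + - z\<^sup>2 * u t) = (\<lambda>t. (Q t - z\<^sup>2) * u t - \<phi> t)"
        by (auto simp: algebra_simps)
      ultimately show "u' x = u' 0 + integral {0..x} (\<lambda>t. (Q t - z\<^sup>2) * u t - \<phi> t)"
        unfolding u'0 by (simp add: u'_def v)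
    qed
  qed
qed

end

section \<open>L2 estimates at the zeros of the sine\<close>

lemma integral_abs_square_le:
  fixes \<phi> :: "real \<Rightarrow> real"
  assumes \<phi>: "continuous_on {0..1} \<phi>"
  shows "(integral {0..1} (\<lambda>t. \<bar>\<phi> t\<bar>))\<^sup>2 \<le> integral {0..1} (\<lambda>t. \<phi> t * \<phi> t)"
proof -
  let ?P = "integral {0..1} (\<lambda>t. \<bar>\<phi> t\<bar>)"
  have i: "(\<lambda>t. \<phi> t * \<phi> t) integrable_on {0..1}" "(\<lambda>t. 2 * ?P * \<bar>\<phi> t\<bar>) integrable_on {0..1}"
    by (intro integrable_continuous_real continuous_intros \<phi>)+
  \<comment> \<open>The variance of |\<phi>| about its mean \<open>?P\<close> on the unit
    interval.\<close>
  have "0 \<le> integral {0..1} (\<lambda>t. (\<bar>\<phi> t\<bar> - ?P)\<^sup>2)"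
    by (intro integral_nonneg integrable_continuous_real continuous_intros \<phi>) auto
  also have "(\<lambda>t. (\<bar>\<phi> t\<bar> - ?P)\<^sup>2) = (\<lambda>t. (\<phi> t * \<phi> t - 2 * ?P * \<bar>\<phi> t\<bar>) + ?P\<^sup>2)"
    by (rule ext) (simp add: power2_diff power2_eq_square[of "\<phi> _"])
  also have "integral {0..1} \<dots> = integral {0..1} (\<lambda>t. \<phi> t * \<phi> t) - 2 * ?P * ?P + ?P\<^sup>2"
    by (subst integral_add[OF integrable_diff[OF i] integrable_const_ivl], subst integral_diff[OF i]) simp
  finally show ?thesis by (simp add: power2_eq_square)
qed

text \<open>The sine vanishes at both ends, so only the terms \<open>x / 2\<close> of the primitive
  \<open>F\<close> survive: cosine and sine are orthogonal and of equal norm.\<close>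

lemma integral_trig_square:
  fixes a b z :: real
  assumes z: "z > 0" "sin z = 0"
  shows "integral {0..1} (\<lambda>x. (a * cos (z * x) + b * sin (z * x))\<^sup>2) = (a\<^sup>2 + b\<^sup>2) / 2"
proof -
  define F where "F x = a\<^sup>2 * (x / 2 + sin (z * x) * cos (z * x) / (2 * z)) + a * b * (sin (z * x))\<^sup>2 / z
    + b\<^sup>2 * (x / 2 - sin (z * x) * cos (z * x) / (2 * z))" for x
  have "((\<lambda>x. (a * cos (z * x) + b * sin (z * x))\<^sup>2) has_integral F 1 - F 0) {0..1}"
  proof (rule fundamental_theorem_of_calculus)
    fix x :: real
    let ?s = "sin (z * x)" and ?c = "cos (z * x)"
    have sc: "?s * ?s = 1 - ?c * ?c" using sin_cos_squared_add[of "z * x"] by (simp add: power2_eq_square)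
    have "(F has_real_derivative a\<^sup>2 * (1 / 2 + (?c * z * ?c + - ?s * z * ?s) / (2 * z)) + a * b * (2 * ?s * (?c * z)) / z
        + b\<^sup>2 * (1 / 2 - (?c * z * ?c + - ?s * z * ?s) / (2 * z))) (at x within {0..1})"
      unfolding F_def using z by (auto intro!: derivative_eq_intros simp: field_simps)
    also have "a\<^sup>2 * (1 / 2 + (?c * z * ?c + - ?s * z * ?s) / (2 * z)) + a * b * (2 * ?s * (?c * z)) / z
        + b\<^sup>2 * (1 / 2 - (?c * z * ?c + - ?s * z * ?s) / (2 * z)) =
        a\<^sup>2 * (1 + ?c * ?c - ?s * ?s) / 2 + 2 * a * b * ?s * ?c + b\<^sup>2 * (1 - ?c * ?c + ?s * ?s) / 2"
      using z by (simp add: field_simps)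
    also have "\<dots> = a\<^sup>2 * (?c * ?c) + 2 * a * b * ?s * ?c + b\<^sup>2 * (?s * ?s)"
      unfolding sc by (simp add: field_simps)
    also have "\<dots> = (a * ?c + b * ?s)\<^sup>2" by (simp add: power2_eq_square algebra_simps)
    finally show "(F has_vector_derivative (a * ?c + b * ?s)\<^sup>2) (at x within {0..1})"
      by (simp add: has_real_derivative_iff_has_vector_derivative)
  qed simp
  moreover have "F 1 - F 0 = (a\<^sup>2 + b\<^sup>2) / 2" using z by (simp add: F_def field_simps)
  ultimately show ?thesis by (simp add: integral_unique)
qed

text \<open>The kernel bound with \<open>Q - z\<^sup>2\<close> as potential and kernel 1. The result
  grows with \<open>z\<close>, which is harmless for its purpose, compactness at a fixed
  \<open>z\<close>.\<close>

lemma schroedinger_sol_derivative_bound: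
  assumes Q: "Q absolutely_integrable_on {0..1}"
    and sol: "schroedinger_sol Q z \<phi> u u'" and \<phi>: "continuous_on {0..1} \<phi>"
    and S: "\<And>t. t \<in> {0..1} \<Longrightarrow> \<bar>u t\<bar> \<le> S" and x: "x \<in> {0..1}"
  shows "\<bar>u' x\<bar> \<le> \<bar>u' 0\<bar> + integral {0..1} (\<lambda>t. \<bar>Q t - z\<^sup>2\<bar>) * S + integral {0..1} (\<lambda>t. \<bar>\<phi> t\<bar>)"
proof -
  have "(\<lambda>t. Q t - z\<^sup>2) absolutely_integrable_on {0..1}"
    by (rule set_integral_diff(1)[OF Q]) (auto intro: absolutely_integrable_on_const)
  from kernel_integral_bound[OF this schroedinger_sol_continuous(1)[OF Q sol \<phi>] \<phi> x, of "\<lambda>t. 1" S]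
  have "\<bar>integral {0..x} (\<lambda>t. (Q t - z\<^sup>2) * u t - \<phi> t)\<bar> \<le> integral {0..1} (\<lambda>t. \<bar>Q t - z\<^sup>2\<bar>) * S + integral {0..1} (\<lambda>t. \<bar>\<phi> t\<bar>)"
    using S by simp
  then show ?thesis using schroedinger_solD(2)[OF sol x] by linarith
qed

text \<open>The natural size of a solution: cosine amplitude, sine amplitude and L1 norm of the
  source. The error bounds are linear in it.\<close>

abbreviation (input) data_size :: "real \<Rightarrow> (real \<Rightarrow> real) \<Rightarrow> (real \<Rightarrow> real) \<Rightarrow> (real \<Rightarrow> real) \<Rightarrow> real" where
  "data_size z u u' \<phi> \<equiv> \<bar>u 0\<bar> + \<bar>u' 0\<bar> / z + l1 \<phi>"

context
  fixes Q :: "real \<Rightarrow> real" and z :: real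
  assumes Q: "Q absolutely_integrable_on {0..1}"
    and z1: "z \<ge> 1" and zQ: "2 * integral {0..1} (\<lambda>t. \<bar>Q t\<bar>) \<le> z" and sinz: "sin z = 0"
begin

text \<open>A converse to the sup bound: L2 norms control the data. The trigonometric part has
  squared norm \<open>(a\<^sup>2 + b\<^sup>2) / 2\<close>, while the condition on \<open>z\<close>
  bounds the squared remainder by \<open>N\<^sup>2 / 24\<close>. The factors 2, 2 and 3 that follow
  raise this to \<open>N\<^sup>2 / 2\<close>, which the left-hand side absorbs.\<close>

lemma schroedinger_sol_energy:
  assumes sol: "schroedinger_sol Q z \<phi> u u'" and \<phi>: "continuous_on {0..1} \<phi>"
    and zl: "24 * (2 * l1 Q + 1)\<^sup>2 \<le> z\<^sup>2"
  shows "(data_size z u u' \<phi>)\<^sup>2 \<le> 24 * (integral {0..1} (\<lambda>t. u t * u t) + integral {0..1} (\<lambda>t. \<phi> t * \<phi> t))"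
proof -
  note cu = schroedinger_sol_continuous(1)[OF Q sol \<phi>]
  define a b P N where "a = u 0" "b = u' 0 / z" "P = integral {0..1} (\<lambda>t. \<bar>\<phi> t\<bar>)" "N = data_size z u u' \<phi>"
  note d = a_b_P_N_def
  have bz: "\<bar>u' 0\<bar> / z = \<bar>b\<bar>" using z1 by (simp add: d)
  have P: "P \<ge> 0" unfolding d by (intro integral_nonneg integrable_continuous_real continuous_intros \<phi>) auto
  have N: "N = \<bar>a\<bar> + \<bar>b\<bar> + P" using bz by (simp add: d)
  define v where "v x = a * cos (z * x) + b * sin (z * x)" for x
  have cv: "continuous_on {0..1} v" unfolding v_def by (intro continuous_intros)
  have rem: "(u x - v x)\<^sup>2 \<le> N\<^sup>2 / 24" if x: "x \<in> {0..1}" for x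
  proof -
    have "\<bar>u x - v x\<bar> \<le> (2 * l1 Q + 1) * N / z"
      using schroedinger_sol_remainder[OF Q sol \<phi> z1 zQ x] by (simp add: d v_def)
    then have "(u x - v x)\<^sup>2 \<le> ((2 * l1 Q + 1) * N / z)\<^sup>2" by (intro abs_le_square_iff[THEN iffD1] order_trans[OF _ abs_ge_self])
    also have "\<dots> = (2 * l1 Q + 1)\<^sup>2 * N\<^sup>2 / z\<^sup>2" by (simp add: power_mult_distrib power_divide)
    also have "\<dots> \<le> N\<^sup>2 / 24"
      using mult_right_mono[OF zl, of "N\<^sup>2"] z1 by (simp add: field_simps)
    finally show ?thesis .
  qed
  have "(a\<^sup>2 + b\<^sup>2) / 2 = integral {0..1} (\<lambda>x. (v x)\<^sup>2)"
    unfolding v_def using z1 sinz by (subst integral_trig_square) auto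
  also have "\<dots> \<le> integral {0..1} (\<lambda>x. 2 * (u x * u x) + N\<^sup>2 / 12)"
  proof (rule integral_le)
    show "(\<lambda>x. (v x)\<^sup>2) integrable_on {0..1}" "(\<lambda>x. 2 * (u x * u x) + N\<^sup>2 / 12) integrable_on {0..1}"
      by (intro integrable_continuous_real continuous_intros cv cu)+
    fix x :: real assume x: "x \<in> {0..1}"
    have "(v x)\<^sup>2 \<le> 2 * (u x * u x) + 2 * (u x - v x)\<^sup>2"
      using zero_le_power2[of "2 * u x - v x"] by (simp add: power2_eq_square algebra_simps)
    then show "(v x)\<^sup>2 \<le> 2 * (u x * u x) + N\<^sup>2 / 12" using rem[OF x] by simp
  qed
  also have "\<dots> = 2 * integral {0..1} (\<lambda>x. u x * u x) + N\<^sup>2 / 12"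
    by (subst integral_add) (auto intro!: integrable_continuous_real continuous_intros cu)
  finally have 1: "a\<^sup>2 + b\<^sup>2 \<le> 4 * integral {0..1} (\<lambda>x. u x * u x) + N\<^sup>2 / 6" by simp
  have 2: "P\<^sup>2 \<le> integral {0..1} (\<lambda>t. \<phi> t * \<phi> t)" unfolding d by (rule integral_abs_square_le[OF \<phi>])
  have "N\<^sup>2 \<le> 3 * (a\<^sup>2 + b\<^sup>2 + P\<^sup>2)"
    using zero_le_power2[of "\<bar>a\<bar> - \<bar>b\<bar>"] zero_le_power2[of "\<bar>a\<bar> - P"] zero_le_power2[of "\<bar>b\<bar> - P"]
    unfolding N by (simp add: power2_eq_square algebra_simps)
  then have "N\<^sup>2 \<le> 24 * integral {0..1} (\<lambda>x. u x * u x) + 6 * integral {0..1} (\<lambda>t. \<phi> t * \<phi> t)"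
    using 1 2 by simp
  also have "\<dots> \<le> 24 * integral {0..1} (\<lambda>x. u x * u x) + 24 * integral {0..1} (\<lambda>t. \<phi> t * \<phi> t)"
    using order_trans[OF zero_le_power2 2] by simp
  finally show ?thesis by (simp add: d)
qed

text \<open>At \<open>x = 1\<close> the sine term of the free solution drops out, so to leading
  order the value at the head does not see the slope.\<close>

lemma schroedinger_sol_transfer:
  assumes sol: "schroedinger_sol Q z \<phi> u u'" and \<phi>: "continuous_on {0..1} \<phi>"
  shows "\<bar>u 1 - cos z * u 0\<bar> \<le> (2 * l1 Q + 1) * data_size z u u' \<phi> / z"
  using schroedinger_sol_remainder[OF Q sol \<phi> z1 zQ, of 1] by (simp add: sinz mult.commute)

text \<open>The equation tested with \<open>cos (z t)\<close>, whose derivative vanishes at both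
  ends: the boundary terms contain only the slopes of \<open>u\<close>, which the Kirchhoff
  condition can handle.\<close>

lemma schroedinger_sol_pairing:
  assumes sol: "schroedinger_sol Q z \<phi> u u'" and \<phi>: "continuous_on {0..1} \<phi>"
  shows "integral {0..1} (\<lambda>t. cos (z * t) * \<phi> t) = integral {0..1} (\<lambda>t. cos (z * t) * u t * Q t) - (cos z * u' 1 - u' 0)"
proof -
  note cu = schroedinger_sol_continuous(1)[OF Q sol \<phi>]
  have "((\<lambda>t. cos (z * t)) has_real_derivative - z * sin (z * t)) (at t)" for t
    by (auto intro!: derivative_eq_intros)
  moreover have "((\<lambda>t. - z * sin (z * t)) has_real_derivative - z\<^sup>2 * cos (z * t)) (at t)" for t
    by (auto intro!: derivative_eq_intros simp: power2_eq_square)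
  ultimately have 1: "integral {0..1} (\<lambda>t. cos (z * t) * (Q t * u t - \<phi> t)) = cos z * u' 1 - u' 0"
    using schroedinger_sol_test[OF Q sol \<phi>, of "\<lambda>t. cos (z * t)" "\<lambda>t. - z * sin (z * t)" 1] by (simp add: sinz)
  have i1: "(\<lambda>t. cos (z * t) * u t * Q t) integrable_on {0..1}"
  proof -
    have "continuous_on {0..1} (\<lambda>t. cos (z * t) * u t)" by (intro continuous_intros cu)
    from absolutely_integrable_continuous_mult[OF this Q] show ?thesis
      unfolding absolutely_integrable_on_def by blast
  qed
  have i2: "(\<lambda>t. cos (z * t) * \<phi> t) integrable_on {0..1}"
    by (intro integrable_continuous_real continuous_intros \<phi>)
  have "integral {0..1} (\<lambda>t. cos (z * t) * u t * Q t - cos (z * t) * \<phi> t) =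
      integral {0..1} (\<lambda>t. cos (z * t) * u t * Q t) - integral {0..1} (\<lambda>t. cos (z * t) * \<phi> t)"
    by (rule integral_diff[OF i1 i2])
  moreover have "(\<lambda>t. cos (z * t) * u t * Q t - cos (z * t) * \<phi> t) = (\<lambda>t. cos (z * t) * (Q t * u t - \<phi> t))"
    by (auto simp: algebra_simps)
  ultimately show ?thesis using 1 by simp
qed

text \<open>The double angle formulas split the cosine times the free solution into the constant
  \<open>u 0 / 2\<close> and oscillations at frequency \<open>2 z\<close>. The last error term is
  the remainder integrated against \<open>\<bar>Q\<bar>\<close>.\<close>

lemma schroedinger_sol_overlap:
  assumes sol: "schroedinger_sol Q z \<phi> u u'" and \<phi>: "continuous_on {0..1} \<phi>"
  shows "\<bar>integral {0..1} (\<lambda>t. cos (z * t) * u t * Q t) - u 0 * (integral {0..1} Q / 2)\<bar> \<le>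
    (\<bar>integral {0..1} (\<lambda>t. Q t * cos (2 * z * t))\<bar> + \<bar>integral {0..1} (\<lambda>t. Q t * sin (2 * z * t))\<bar>
      + l1 Q * (2 * l1 Q + 1) / z) * data_size z u u' \<phi>"
proof -
  note cu = schroedinger_sol_continuous(1)[OF Q sol \<phi>]
  define a b N where "a = u 0" "b = u' 0 / z" "N = data_size z u u' \<phi>"
  note d = a_b_N_def
  have bz: "\<bar>u' 0\<bar> / z = \<bar>b\<bar>" using z1 by (simp add: d)
  have P: "integral {0..1} (\<lambda>t. \<bar>\<phi> t\<bar>) \<ge> 0"
    by (intro integral_nonneg integrable_continuous_real continuous_intros \<phi>) auto
  have ab: "\<bar>a\<bar> \<le> N" "\<bar>b\<bar> \<le> N" using bz P by (auto simp: d)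
  define v where "v x = a * cos (z * x) + b * sin (z * x)" for x
  have cv: "continuous_on {0..1} v" unfolding v_def by (intro continuous_intros)
  define Ic Is where "Ic = integral {0..1} (\<lambda>t. Q t * cos (2 * z * t))" "Is = integral {0..1} (\<lambda>t. Q t * sin (2 * z * t))"
  have mi: "(\<lambda>t. f t * Q t) integrable_on {0..1}" if "continuous_on {0..1} f" for f
    using absolutely_integrable_continuous_mult[OF that Q] by (simp add: absolutely_integrable_on_def)
  have Qi: "Q integrable_on {0..1}" using Q by (simp add: absolutely_integrable_on_def)
  have hc: "((\<lambda>t. Q t * cos (2 * z * t)) has_integral Ic) {0..1}" "((\<lambda>t. Q t * sin (2 * z * t)) has_integral Is) {0..1}"
    unfolding Ic_Is_def mult.commute[of "Q _"]
    by (intro integrable_integral mi continuous_intros)+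
  define J where "J = integral {0..1} (\<lambda>t. cos (z * t) * (u t - v t) * Q t)"
  have hJ: "((\<lambda>t. cos (z * t) * (u t - v t) * Q t) has_integral J) {0..1}"
    unfolding J_def by (intro integrable_integral mi continuous_intros cu cv)
  have "((\<lambda>t. (Q t * (a / 2) + Q t * cos (2 * z * t) * (a / 2)) + (Q t * sin (2 * z * t) * (b / 2) + cos (z * t) * (u t - v t) * Q t))
      has_integral (integral {0..1} Q * (a / 2) + Ic * (a / 2)) + (Is * (b / 2) + J)) {0..1}"
    by (intro has_integral_add has_integral_mult_left integrable_integral Qi hc hJ)
  moreover have "(Q t * (a / 2) + Q t * cos (2 * z * t) * (a / 2)) + (Q t * sin (2 * z * t) * (b / 2) + cos (z * t) * (u t - v t) * Q t)
     = cos (z * t) * u t * Q t" for t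
  proof -
    have "cos (2 * z * t) = 2 * cos (z * t) * cos (z * t) - 1" "sin (2 * z * t) = 2 * sin (z * t) * cos (z * t)"
      using cos_double_cos[of "z * t"] sin_double[of "z * t"] by (simp_all add: mult.assoc power2_eq_square)
    then show ?thesis by (simp only: v_def) (simp add: field_simps)
  qed
  ultimately have "integral {0..1} (\<lambda>t. cos (z * t) * u t * Q t) = (integral {0..1} Q * (a / 2) + Ic * (a / 2)) + (Is * (b / 2) + J)"
    by (simp add: integral_unique)
  then have eq: "integral {0..1} (\<lambda>t. cos (z * t) * u t * Q t) - u 0 * (integral {0..1} Q / 2) = Ic * (a / 2) + Is * (b / 2) + J"
    by (simp add: d algebra_simps)
  define \<rho> where "\<rho> = (2 * l1 Q + 1) * N / z"
  have "norm J \<le> integral {0..1} (\<lambda>t. \<rho> * \<bar>Q t\<bar>)"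
    unfolding J_def
  proof (rule integral_norm_bound_integral)
    show "(\<lambda>t. cos (z * t) * (u t - v t) * Q t) integrable_on {0..1}" using hJ by blast
    show "(\<lambda>t. \<rho> * \<bar>Q t\<bar>) integrable_on {0..1}" by (intro integrable_on_mult_right Q_integrable[OF Q])
    fix t :: real assume t: "t \<in> {0..1}"
    have "\<bar>u t - v t\<bar> \<le> \<rho>"
      using schroedinger_sol_remainder[OF Q sol \<phi> z1 zQ t] by (simp add: d v_def \<rho>_def)
    then have "\<bar>cos (z * t)\<bar> * \<bar>u t - v t\<bar> \<le> 1 * \<rho>" by (intro mult_mono abs_cos_le_one) auto
    then show "norm (cos (z * t) * (u t - v t) * Q t) \<le> \<rho> * \<bar>Q t\<bar>"
      by (simp add: abs_mult mult_right_mono)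
  qed
  then have "\<bar>J\<bar> \<le> \<rho> * l1 Q" by simp
  moreover have "\<bar>Ic * (a / 2)\<bar> \<le> \<bar>Ic\<bar> * N" "\<bar>Is * (b / 2)\<bar> \<le> \<bar>Is\<bar> * N"
    unfolding abs_mult using ab by (intro mult_left_mono; simp)+
  ultimately have "\<bar>Ic * (a / 2) + Is * (b / 2) + J\<bar> \<le> \<bar>Ic\<bar> * N + \<bar>Is\<bar> * N + \<rho> * l1 Q" by linarith
  also have "\<dots> = (\<bar>Ic\<bar> + \<bar>Is\<bar> + l1 Q * (2 * l1 Q + 1) / z) * N" by (simp add: \<rho>_def algebra_simps)
  finally show ?thesis unfolding eq by (simp add: d Ic_Is_def)
qed

end

section \<open>Symmetric compact operators\<close>

text \<open>The form is semidefinite only: in the intended instance it does not see the values of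
  functions off the edges. Vectors are therefore compared through their pairings with all
  \<open>g\<close>, and limits are taken in the seminorm.\<close>

locale pre_inner_space =
  fixes X :: "('i \<Rightarrow> real) set" and ip :: "('i \<Rightarrow> real) \<Rightarrow> ('i \<Rightarrow> real) \<Rightarrow> real"
  assumes comb: "\<And>f g a b. f \<in> X \<Longrightarrow> g \<in> X \<Longrightarrow> (\<lambda>i. a * f i + b * g i) \<in> X"
    and ip_sym: "\<And>f g. f \<in> X \<Longrightarrow> g \<in> X \<Longrightarrow> ip f g = ip g f"
    and ip_lin: "\<And>f g h a b. f \<in> X \<Longrightarrow> g \<in> X \<Longrightarrow> h \<in> X \<Longrightarrow>
      ip (\<lambda>i. a * f i + b * g i) h = a * ip f h + b * ip g h"
    and ip_nonneg: "\<And>f. f \<in> X \<Longrightarrow> 0 \<le> ip f f"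
begin

lemma ip_lin_right:
  assumes "f \<in> X" "g \<in> X" "h \<in> X"
  shows "ip h (\<lambda>i. a * f i + b * g i) = a * ip h f + b * ip h g"
  using assms by (simp add: ip_sym[of h] comb ip_lin)

lemma ip_comb_self:
  assumes "f \<in> X" "g \<in> X"
  shows "ip (\<lambda>i. a * f i + b * g i) (\<lambda>i. a * f i + b * g i) = a\<^sup>2 * ip f f + 2 * a * b * ip f g + b\<^sup>2 * ip g g"
  using assms by (simp add: comb ip_lin ip_lin_right ip_sym[of g f] algebra_simps power2_eq_square)

lemma Cauchy_Schwarz:
  assumes f: "f \<in> X" and g: "g \<in> X"
  shows "(ip f g)\<^sup>2 \<le> ip f f * ip g g"
proof (cases "ip g g = 0")
  case True
  have "ip f g = 0"
  proof (rule ccontr)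
    assume n: "ip f g \<noteq> 0"
    \<comment> \<open>With \<open>ip g g = 0\<close> the quadratic expression below is affine in
      \<open>t\<close>; this \<open>t\<close> makes it \<open>- 1\<close>.\<close>
    define t where "t = - (ip f f + 1) / (2 * ip f g)"
    have "0 \<le> 1\<^sup>2 * ip f f + 2 * 1 * t * ip f g + t\<^sup>2 * ip g g"
      unfolding ip_comb_self[OF f g, symmetric] by (intro ip_nonneg comb f g)
    also have "\<dots> = - 1" using n by (simp add: True t_def field_simps)
    finally show False by simp
  qed
  then show ?thesis by (simp add: True)
next
  case False
  then have p: "ip g g > 0" using ip_nonneg[OF g] by simp
  have "0 \<le> (ip g g)\<^sup>2 * ip f f + 2 * ip g g * (- ip f g) * ip f g + (- ip f g)\<^sup>2 * ip g g"
    unfolding ip_comb_self[OF f g, symmetric] by (intro ip_nonneg comb f g)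
  also have "\<dots> = ip g g * (ip f f * ip g g - (ip f g)\<^sup>2)"
    by (simp add: algebra_simps power2_eq_square)
  finally show ?thesis using p by (simp add: zero_le_mult_iff)
qed

lemma ip_null:
  assumes "f \<in> X" "g \<in> X" "ip f f = 0"
  shows "ip f g = 0"
  using Cauchy_Schwarz[OF assms(1,2)] assms(3) by simp

lemma ip_tendsto_null:
  assumes d: "\<And>n. d n \<in> X" and lim: "(\<lambda>n. ip (d n) (d n)) \<longlonglongrightarrow> 0" and g: "g \<in> X"
  shows "(\<lambda>n. ip (d n) g) \<longlonglongrightarrow> 0"
proof -
  have "(\<lambda>n. (ip (d n) g)\<^sup>2) \<longlonglongrightarrow> 0"
  proof (rule tendsto_sandwich[OF always_eventually always_eventually tendsto_const])
    show "\<forall>n. (ip (d n) g)\<^sup>2 \<le> ip (d n) (d n) * ip g g" using Cauchy_Schwarz d g by blast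
    show "(\<lambda>n. ip (d n) (d n) * ip g g) \<longlonglongrightarrow> 0" by (rule tendsto_mult_left_zero[OF lim])
  qed auto
  then have "(\<lambda>n. sqrt ((ip (d n) g)\<^sup>2)) \<longlonglongrightarrow> sqrt 0" by (rule tendsto_real_sqrt)
  then show ?thesis by (simp add: tendsto_rabs_zero_iff)
qed

text \<open>
  Minimise \<open>ip \<phi> \<phi>\<close> subject to \<open>ip (R \<phi>) (R \<phi>) = 1\<close>, and let \<open>m\<^sup>2\<close> be the infimum.  Along a
  minimising sequence \<open>\<phi> - m\<^sup>2 R R \<phi>\<close> tends to \<open>0\<close>, so the limit \<open>u\<close> of \<open>R \<phi>\<close> satisfies
  \<open>u = m\<^sup>2 R R u\<close>, and one of \<open>u + m R u\<close> and \<open>u\<close> is an eigenvector of \<open>R\<close>.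
\<close>

lemma compact_symmetric_eigenvector:
  assumes R: "\<And>f. f \<in> X \<Longrightarrow> R f \<in> X"
    and sym: "\<And>f g. f \<in> X \<Longrightarrow> g \<in> X \<Longrightarrow> ip (R f) g = ip f (R g)"
    and cpt: "\<And>\<phi> K. (\<And>n::nat. \<phi> n \<in> X) \<Longrightarrow> (\<And>n. ip (\<phi> n) (\<phi> n) \<le> K) \<Longrightarrow> (\<And>n. ip (R (\<phi> n)) (R (\<phi> n)) \<le> K) \<Longrightarrow>
      \<exists>r u. strict_mono (r :: nat \<Rightarrow> nat) \<and> u \<in> X \<and>
        (\<lambda>n. ip (\<lambda>i. 1 * R (\<phi> (r n)) i + (-1) * u i) (\<lambda>i. 1 * R (\<phi> (r n)) i + (-1) * u i)) \<longlonglongrightarrow> 0"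
    and \<phi>0: "\<phi>0 \<in> X" "ip (R \<phi>0) (R \<phi>0) > 0" "ip \<phi>0 \<phi>0 \<le> \<epsilon>\<^sup>2 * ip (R \<phi>0) (R \<phi>0)" and \<epsilon>: "\<epsilon> \<ge> 0"
  obtains f \<kappa> where "f \<in> X" "\<bar>\<kappa>\<bar> \<le> \<epsilon>" "ip f f > 0" "\<And>g. g \<in> X \<Longrightarrow> ip f g = \<kappa> * ip (R f) g"
proof -
  define A where "A = {ip \<phi> \<phi> |\<phi>. \<phi> \<in> X \<and> ip (R \<phi>) (R \<phi>) = 1}"
  \<comment> \<open>The operator will be defined by choice, so its homogeneity is read off from
    symmetry: \<open>ip (R \<psi>) h = ip \<psi> (R h)\<close> is linear in \<psi>.\<close>
  have scale: "\<exists>\<psi>\<in>X. ip (R \<psi>) (R \<psi>) = 1 \<and> ip \<psi> \<psi> = ip \<phi> \<phi> / ip (R \<phi>) (R \<phi>)"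
    if \<phi>: "\<phi> \<in> X" "ip (R \<phi>) (R \<phi>) > 0" for \<phi>
  proof -
    define c where "c = 1 / sqrt (ip (R \<phi>) (R \<phi>))"
    have c2: "c * c = 1 / ip (R \<phi>) (R \<phi>)" using \<phi> by (simp add: c_def)
    define \<psi> where "\<psi> = (\<lambda>i. c * \<phi> i + 0 * \<phi> i)"
    have \<psi>: "\<psi> \<in> X" unfolding \<psi>_def by (intro comb \<phi>)
    have l: "ip \<psi> g = c * ip \<phi> g" if "g \<in> X" for g
      unfolding \<psi>_def using ip_lin[OF \<phi>(1) \<phi>(1) that, of c 0] by simp
    have "ip (R \<psi>) (R \<psi>) = c * ip \<phi> (R (R \<psi>))" using sym[OF \<psi> R[OF \<psi>]] l \<psi> R by simp
    also have "ip \<phi> (R (R \<psi>)) = ip \<psi> (R (R \<phi>))"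
      using sym[OF \<phi>(1) R[OF \<psi>]] sym[OF \<psi> R[OF \<phi>(1)]] ip_sym R \<phi> \<psi> by metis
    also have "\<dots> = c * ip (R \<phi>) (R \<phi>)" using l R \<phi> sym[OF \<phi>(1) R[OF \<phi>(1)]] by simp
    finally have "ip (R \<psi>) (R \<psi>) = (c * c) * ip (R \<phi>) (R \<phi>)" by simp
    then have 1: "ip (R \<psi>) (R \<psi>) = 1" using \<phi> by (simp add: c2)
    have "ip \<psi> \<psi> = (c * c) * ip \<phi> \<phi>" using l \<psi> \<phi> ip_sym[OF \<phi>(1) \<psi>] by simp
    then show ?thesis using \<psi> 1 by (auto simp: c2)
  qed
  obtain \<psi>0 where \<psi>0: "\<psi>0 \<in> X" "ip (R \<psi>0) (R \<psi>0) = 1" "ip \<psi>0 \<psi>0 = ip \<phi>0 \<phi>0 / ip (R \<phi>0) (R \<phi>0)"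
    using scale[OF \<phi>0(1,2)] by blast
  have ne: "ip \<psi>0 \<psi>0 \<in> A" using \<psi>0 unfolding A_def by blast
  have bdd: "bdd_below A" unfolding A_def by (rule bdd_belowI[of _ 0]) (auto simp: ip_nonneg)
  define M where "M = Inf A"
  have M0: "M \<ge> 0" unfolding M_def using ne by (intro cInf_greatest) (auto simp: A_def ip_nonneg)
  have "M \<le> ip \<psi>0 \<psi>0" unfolding M_def by (rule cInf_lower[OF ne bdd])
  also have "\<dots> \<le> \<epsilon>\<^sup>2" using \<phi>0 \<psi>0(3) by (simp add: divide_le_eq)
  finally have M\<epsilon>: "sqrt M \<le> \<epsilon>" using \<epsilon> by (simp add: real_le_lsqrt)
  \<comment> \<open>In operator terms, \<open>1 - M R\<^sup>2\<close> is positive semidefinite. For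
    \<open>v n\<close> this is what makes the defect \<open>d n\<close> small.\<close>
  have low: "M * ip (R \<phi>) (R \<phi>) \<le> ip \<phi> \<phi>" if \<phi>: "\<phi> \<in> X" for \<phi>
  proof (cases "ip (R \<phi>) (R \<phi>) = 0")
    case True
    then show ?thesis using ip_nonneg[OF \<phi>] by simp
  next
    case False
    then have p: "ip (R \<phi>) (R \<phi>) > 0" using ip_nonneg[OF R[OF \<phi>]] by simp
    obtain \<psi> where \<psi>: "\<psi> \<in> X" "ip (R \<psi>) (R \<psi>) = 1" "ip \<psi> \<psi> = ip \<phi> \<phi> / ip (R \<phi>) (R \<phi>)"
      using scale[OF \<phi> p] by blast
    then have "ip \<psi> \<psi> \<in> A" unfolding A_def by blast
    then have "M \<le> ip \<psi> \<psi>" unfolding M_def by (rule cInf_lower[OF _ bdd])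
    then show ?thesis using p \<psi> by (simp add: le_divide_eq)
  qed
  have "\<exists>\<phi>\<in>X. ip (R \<phi>) (R \<phi>) = 1 \<and> ip \<phi> \<phi> < M + inverse (real (Suc n))" for n
  proof -
    have "Inf A < M + inverse (real (Suc n))" unfolding M_def by simp
    then obtain x where "x \<in> A" "x < M + inverse (real (Suc n))" using cInf_lessD[of A] ne by blast
    then show ?thesis unfolding A_def by blast
  qed
  then obtain \<phi> where \<phi>: "\<And>n. \<phi> n \<in> X" "\<And>n. ip (R (\<phi> n)) (R (\<phi> n)) = 1" "\<And>n. ip (\<phi> n) (\<phi> n) < M + inverse (real (Suc n))"
    by metis
  have "inverse (real (Suc n)) \<le> 1" for n by (simp add: inverse_le_1_iff)
  then have "ip (\<phi> n) (\<phi> n) \<le> M + 1" for n using \<phi>(3)[of n] by (meson add_left_mono less_le_trans less_imp_le)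
  then obtain r u where r: "strict_mono (r :: nat \<Rightarrow> nat)" and u: "u \<in> X"
    and lim: "(\<lambda>n. ip (\<lambda>i. 1 * R (\<phi> (r n)) i + (-1) * u i) (\<lambda>i. 1 * R (\<phi> (r n)) i + (-1) * u i)) \<longlonglongrightarrow> 0"
    using cpt[of \<phi> "M + 1"] \<phi> M0 by auto
  define \<psi> where "\<psi> n = \<phi> (r n)" for n
  define v where "v n = R (\<psi> n)" for n
  have \<psi>: "\<psi> n \<in> X" and v: "v n \<in> X" and vv: "ip (v n) (v n) = 1" for n
    using \<phi> R by (auto simp: \<psi>_def v_def)
  have vu: "(\<lambda>n. ip (v n) g) \<longlonglongrightarrow> ip u g" if g: "g \<in> X" for g
  proof -
    have "(\<lambda>n. ip (\<lambda>i. 1 * v n i + (-1) * u i) g) \<longlonglongrightarrow> 0"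
      by (rule ip_tendsto_null[OF comb[OF v u] _ g]) (use lim in \<open>simp add: v_def \<psi>_def\<close>)
    then have "(\<lambda>n. ip (v n) g - ip u g) \<longlonglongrightarrow> 0" by (simp only: ip_lin[OF v u g]) simp
    then show ?thesis by (rule LIM_zero_cancel)
  qed
  have "(\<lambda>n. ip (\<lambda>i. 1 * v n i + (-1) * u i) (\<lambda>i. 1 * v n i + (-1) * u i)) \<longlonglongrightarrow> 0"
    using lim by (simp add: v_def \<psi>_def)
  then have "(\<lambda>n. 1 - 2 * ip (v n) u + ip u u) \<longlonglongrightarrow> 0"
    by (simp only: ip_comb_self[OF v u] vv) simp
  moreover have "(\<lambda>n. 1 - 2 * ip (v n) u + ip u u) \<longlonglongrightarrow> 1 - 2 * ip u u + ip u u"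
    by (intro tendsto_intros vu u)
  ultimately have "1 - 2 * ip u u + ip u u = 0" by (rule LIMSEQ_unique[symmetric])
  \<comment> \<open>Convergence in the seminorm preserves the normalisation, so \<open>u\<close> is
    not a null vector.\<close>
  then have uu: "ip u u = 1" by simp
  have inv: "(\<lambda>n. inverse (real (Suc (r n)))) \<longlonglongrightarrow> 0"
    using LIMSEQ_subseq_LIMSEQ[OF LIMSEQ_inverse_real_of_nat r] by (simp add: o_def)
  \<comment> \<open>The defect in the Euler-Lagrange equation \<open>\<psi> = M R R \<psi>\<close>
    of the minimisation. Its square expands to at most \<open>ip \<psi> \<psi> - M\<close>, the
    excess over the infimum.\<close>
  define d where "d n = (\<lambda>i. 1 * \<psi> n i + (- M) * R (v n) i)" for n
  have dX: "d n \<in> X" for n unfolding d_def by (intro comb \<psi> R v)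
  have "(\<lambda>n. ip (d n) (d n)) \<longlonglongrightarrow> 0"
  proof (rule tendsto_sandwich[OF always_eventually always_eventually tendsto_const inv]; intro allI)
    fix n
    show "0 \<le> ip (d n) (d n)" by (rule ip_nonneg[OF dX])
    have "ip (\<psi> n) (R (v n)) = 1" using sym[OF \<psi> v] vv by (simp add: v_def)
    then have "ip (d n) (d n) = ip (\<psi> n) (\<psi> n) - 2 * M + M * (M * ip (R (v n)) (R (v n)))"
      unfolding d_def ip_comb_self[OF \<psi> R[OF v]] by (simp add: power2_eq_square)
    also have "M * (M * ip (R (v n)) (R (v n))) \<le> M * 1"
      using low[OF v, of n] vv M0 by (intro mult_left_mono) auto
    finally show "ip (d n) (d n) \<le> inverse (real (Suc (r n)))"
      using \<phi>(3)[of "r n"] by (simp add: \<psi>_def)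
  qed
  then have dz: "(\<lambda>n. ip (d n) g) \<longlonglongrightarrow> 0" if "g \<in> X" for g
    by (rule ip_tendsto_null[OF dX _ that])
  have key: "ip u g = M * ip (R (R u)) g" if g: "g \<in> X" for g
  proof -
    have "ip (v n) g = ip (d n) (R g) + M * ip (v n) (R (R g))" for n
      unfolding d_def ip_lin[OF \<psi> R[OF v] R[OF g]]
      using sym[OF \<psi> g] sym[OF v R[OF g]] by (simp add: v_def)
    moreover have "(\<lambda>n. ip (d n) (R g) + M * ip (v n) (R (R g))) \<longlonglongrightarrow> 0 + M * ip u (R (R g))"
      by (intro tendsto_intros dz vu R g)
    ultimately have "ip u g = M * ip u (R (R g))"
      using vu[OF g] by (simp add: LIMSEQ_unique)
    then show ?thesis using sym[OF u R[OF g]] sym[OF R[OF u] g] by simp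
  qed
  define m where "m = sqrt M"
  have m: "0 \<le> m" "m \<le> \<epsilon>" "m * m = M" using M0 M\<epsilon> by (auto simp: m_def)
  \<comment> \<open>From the factorisation of \<open>1 - m\<^sup>2 R\<^sup>2\<close>: up to null
    vectors \<open>1 - m R\<close> annihilates \<open>f\<close>; if \<open>f\<close> itself is null,
    then \<open>1 + m R\<close> annihilates \<open>u\<close>.\<close>
  define f where "f = (\<lambda>i. 1 * u i + m * R u i)"
  have f: "f \<in> X" unfolding f_def by (intro comb u R)
  have fg: "ip f g = ip u g + m * ip (R u) g" if "g \<in> X" for g
    unfolding f_def using ip_lin[OF u R[OF u] that, of 1 m] by simp
  show ?thesis
  proof (cases "ip f f = 0")
    case False
    show ?thesis
    proof (rule that[OF f, of m])
      show "ip f f > 0" using ip_nonneg[OF f] False by simp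
      fix g assume g: "g \<in> X"
      have "m * ip (R f) g = m * ip u (R g) + m * m * ip (R u) (R g)"
        using sym[OF f g] fg[OF R[OF g]] by (simp add: algebra_simps)
      also have "\<dots> = m * ip (R u) g + M * ip (R (R u)) g"
        using sym[OF u g] sym[OF R[OF u] g] m by simp
      finally show "ip f g = m * ip (R f) g" using fg[OF g] key[OF g] by simp
    qed (use m in auto)
  next
    case True
    show ?thesis
    proof (rule that[OF u, of "- m"])
      show "ip u g = - m * ip (R u) g" if "g \<in> X" for g
        using ip_null[OF f that True] fg[OF that] by simp
    qed (use m uu in auto)
  qed
qed

end

section \<open>Finite systems\<close>

text \<open>Uniqueness implies existence, by Gaussian elimination with pivot \<open>L i0 j0\<close>.
  Equations and unknowns have separate index sets, so that the induction can remove one of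
  each.\<close>

lemma finite_square_system:
  fixes L :: "'a \<Rightarrow> 'b \<Rightarrow> real"
  assumes "finite I" "finite J" "card I = card J"
    and "\<And>x. (\<And>i. i \<in> I \<Longrightarrow> (\<Sum>j\<in>J. L i j * x j) = 0) \<Longrightarrow> \<forall>j\<in>J. x j = 0"
  shows "\<exists>x. \<forall>i\<in>I. (\<Sum>j\<in>J. L i j * x j) = c i"
  using assms
proof (induction "card J" arbitrary: I J L c)
  case 0
  then show ?case by simp
next
  case (Suc k)
  then obtain j0 where j0: "j0 \<in> J" by (metis card.empty ex_in_conv nat.distinct(1))
  have "\<exists>i0\<in>I. L i0 j0 \<noteq> 0"
  proof (rule ccontr)
    assume "\<not> (\<exists>i0\<in>I. L i0 j0 \<noteq> 0)"
    then have "(\<Sum>j\<in>J. L i j * (if j = j0 then 1 else 0)) = 0" if "i \<in> I" for i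
      using that j0 Suc.prems(2) by (simp add: if_distrib[of "\<lambda>x. _ * x"] cong: if_cong)
    from Suc.prems(4)[OF this] j0 show False by auto
  qed
  then obtain i0 where i0: "i0 \<in> I" "L i0 j0 \<noteq> 0" by blast
  let ?I = "I - {i0}" and ?J = "J - {j0}"
  define L' where "L' i j = L i j - L i j0 * L i0 j / L i0 j0" for i j
  define c' where "c' i = c i - L i j0 * c i0 / L i0 j0" for i
  \<comment> \<open>Row \<open>i0\<close> with right-hand side \<open>d\<close>, solved for the
    unknown \<open>j0\<close>. The value \<open>d = 0\<close> carries uniqueness over to the reduced
    system, \<open>d = c i0\<close> extends a solution of it.\<close>
  define ext where "ext d x = x(j0 := (d - (\<Sum>j\<in>?J. L i0 j * x j)) / L i0 j0)" for d and x :: "'b \<Rightarrow> real"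
  have S: "(\<Sum>j\<in>J. L i j * ext d x j) = (\<Sum>j\<in>?J. L' i j * x j) + L i j0 * d / L i0 j0" for i d x
  proof -
    have "(\<Sum>j\<in>J. L i j * ext d x j) = L i j0 * ext d x j0 + (\<Sum>j\<in>?J. L i j * ext d x j)"
      by (rule sum.remove[OF Suc.prems(2) j0])
    also have "(\<Sum>j\<in>?J. L i j * ext d x j) = (\<Sum>j\<in>?J. L i j * x j)"
      by (rule sum.cong) (auto simp: ext_def)
    also have "L i j0 * ext d x j0 = L i j0 * d / L i0 j0 - (\<Sum>j\<in>?J. L i j0 * L i0 j / L i0 j0 * x j)"
      by (simp add: ext_def diff_divide_distrib right_diff_distrib sum_distrib_left sum_divide_distrib mult.assoc)
    finally show ?thesis by (simp add: L'_def left_diff_distrib sum_subtractf)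
  qed
  have S0: "(\<Sum>j\<in>J. L i0 j * ext d x j) = d" for d x
    unfolding S using i0 by (simp add: L'_def)
  have "\<exists>x. \<forall>i\<in>?I. (\<Sum>j\<in>?J. L' i j * x j) = c' i"
  proof (rule Suc.hyps(1))
    show "k = card ?J" "finite ?I" "finite ?J" "card ?I = card ?J"
      using Suc.hyps(2) Suc.prems j0 i0 by auto
    fix x assume x: "\<And>i. i \<in> ?I \<Longrightarrow> (\<Sum>j\<in>?J. L' i j * x j) = 0"
    have "(\<Sum>j\<in>J. L i j * ext 0 x j) = 0" if "i \<in> I" for i
      using x[of i] that S[of i 0 x] S0[of 0 x] by (cases "i = i0") auto
    from Suc.prems(4)[OF this] have "\<forall>j\<in>J. ext 0 x j = 0" .
    then show "\<forall>j\<in>?J. x j = 0" by (auto simp: ext_def split: if_splits)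
  qed
  then obtain x where x: "\<And>i. i \<in> ?I \<Longrightarrow> (\<Sum>j\<in>?J. L' i j * x j) = c' i" by blast
  have "(\<Sum>j\<in>J. L i j * ext (c i0) x j) = c i" if "i \<in> I" for i
    using x[of i] that S[of i "c i0" x] S0[of "c i0" x] by (cases "i = i0") (auto simp: c'_def)
  then show ?case by blast
qed

text \<open>One extraction for each member of the family, always from the subsequence found
  before.\<close>

lemma Arzela_Ascoli_finite_family:
  fixes f :: "nat \<Rightarrow> 'e \<Rightarrow> real \<Rightarrow> real"
  assumes "finite A"
    and "\<And>n e x. e \<in> A \<Longrightarrow> x \<in> {0..1} \<Longrightarrow> \<bar>f n e x\<bar> \<le> B"
    and "\<And>n e x y. e \<in> A \<Longrightarrow> x \<in> {0..1} \<Longrightarrow> y \<in> {0..1} \<Longrightarrow> \<bar>f n e x - f n e y\<bar> \<le> L * \<bar>x - y\<bar>"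
  shows "\<exists>r g. strict_mono (r :: nat \<Rightarrow> nat) \<and>
    (\<forall>e\<in>A. continuous_on {0..1} (g e) \<and> uniform_limit {0..1} (\<lambda>n. f (r n) e) (g e) sequentially)"
  using assms
proof (induction A rule: finite_induct)
  case empty
  show ?case by (intro exI[of _ "\<lambda>n. n"]) (simp add: strict_mono_def)
next
  case (insert e A)
  have "\<exists>r g. strict_mono (r :: nat \<Rightarrow> nat) \<and>
      (\<forall>e\<in>A. continuous_on {0..1} (g e) \<and> uniform_limit {0..1} (\<lambda>n. f (r n) e) (g e) sequentially)"
    by (rule insert.IH; rule insert.prems; simp)
  then obtain r g where r: "strict_mono (r :: nat \<Rightarrow> nat)"
    and g: "\<And>e'. e' \<in> A \<Longrightarrow> continuous_on {0..1} (g e') \<and> uniform_limit {0..1} (\<lambda>n. f (r n) e') (g e') sequentially"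
    by blast
  \<comment> \<open>\<open>\<bar>L\<bar> + 1\<close> is positive, so it can be the denominator of
    the modulus of continuity.\<close>
  have L: "\<bar>f n e x - f n e y\<bar> \<le> (\<bar>L\<bar> + 1) * \<bar>x - y\<bar>" if "x \<in> {0..1}" "y \<in> {0..1}" for n x y
  proof -
    have "L * \<bar>x - y\<bar> \<le> (\<bar>L\<bar> + 1) * \<bar>x - y\<bar>" by (intro mult_right_mono) auto
    then show ?thesis using insert.prems(2)[of e x y n] that by simp
  qed
  obtain h k where h: "continuous_on {0..1} h" and k: "strict_mono (k :: nat \<Rightarrow> nat)"
    and lim: "\<And>\<epsilon>. 0 < \<epsilon> \<Longrightarrow> \<exists>N. \<forall>n x. n \<ge> N \<and> x \<in> {0..1} \<longrightarrow> norm (f (r (k n)) e x - h x) < \<epsilon>"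
  proof (rule Arzela_Ascoli[of "{0..1::real}" "\<lambda>n. f (r n) e" B])
    show "norm (f (r n) e x) \<le> B" if "x \<in> {0..1}" for n x using insert.prems(1) that by simp
    fix x \<epsilon> :: real assume x: "x \<in> {0..1}" and \<epsilon>: "0 < \<epsilon>"
    show "\<exists>d>0. \<forall>n y. y \<in> {0..1} \<and> norm (x - y) < d \<longrightarrow> norm (f (r n) e x - f (r n) e y) < \<epsilon>"
    proof (intro exI[of _ "\<epsilon> / (\<bar>L\<bar> + 1)"] conjI allI impI)
      show "0 < \<epsilon> / (\<bar>L\<bar> + 1)" using \<epsilon> by simp
      fix n y assume y: "y \<in> {0..1} \<and> norm (x - y) < \<epsilon> / (\<bar>L\<bar> + 1)"
      then have "(\<bar>L\<bar> + 1) * \<bar>x - y\<bar> < \<epsilon>" by (simp add: field_simps)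
      then show "norm (f (r n) e x - f (r n) e y) < \<epsilon>" using L[OF x, of y "r n"] y by simp
    qed
  qed (auto simp: that)
  define g' where "g' = g(e := h)"
  have "continuous_on {0..1} (g' e') \<and> uniform_limit {0..1} (\<lambda>n. f ((r \<circ> k) n) e') (g' e') sequentially"
    if "e' \<in> insert e A" for e'
  proof (cases "e' = e")
    case True
    have "uniform_limit {0..1} (\<lambda>n. f (r (k n)) e) h sequentially"
      unfolding uniform_limit_sequentially_iff dist_real_def
    proof (intro allI impI)
      fix \<epsilon> :: real assume "0 < \<epsilon>"
      then obtain N where "\<forall>n x. n \<ge> N \<and> x \<in> {0..1} \<longrightarrow> norm (f (r (k n)) e x - h x) < \<epsilon>"
        using lim by blast
      then show "\<exists>N. \<forall>n\<ge>N. \<forall>x\<in>{0..1}. \<bar>f (r (k n)) e x - h x\<bar> < \<epsilon>"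
        by (intro exI[of _ N]) auto
    qed
    then show ?thesis using h True by (simp add: g'_def)
  next
    case False
    then have e': "e' \<in> A" using that by simp
    have "uniform_limit {0..1} (\<lambda>n. f (r (k n)) e') (g e') sequentially"
      by (rule filterlim_compose[OF conjunct2[OF g[OF e']] filterlim_subseq[OF k]])
    then show ?thesis using g[OF e'] False by (simp add: g'_def)
  qed
  moreover have "strict_mono (r \<circ> k)" using r k by (rule strict_mono_o)
  ultimately show ?case by blast
qed

section \<open>The Schroedinger equation on a graph\<close>

text \<open>Continuity is recorded by the common value \<open>a\<close> at each vertex. Summation by
  parts and the connectivity bound act on this function on the vertices.\<close>

definition vertex_conditions ::
  "('v, 'e) pre_digraph \<Rightarrow> ('v \<Rightarrow> real) \<Rightarrow> ('e \<Rightarrow> real \<Rightarrow> real) \<Rightarrow> ('e \<Rightarrow> real \<Rightarrow> real) \<Rightarrow> bool" where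
  "vertex_conditions G a u u' \<longleftrightarrow>
    (\<forall>e\<in>arcs G. u e 0 = a (tail G e) \<and> u e 1 = a (head G e)) \<and>
    (\<forall>v\<in>verts G. (\<Sum>e\<in>out_arcs G v. u' e 0) = (\<Sum>e\<in>in_arcs G v. u' e 1))"

lemma standard_matching_of_real:
  assumes "vertex_conditions G a u u'"
  shows "standard_matching G (\<lambda>e x. complex_of_real (u e x)) (\<lambda>e x. complex_of_real (u' e x))"
proof -
  have "complex_of_real (u e \<kappa>) = a v" if "(e, \<kappa>) \<in> edge_ends_at G v" for e \<kappa> v
    using that assms unfolding edge_ends_at_def vertex_conditions_def by auto
  moreover have "(\<Sum>e\<in>out_arcs G v. complex_of_real (u' e 0)) = (\<Sum>e\<in>in_arcs G v. complex_of_real (u' e 1))"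
    if "v \<in> verts G" for v
    using assms that unfolding vertex_conditions_def of_real_sum[symmetric] by simp
  ultimately show ?thesis unfolding standard_matching_def by fastforce
qed

section \<open>Summation by parts and connectivity on a digraph\<close>

context fin_digraph
begin

lemma sum_in_arcs: "(\<Sum>v\<in>verts G. \<Sum>e\<in>in_arcs G v. h e) = (\<Sum>e\<in>arcs G. h e)"
  for h :: "'b \<Rightarrow> real"
  unfolding in_arcs_def by (rule sum.group) auto

lemma sum_out_arcs: "(\<Sum>v\<in>verts G. \<Sum>e\<in>out_arcs G v. h e) = (\<Sum>e\<in>arcs G. h e)"
  for h :: "'b \<Rightarrow> real"
  unfolding out_arcs_def by (rule sum.group) auto

text \<open>Summation by parts: grouped by vertices, the coefficient of \<open>b v\<close> is the
  Kirchhoff defect at \<open>v\<close>. For \<open>b\<close> one takes the vertex values of a second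
  solution, or the signs \<sigma>.\<close>

lemma vertex_conditions_flux:
  assumes "vertex_conditions G a u u'"
  shows "(\<Sum>e\<in>arcs G. b (head G e) * u' e 1 - b (tail G e) * u' e 0) = 0"
proof -
  have "(\<Sum>e\<in>arcs G. b (head G e) * u' e 1) = (\<Sum>v\<in>verts G. b v * (\<Sum>e\<in>in_arcs G v. u' e 1))"
    unfolding sum_in_arcs[symmetric] sum_distrib_left by (intro sum.cong refl) auto
  moreover have "(\<Sum>e\<in>arcs G. b (tail G e) * u' e 0) = (\<Sum>v\<in>verts G. b v * (\<Sum>e\<in>out_arcs G v. u' e 0))"
    unfolding sum_out_arcs[symmetric] sum_distrib_left by (intro sum.cong refl) auto
  ultimately show ?thesis
    using assms unfolding vertex_conditions_def by (simp add: sum_subtractf)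
qed

text \<open>Each step of a walk from \<open>v0\<close> costs at most \<eta>. What matters is that
  \<open>K\<close> depends on the graph and \<open>v0\<close> alone: it will be applied to functions
  \<open>a\<close> that change with \<open>z\<close>.\<close>

lemma connected_variation_bound:
  assumes "Digraph_Component.connected G" "v0 \<in> verts G"
  shows "\<exists>K\<ge>0. \<forall>(a :: 'a \<Rightarrow> real) \<eta>. \<eta> \<ge> 0 \<longrightarrow> (\<forall>e\<in>arcs G. \<bar>a (head G e) - a (tail G e)\<bar> \<le> \<eta>) \<longrightarrow>
    (\<forall>v\<in>verts G. \<bar>a v - a v0\<bar> \<le> K * \<eta>)"
proof -
  define P where "P v K \<longleftrightarrow> K \<ge> 0 \<and> (\<forall>(a :: 'a \<Rightarrow> real) \<eta>. \<eta> \<ge> 0 \<longrightarrow>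
    (\<forall>e\<in>arcs G. \<bar>a (head G e) - a (tail G e)\<bar> \<le> \<eta>) \<longrightarrow> \<bar>a v - a v0\<bar> \<le> K * \<eta>)" for v and K :: real
  have "\<exists>K. P v K" if v: "v \<in> verts G" for v
  proof -
    have "v0 \<rightarrow>\<^sup>*\<^bsub>with_proj (mk_symmetric G)\<^esub> v"
      using assms v unfolding Digraph_Component.connected_def strongly_connected_def by simp
    then have "(v0, v) \<in> rtrancl_on (verts G) (parcs (mk_symmetric G))"
      unfolding reachable_def by simp
    then show ?thesis
    proof (induction rule: rtrancl_on_induct)
      case base
      then show ?case by (intro exI[of _ 0]) (simp add: P_def)
    next
      case (step y w)
      then obtain K where K: "P y K" by blast
      have "P w (K + 1)"
        unfolding P_def
      proof (intro conjI allI impI)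
        show "0 \<le> K + 1" using K by (simp add: P_def)
        fix a :: "'a \<Rightarrow> real" and \<eta> :: real
        assume a: "\<eta> \<ge> 0" "\<forall>e\<in>arcs G. \<bar>a (head G e) - a (tail G e)\<bar> \<le> \<eta>"
        have "\<bar>a w - a y\<bar> \<le> \<eta>"
          using step(2) a(2) by (auto simp: parcs_mk_symmetric abs_minus_commute)
        moreover have "\<bar>a y - a v0\<bar> \<le> K * \<eta>" using K a unfolding P_def by blast
        ultimately show "\<bar>a w - a v0\<bar> \<le> (K + 1) * \<eta>" by (simp add: distrib_right)
      qed
      then show ?case by blast
    qed
  qed
  then obtain K where K: "\<And>v. v \<in> verts G \<Longrightarrow> P v (K v)" by metis
  have K0: "K v \<ge> 0" if "v \<in> verts G" for v using K[OF that] by (simp add: P_def)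
  show ?thesis
  proof (intro exI[of _ "\<Sum>v\<in>verts G. K v"] conjI allI impI ballI)
    show "0 \<le> (\<Sum>v\<in>verts G. K v)" using K0 by (rule sum_nonneg)
    fix a :: "'a \<Rightarrow> real" and \<eta> v
    assume a: "\<eta> \<ge> 0" "\<forall>e\<in>arcs G. \<bar>a (head G e) - a (tail G e)\<bar> \<le> \<eta>" and v: "v \<in> verts G"
    have "\<bar>a v - a v0\<bar> \<le> K v * \<eta>" using K[OF v] a unfolding P_def by blast
    also have "\<dots> \<le> (\<Sum>v\<in>verts G. K v) * \<eta>"
      using v K0 a by (intro mult_right_mono member_le_sum) auto
    finally show "\<bar>a v - a v0\<bar> \<le> (\<Sum>v\<in>verts G. K v) * \<eta>" .
  qed
qed

end

section \<open>Solvability of the boundary value problem on the graph\<close>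

locale schroedinger_graph = fin_digraph G for G :: "('v, 'e) pre_digraph" +
  fixes Q :: "'e \<Rightarrow> real \<Rightarrow> real"
  assumes conn: "Digraph_Component.connected G"
    and arcs_ne: "arcs G \<noteq> {}"
    and Q: "\<And>e. e \<in> arcs G \<Longrightarrow> Q e absolutely_integrable_on {0..1}"
begin

definition graph_sol ::
  "real \<Rightarrow> ('e \<Rightarrow> real \<Rightarrow> real) \<Rightarrow> ('v \<Rightarrow> real) \<Rightarrow> ('e \<Rightarrow> real \<Rightarrow> real) \<Rightarrow> ('e \<Rightarrow> real \<Rightarrow> real) \<Rightarrow> bool" where
  "graph_sol z \<phi> a u u' \<longleftrightarrow> vertex_conditions G a u u' \<and>
    (\<forall>e\<in>arcs G. schroedinger_sol (Q e) z (\<phi> e) (u e) (u' e))"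

lemma graph_solD:
  assumes "graph_sol z \<phi> a u u'"
  shows "vertex_conditions G a u u'"
    and "e \<in> arcs G \<Longrightarrow> schroedinger_sol (Q e) z (\<phi> e) (u e) (u' e)"
    and "e \<in> arcs G \<Longrightarrow> u e 0 = a (tail G e)" and "e \<in> arcs G \<Longrightarrow> u e 1 = a (head G e)"
  using assms unfolding graph_sol_def vertex_conditions_def by blast+

text \<open>The bound by \<open>l1\<close> makes the fixed point map a contraction and permits the
  absorption in the sup estimate; the bound on \<open>z\<^sup>2\<close> permits the absorption in
  the energy estimate.\<close>

definition large :: "real \<Rightarrow> bool" where
  "large z \<longleftrightarrow> z \<ge> 1 \<and> (\<forall>e\<in>arcs G. 2 * l1 (Q e) \<le> z \<and> 24 * (2 * l1 (Q e) + 1)\<^sup>2 \<le> z\<^sup>2)"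

text \<open>The boundary terms of the Lagrange identity are the slopes of each solution paired with
  the vertex values of the other, so they sum to zero. This is the symmetry of the
  resolvent.\<close>

lemma graph_sol_symmetric:
  assumes "graph_sol z \<phi> a u u'" "graph_sol z \<psi> b w w'"
    and \<phi>: "\<And>e. e \<in> arcs G \<Longrightarrow> continuous_on {0..1} (\<phi> e)"
    and \<psi>: "\<And>e. e \<in> arcs G \<Longrightarrow> continuous_on {0..1} (\<psi> e)"
  shows "(\<Sum>e\<in>arcs G. integral {0..1} (\<lambda>t. u e t * \<psi> e t)) = (\<Sum>e\<in>arcs G. integral {0..1} (\<lambda>t. \<phi> e t * w e t))"
proof -
  have "(\<Sum>e\<in>arcs G. integral {0..1} (\<lambda>t. u e t * \<psi> e t)) - (\<Sum>e\<in>arcs G. integral {0..1} (\<lambda>t. \<phi> e t * w e t)) =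
     (\<Sum>e\<in>arcs G. (w e 1 * u' e 1 - u e 1 * w' e 1) - (w e 0 * u' e 0 - u e 0 * w' e 0))"
    unfolding sum_subtractf[symmetric]
    by (intro sum.cong refl schroedinger_sol_Lagrange[OF Q graph_solD(2)[OF assms(1)] \<phi> graph_solD(2)[OF assms(2)] \<psi>])
  also have "\<dots> = (\<Sum>e\<in>arcs G. (b (head G e) * u' e 1 - b (tail G e) * u' e 0) - (a (head G e) * w' e 1 - a (tail G e) * w' e 0))"
    using assms(1,2) unfolding graph_sol_def vertex_conditions_def by (intro sum.cong refl) simp
  also have "\<dots> = 0"
    unfolding sum_subtractf[of "\<lambda>e. b (head G e) * u' e 1 - b (tail G e) * u' e 0"]
      vertex_conditions_flux[OF graph_solD(1)[OF assms(1)]] vertex_conditions_flux[OF graph_solD(1)[OF assms(2)]]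
    by simp
  finally show ?thesis by simp
qed

text \<open>Vertex values and initial slopes, the unknowns of the linear system below, cannot be
  nonzero for a zero solution. For the vertices, connectedness with \<eta> = 0 makes
  \<open>a\<close> constant, and it is 0 at the ends of an edge.\<close>

lemma graph_sol_zero_data:
  assumes sol: "graph_sol z (\<lambda>e x. 0) a u u'" and z: "z \<ge> 1"
    and zero: "\<And>e x. e \<in> arcs G \<Longrightarrow> x \<in> {0..1} \<Longrightarrow> u e x = 0"
  shows "v \<in> verts G \<Longrightarrow> a v = 0" and "e \<in> arcs G \<Longrightarrow> u' e 0 = 0"
proof -
  have a0: "a (tail G e) = 0 \<and> a (head G e) = 0" if "e \<in> arcs G" for e
    using sol zero[OF that, of 0] zero[OF that, of 1] that unfolding graph_sol_def vertex_conditions_def by simp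
  obtain e0 where e0: "e0 \<in> arcs G" using arcs_ne by blast
  show "a v = 0" if v: "v \<in> verts G"
  proof -
    have t: "tail G e0 \<in> verts G" using e0 by simp
    obtain K where "\<forall>(a :: 'v \<Rightarrow> real) \<eta>. \<eta> \<ge> 0 \<longrightarrow> (\<forall>e\<in>arcs G. \<bar>a (head G e) - a (tail G e)\<bar> \<le> \<eta>) \<longrightarrow>
        (\<forall>v\<in>verts G. \<bar>a v - a (tail G e0)\<bar> \<le> K * \<eta>)"
      using connected_variation_bound[OF conn t] by blast
    from this[rule_format, of 0 a v] show ?thesis using a0 v e0 by simp
  qed
  show "u' e 0 = 0" if e: "e \<in> arcs G"
  proof -
    have s: "schroedinger_sol (Q e) z (\<lambda>x. 0) (u e) (u' e)" using sol e unfolding graph_sol_def by blast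
    \<comment> \<open>At \<open>x = 1 / z\<close> the sine in the variation formula is
      \<open>sin 1\<close>, which is positive, so the slope can be isolated.\<close>
    have x: "1 / z \<in> {0..1}" using z by simp
    have "integral {0..1 / z} (\<lambda>t. sin (z * (1 / z - t)) * (Q e t * u e t - 0)) = integral {0..1 / z} (\<lambda>t. 0)"
      by (rule integral_cong) (use x zero[OF e] in auto)
    moreover have "sin 1 > (0 :: real)" using pi_gt3 by (intro sin_gt_zero) auto
    ultimately show ?thesis
      using schroedinger_sol_variation[OF Q[OF e] s continuous_on_const x] zero[OF e x] zero[OF e, of 0] z by simp
  qed
qed

text \<open>The Fredholm alternative by counting. The unknowns are the vertex values and the initial
  slopes; the equations are the Kirchhoff condition at each vertex and the value at the head of each
  edge, while the values at the tails hold by construction. Both kinds number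
  \<open>card (verts G) + card (arcs G)\<close>.\<close>

lemma graph_sol_exists:
  assumes z: "large z"
    and noeig: "\<And>a u u' e x. graph_sol z (\<lambda>e x. 0) a u u' \<Longrightarrow> e \<in> arcs G \<Longrightarrow> x \<in> {0..1} \<Longrightarrow> u e x = 0"
    and \<phi>: "\<And>e. e \<in> arcs G \<Longrightarrow> continuous_on {0..1} (\<phi> e)"
  shows "\<exists>a u u'. graph_sol z \<phi> a u u'"
proof -
  have z1: "z \<ge> 1" and zQ: "\<And>e. e \<in> arcs G \<Longrightarrow> 2 * l1 (Q e) \<le> z" using z unfolding large_def by auto
  have ex: "\<exists>u u'. schroedinger_sol (Q e) z f u u' \<and> u 0 = a \<and> u' 0 = b"
    if "e \<in> arcs G" "continuous_on {0..1} f" for e f a b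
    using schroedinger_sol_exists[OF Q[OF that(1)] that(2) z1 zQ[OF that(1)], of a b] by metis
  have c0: "continuous_on {0..1} (\<lambda>x::real. 0 :: real)" by simp
  obtain c c' where c: "\<And>e. e \<in> arcs G \<Longrightarrow> schroedinger_sol (Q e) z (\<lambda>x. 0) (c e) (c' e) \<and> c e 0 = 1 \<and> c' e 0 = 0"
    using ex[OF _ c0, of _ 1 0] by metis
  obtain s s' where s: "\<And>e. e \<in> arcs G \<Longrightarrow> schroedinger_sol (Q e) z (\<lambda>x. 0) (s e) (s' e) \<and> s e 0 = 0 \<and> s' e 0 = 1"
    using ex[OF _ c0, of _ 0 1] by metis
  have "\<exists>u u'. schroedinger_sol (Q e) z (\<phi> e) u u' \<and> u 0 = 0 \<and> u' 0 = 0" if "e \<in> arcs G" for e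
    using ex[OF that \<phi>[OF that], of 0 0] .
  then obtain p p' where p: "\<And>e. e \<in> arcs G \<Longrightarrow> schroedinger_sol (Q e) z (\<phi> e) (p e) (p' e) \<and> p e 0 = 0 \<and> p' e 0 = 0"
    by metis
  define I where "I = verts G <+> arcs G"
  have I: "finite I" by (simp add: I_def)
  have mem: "v \<in> verts G \<Longrightarrow> Inl v \<in> I" "e \<in> arcs G \<Longrightarrow> Inr e \<in> I" for v e by (auto simp: I_def)
  \<comment> \<open>Row \<open>Inl v\<close> is the Kirchhoff condition at \<open>v\<close>, row
    \<open>Inr e\<close> the value at the head of \<open>e\<close>. Column \<open>Inl w\<close> is
    the value at \<open>w\<close>, column \<open>Inr e\<close> the initial slope on
    \<open>e\<close>. A loop enters both parts of an entry.\<close>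
  define L where "L i j = (case i of
      Inl v \<Rightarrow> (case j of
          Inl w \<Rightarrow> - (\<Sum>e\<in>in_arcs G v. if tail G e = w then c' e 1 else 0)
        | Inr e \<Rightarrow> (if tail G e = v then 1 else 0) - (if head G e = v then s' e 1 else 0))
    | Inr e \<Rightarrow> (case j of
          Inl w \<Rightarrow> (if tail G e = w then c e 1 else 0) - (if head G e = w then 1 else 0)
        | Inr e' \<Rightarrow> if e' = e then s e 1 else 0))" for i j :: "'v + 'e"
  have row_e: "(\<Sum>j\<in>I. L (Inr e) j * x j) =
      (x (Inl (tail G e)) * c e 1 + x (Inr e) * s e 1) - x (Inl (head G e))" if e: "e \<in> arcs G" for e x
  proof -
    have "(\<Sum>w\<in>verts G. ((if tail G e = w then c e 1 else 0) - (if head G e = w then 1 else 0)) * x (Inl w)) =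
       (\<Sum>w\<in>verts G. (if tail G e = w then c e 1 * x (Inl w) else 0)) - (\<Sum>w\<in>verts G. if head G e = w then x (Inl w) else 0)"
      unfolding sum_subtractf[symmetric] by (rule sum.cong) (auto simp: left_diff_distrib)
    also have "\<dots> = c e 1 * x (Inl (tail G e)) - x (Inl (head G e))"
      using e by simp
    finally have 1: "(\<Sum>w\<in>verts G. ((if tail G e = w then c e 1 else 0) - (if head G e = w then 1 else 0)) * x (Inl w)) = \<dots>" .
    have "(\<Sum>e'\<in>arcs G. (if e' = e then s e 1 else 0) * x (Inr e')) = (\<Sum>e'\<in>arcs G. (if e' = e then s e 1 * x (Inr e') else 0))"
      by (rule sum.cong) auto
    also have "\<dots> = s e 1 * x (Inr e)" using e by simp
    finally show ?thesis unfolding I_def using 1 by (subst sum.Plus) (simp_all add: L_def mult.commute)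
  qed
  have row_v: "(\<Sum>j\<in>I. L (Inl v) j * x j) =
      (\<Sum>e\<in>out_arcs G v. x (Inr e)) - (\<Sum>e\<in>in_arcs G v. x (Inl (tail G e)) * c' e 1 + x (Inr e) * s' e 1)" for v x
  proof -
    have "(\<Sum>w\<in>verts G. - (\<Sum>e\<in>in_arcs G v. if tail G e = w then c' e 1 else 0) * x (Inl w)) =
       - (\<Sum>w\<in>verts G. (\<Sum>e\<in>in_arcs G v. if tail G e = w then c' e 1 * x (Inl w) else 0))"
      by (simp add: sum_distrib_right sum_negf if_distrib[of "\<lambda>c. c * _"] cong: if_cong)
    also have "\<dots> = - (\<Sum>e\<in>in_arcs G v. (\<Sum>w\<in>verts G. if tail G e = w then c' e 1 * x (Inl w) else 0))"
      by (subst sum.swap) simp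
    also have "\<dots> = - (\<Sum>e\<in>in_arcs G v. x (Inl (tail G e)) * c' e 1)"
      by (intro arg_cong[of _ _ uminus] sum.cong refl) simp
    finally have 1: "(\<Sum>w\<in>verts G. - (\<Sum>e\<in>in_arcs G v. if tail G e = w then c' e 1 else 0) * x (Inl w)) = \<dots>" .
    have "(\<Sum>e\<in>arcs G. ((if tail G e = v then 1 else 0) - (if head G e = v then s' e 1 else 0)) * x (Inr e)) =
        (\<Sum>e\<in>arcs G. if tail G e = v then x (Inr e) else 0) - (\<Sum>e\<in>arcs G. if head G e = v then x (Inr e) * s' e 1 else 0)"
      unfolding sum_subtractf[symmetric] by (rule sum.cong) (auto simp: left_diff_distrib)
    also have "\<dots> = (\<Sum>e\<in>out_arcs G v. x (Inr e)) - (\<Sum>e\<in>in_arcs G v. x (Inr e) * s' e 1)"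
      unfolding in_arcs_def out_arcs_def by (simp add: sum.inter_filter)
    finally show ?thesis unfolding I_def using 1 by (subst sum.Plus) (simp_all add: L_def sum.distrib)
  qed
  have "\<exists>x. \<forall>i\<in>I. (\<Sum>j\<in>I. L i j * x j) = (case i of Inl v \<Rightarrow> (\<Sum>e\<in>in_arcs G v. p' e 1) | Inr e \<Rightarrow> - p e 1)"
  proof (rule finite_square_system[OF I I refl])
    fix x assume x: "\<And>i. i \<in> I \<Longrightarrow> (\<Sum>j\<in>I. L i j * x j) = 0"
    define u where "u e t = x (Inl (tail G e)) * c e t + x (Inr e) * s e t" for e t
    define u' where "u' e t = x (Inl (tail G e)) * c' e t + x (Inr e) * s' e t" for e t
    have "schroedinger_sol (Q e) z (\<lambda>x. 0) (u e) (u' e)" if "e \<in> arcs G" for e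
      using schroedinger_sol_linear[OF Q[OF that] conjunct1[OF c[OF that]] conjunct1[OF s[OF that]] c0 c0]
      unfolding u_def u'_def by simp
    moreover have "vertex_conditions G (\<lambda>v. x (Inl v)) u u'"
      unfolding vertex_conditions_def
    proof (intro conjI ballI)
      show "u e 0 = x (Inl (tail G e))" if "e \<in> arcs G" for e using c[OF that] s[OF that] by (simp add: u_def)
      show "u e 1 = x (Inl (head G e))" if "e \<in> arcs G" for e
        using x[of "Inr e"] row_e[OF that, of x] mem(2)[OF that] by (simp add: u_def)
      show "(\<Sum>e\<in>out_arcs G v. u' e 0) = (\<Sum>e\<in>in_arcs G v. u' e 1)" if "v \<in> verts G" for v
      proof -
        have "(\<Sum>e\<in>out_arcs G v. u' e 0) = (\<Sum>e\<in>out_arcs G v. x (Inr e))"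
          by (rule sum.cong) (use c s in \<open>auto simp: u'_def\<close>)
        then show ?thesis using x[of "Inl v"] row_v[of v x] mem(1)[OF that] by (simp add: u'_def)
      qed
    qed
    ultimately have sol: "graph_sol z (\<lambda>e x. 0) (\<lambda>v. x (Inl v)) u u'" unfolding graph_sol_def by blast
    note zero = graph_sol_zero_data[OF sol z1 noeig[OF sol]]
    have "x (Inr e) = 0" if "e \<in> arcs G" for e
      using zero(2)[OF _ _ that] c[OF that] s[OF that] by (simp add: u'_def)
    then show "\<forall>j\<in>I. x j = 0" using zero(1) unfolding I_def by auto
  qed
  then obtain x where x: "\<And>i. i \<in> I \<Longrightarrow> (\<Sum>j\<in>I. L i j * x j) = (case i of Inl v \<Rightarrow> (\<Sum>e\<in>in_arcs G v. p' e 1) | Inr e \<Rightarrow> - p e 1)"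
    by blast
  define u where "u e t = 1 * p e t + 1 * (x (Inl (tail G e)) * c e t + x (Inr e) * s e t)" for e t
  define u' where "u' e t = 1 * p' e t + 1 * (x (Inl (tail G e)) * c' e t + x (Inr e) * s' e t)" for e t
  have "schroedinger_sol (Q e) z (\<phi> e) (u e) (u' e)" if "e \<in> arcs G" for e
  proof -
    have "schroedinger_sol (Q e) z (\<lambda>x. 0) (\<lambda>t. x (Inl (tail G e)) * c e t + x (Inr e) * s e t)
       (\<lambda>t. x (Inl (tail G e)) * c' e t + x (Inr e) * s' e t)"
      using schroedinger_sol_linear[OF Q[OF that] conjunct1[OF c[OF that]] conjunct1[OF s[OF that]] c0 c0] by simp
    from schroedinger_sol_linear[OF Q[OF that] conjunct1[OF p[OF that]] this \<phi>[OF that] c0, of 1 1]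
    show ?thesis unfolding u_def u'_def by simp
  qed
  moreover have "vertex_conditions G (\<lambda>v. x (Inl v)) u u'"
    unfolding vertex_conditions_def
  proof (intro conjI ballI)
    show "u e 0 = x (Inl (tail G e))" if "e \<in> arcs G" for e using c[OF that] s[OF that] p[OF that] by (simp add: u_def)
    show "u e 1 = x (Inl (head G e))" if "e \<in> arcs G" for e
      using x[of "Inr e"] row_e[OF that, of x] mem(2)[OF that] by (simp add: u_def)
    show "(\<Sum>e\<in>out_arcs G v. u' e 0) = (\<Sum>e\<in>in_arcs G v. u' e 1)" if "v \<in> verts G" for v
    proof -
      have "(\<Sum>e\<in>out_arcs G v. u' e 0) = (\<Sum>e\<in>out_arcs G v. x (Inr e))"
        by (rule sum.cong) (use c s p in \<open>auto simp: u'_def\<close>)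
      then show ?thesis using x[of "Inl v"] row_v[of v x] mem(1)[OF that] by (simp add: u'_def sum.distrib)
    qed
  qed
  ultimately show ?thesis unfolding graph_sol_def by blast
qed

end

lemma schroedinger_sol_cong:
  assumes "schroedinger_sol Q z \<phi> u u'" "\<And>x. x \<in> {0..1} \<Longrightarrow> \<phi> x = \<psi> x"
  shows "schroedinger_sol Q z \<psi> u u'"
proof -
  have eq: "integral {0..x} (\<lambda>t. (Q t - z\<^sup>2) * u t - \<psi> t) = integral {0..x} (\<lambda>t. (Q t - z\<^sup>2) * u t - \<phi> t)"
    if "x \<in> {0..1}" for x
    by (rule integral_cong) (use that assms(2) in auto)
  show ?thesis
    unfolding schroedinger_sol_def
  proof (intro conjI ballI)
    fix x :: real assume x: "x \<in> {0..1}"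
    show "(u has_real_derivative u' x) (at x within {0..1})" by (rule schroedinger_solD(1)[OF assms(1) x])
    show "u' x = u' 0 + integral {0..x} (\<lambda>t. (Q t - z\<^sup>2) * u t - \<psi> t)"
      unfolding eq[OF x] by (rule schroedinger_solD(2)[OF assms(1) x])
  qed
qed

section \<open>The test function and its error terms\<close>

context schroedinger_graph
begin

text \<open>The first sum collects the errors of the overlaps, the last term that of replacing the
  values of \<open>\<sigma> a\<close> by the one at \<open>v0\<close>. Both are relative to the size
  of the data.\<close>

definition test_error :: "real \<Rightarrow> real \<Rightarrow> real" where
  "test_error K z =
    (\<Sum>e\<in>arcs G. \<bar>integral {0..1} (\<lambda>t. Q e t * cos (2 * z * t))\<bar> + \<bar>integral {0..1} (\<lambda>t. Q e t * sin (2 * z * t))\<bar>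
      + l1 (Q e) * (2 * l1 (Q e) + 1) / z)
    + K * (\<Sum>e\<in>arcs G. 2 * l1 (Q e) + 1) / z * (\<Sum>e\<in>arcs G. \<bar>integral {0..1} (Q e) / 2\<bar>)"

lemma test_error_tendsto_0: "(\<lambda>n. test_error K (real n * pi)) \<longlonglongrightarrow> 0"
proof -
  have om: "filterlim (\<lambda>n. 2 * (real n * pi)) at_top sequentially"
    by real_asymp
  have inv: "(\<lambda>n. c / (real n * pi)) \<longlonglongrightarrow> 0" for c by real_asymp
  have c: "(\<lambda>n. integral {0..1} (\<lambda>t. Q e t * cos (2 * (real n * pi) * t))) \<longlonglongrightarrow> 0" if "e \<in> arcs G" for e
    by (rule Riemann_Lebesgue_trig[where F = sin, OF Q[OF that] _ _ _ _ om]) (auto intro!: continuous_intros derivative_eq_intros)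
  have s: "(\<lambda>n. integral {0..1} (\<lambda>t. Q e t * sin (2 * (real n * pi) * t))) \<longlonglongrightarrow> 0" if "e \<in> arcs G" for e
    by (rule Riemann_Lebesgue_trig[where F = "\<lambda>x. - cos x", OF Q[OF that] _ _ _ _ om]) (auto intro!: continuous_intros derivative_eq_intros)
  have "(\<lambda>n. test_error K (real n * pi)) \<longlonglongrightarrow> (\<Sum>e\<in>arcs G. \<bar>0\<bar> + \<bar>0\<bar> + 0) + 0 * (\<Sum>e\<in>arcs G. \<bar>integral {0..1} (Q e) / 2\<bar>)"
    unfolding test_error_def by (intro tendsto_intros c s inv)
  then show ?thesis by simp
qed

text \<open>
  The test function \<open>\<sigma> cos (z t)\<close> satisfies the vertex conditions exactly, and pairing it with
  the differential equation for \<open>u\<close> leaves only \<open>\<Sum> \<integral> Q \<sigma> cos u\<close>.  On the edge \<open>e\<close> this is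
  \<open>\<sigma> a / 2 \<integral> Q e\<close> up to small terms; since \<open>\<sigma> a\<close> is nearly constant on the connected graph,
  the condition \<open>\<Sum> \<integral> Q e = 0\<close> makes the total small.
\<close>

lemma test_function_estimate:
  assumes z: "large z" "sin z = 0"
    and mean: "(\<Sum>e\<in>arcs G. integral {0..1} (Q e)) = 0"
    and v0: "v0 \<in> verts G" and K: "K \<ge> 0"
      "\<forall>(a :: 'v \<Rightarrow> real) \<eta>. \<eta> \<ge> 0 \<longrightarrow> (\<forall>e\<in>arcs G. \<bar>a (head G e) - a (tail G e)\<bar> \<le> \<eta>) \<longrightarrow>
        (\<forall>v\<in>verts G. \<bar>a v - a v0\<bar> \<le> K * \<eta>)"
    and \<sigma>: "\<And>v. \<bar>\<sigma> v\<bar> = 1" "\<And>e. e \<in> arcs G \<Longrightarrow> \<sigma> (head G e) = cos z * \<sigma> (tail G e)"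
    and sol: "graph_sol z (\<lambda>e x. \<sigma> (tail G e) * cos (z * x)) a u u'"
    and N: "\<And>e. e \<in> arcs G \<Longrightarrow> data_size z (u e) (u' e) (\<lambda>x. \<sigma> (tail G e) * cos (z * x)) \<le> N"
  shows "card (arcs G) / 2 \<le> test_error K z * N"
proof -
  have z1: "z \<ge> 1" and zQ: "\<And>e. e \<in> arcs G \<Longrightarrow> 2 * l1 (Q e) \<le> z" using z unfolding large_def by auto
  define \<phi> where "\<phi> e x = \<sigma> (tail G e) * cos (z * x)" for e x
  note sol = sol[folded \<phi>_def]
  note N = N[folded \<phi>_def]
  have c\<phi>: "continuous_on {0..1} (\<phi> e)" for e unfolding \<phi>_def by (intro continuous_intros)
  define N' where "N' e = data_size z (u e) (u' e) (\<phi> e)" for e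
  have l1: "l1 (Q e) \<ge> 0" if "e \<in> arcs G" for e
    using Q[OF that] by (intro integral_nonneg) (auto simp: absolutely_integrable_on_def)
  have "0 \<le> l1 (\<phi> e)" for e
    by (intro integral_nonneg integrable_continuous_real continuous_intros c\<phi>) auto
  then have N'0: "N' e \<ge> 0" for e using z1 by (simp add: N'_def)
  obtain e0 where e0: "e0 \<in> arcs G" using arcs_ne by blast
  have N0: "N \<ge> 0" using N[OF e0] N'0[of e0] by (simp add: N'_def)
  have \<sigma>2: "\<sigma> v * \<sigma> v = 1" for v using \<sigma>(1)[of v] by (metis abs_mult_self_eq mult_1)
  have "cos z * cos z = 1" using sin_cos_squared_add[of z] z(2) by (simp add: power2_eq_square)
  \<comment> \<open>As \<open>cos z\<close> is 1 or -1, the sign relation can be read from head to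
    tail as well.\<close>
  then have \<sigma>t: "cos z * \<sigma> (head G e) = \<sigma> (tail G e)" if "e \<in> arcs G" for e
    using \<sigma>(2)[OF that] by (simp add: mult.assoc[symmetric])
  define r where "r e = integral {0..1} (Q e) / 2" for e
  define W where "W e = integral {0..1} (\<lambda>t. cos (z * t) * u e t * Q e t)" for e
  define \<delta> where "\<delta> e = \<bar>integral {0..1} (\<lambda>t. Q e t * cos (2 * z * t))\<bar> + \<bar>integral {0..1} (\<lambda>t. Q e t * sin (2 * z * t))\<bar>
      + l1 (Q e) * (2 * l1 (Q e) + 1) / z" for e
  have \<delta>0: "\<delta> e \<ge> 0" if "e \<in> arcs G" for e using l1[OF that] z1 by (simp add: \<delta>_def)
  define C where "C = (\<Sum>e\<in>arcs G. 2 * l1 (Q e) + 1)"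
  have C: "2 * l1 (Q e) + 1 \<le> C" if "e \<in> arcs G" for e
    unfolding C_def using that l1 by (intro member_le_sum) (auto intro!: add_nonneg_nonneg)
  then have C0: "C \<ge> 0" using l1[OF e0] C[OF e0] by linarith
  have half: "integral {0..1} (\<lambda>t. cos (z * t) * \<phi> e t) = \<sigma> (tail G e) / 2" for e
  proof -
    have "integral {0..1} (\<lambda>t. (cos (z * t))\<^sup>2) = 1 / 2"
      using integral_trig_square[of z 1 0] z1 z(2) by simp
    then have "integral {0..1} (\<lambda>t. \<sigma> (tail G e) * (cos (z * t))\<^sup>2) = \<sigma> (tail G e) / 2" by simp
    then show ?thesis by (simp add: \<phi>_def power2_eq_square mult_ac)
  qed
  have pair: "\<sigma> (tail G e) / 2 = W e - (cos z * u' e 1 - u' e 0)" if "e \<in> arcs G" for e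
    unfolding half[symmetric] W_def
    by (rule schroedinger_sol_pairing[OF Q[OF that] z1 zQ[OF that] z(2) graph_solD(2)[OF sol that] c\<phi>])
  have "real (card (arcs G)) / 2 = (\<Sum>e\<in>arcs G. \<sigma> (tail G e) * (\<sigma> (tail G e) / 2))"
    by (simp add: \<sigma>2)
  \<comment> \<open>By the sign relation the weight \<sigma> turns the slopes into a flux against
    \<sigma> itself, which sums to zero.\<close>
  also have "\<dots> = (\<Sum>e\<in>arcs G. \<sigma> (tail G e) * W e - (\<sigma> (head G e) * u' e 1 - \<sigma> (tail G e) * u' e 0))"
    by (intro sum.cong refl) (simp add: pair \<sigma>(2) algebra_simps)
  also have "\<dots> = (\<Sum>e\<in>arcs G. \<sigma> (tail G e) * W e)"
    unfolding sum_subtractf[of "\<lambda>e. \<sigma> (tail G e) * W e"] vertex_conditions_flux[OF graph_solD(1)[OF sol]] by simp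
  finally have 1: "real (card (arcs G)) / 2 = (\<Sum>e\<in>arcs G. \<sigma> (tail G e) * W e)" .
  have ov: "\<bar>\<sigma> (tail G e) * W e - \<sigma> (tail G e) * a (tail G e) * r e\<bar> \<le> \<delta> e * N" if e: "e \<in> arcs G" for e
  proof -
    have "\<bar>W e - a (tail G e) * r e\<bar> \<le> \<delta> e * N' e"
      using schroedinger_sol_overlap[OF Q[OF e] z1 zQ[OF e] z(2) graph_solD(2)[OF sol e] c\<phi>]
      unfolding W_def r_def \<delta>_def N'_def graph_solD(3)[OF sol e] .
    also have "\<dots> \<le> \<delta> e * N" using N[OF e] \<delta>0[OF e] by (intro mult_left_mono) (simp_all add: N'_def)
    finally have *: "\<bar>W e - a (tail G e) * r e\<bar> \<le> \<delta> e * N" .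
    have "\<sigma> (tail G e) * W e - \<sigma> (tail G e) * a (tail G e) * r e = \<sigma> (tail G e) * (W e - a (tail G e) * r e)"
      by (simp add: algebra_simps)
    then show ?thesis using * \<sigma>(1) by (simp add: abs_mult)
  qed
  have step: "\<bar>\<sigma> (head G e) * a (head G e) - \<sigma> (tail G e) * a (tail G e)\<bar> \<le> C * N / z" if e: "e \<in> arcs G" for e
  proof -
    have "\<bar>a (head G e) - cos z * a (tail G e)\<bar> \<le> (2 * l1 (Q e) + 1) * N' e / z"
      using schroedinger_sol_transfer[OF Q[OF e] z1 zQ[OF e] z(2) graph_solD(2)[OF sol e] c\<phi>]
      unfolding N'_def graph_solD(4)[OF sol e, symmetric] graph_solD(3)[OF sol e, symmetric] .
    also have "\<dots> \<le> C * N / z"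
      using C[OF e] N[OF e] N'0[of e] C0 z1 by (intro divide_right_mono mult_mono) (simp_all add: N'_def)
    finally have *: "\<bar>a (head G e) - cos z * a (tail G e)\<bar> \<le> C * N / z" .
    have "\<sigma> (head G e) * a (head G e) - \<sigma> (tail G e) * a (tail G e) = \<sigma> (head G e) * (a (head G e) - cos z * a (tail G e))"
      unfolding \<sigma>t[OF e, symmetric] by (simp add: algebra_simps)
    then show ?thesis using * \<sigma>(1) by (simp add: abs_mult)
  qed
  define b where "b v = \<sigma> v * a v" for v
  have "C * N / z \<ge> 0" using C0 N0 z1 by simp
  then have var: "\<bar>b v - b v0\<bar> \<le> K * (C * N / z)" if "v \<in> verts G" for v
    using K(2)[rule_format, of "C * N / z" b v] step that unfolding b_def by blast
  have "(\<Sum>e\<in>arcs G. r e) = 0" unfolding r_def using mean by (simp flip: sum_divide_distrib)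
  \<comment> \<open>The numbers \<open>r e\<close> sum to 0, so the constant \<open>b v0\<close> may
    be subtracted.\<close>
  then have "(\<Sum>e\<in>arcs G. b (tail G e) * r e) = (\<Sum>e\<in>arcs G. (b (tail G e) - b v0) * r e)"
    by (simp add: left_diff_distrib sum_subtractf flip: sum_distrib_left)
  also have "\<bar>\<dots>\<bar> \<le> (\<Sum>e\<in>arcs G. K * (C * N / z) * \<bar>r e\<bar>)"
    by (intro order_trans[OF sum_abs] sum_mono) (unfold abs_mult, intro mult_right_mono var, auto)
  finally have 2: "\<bar>\<Sum>e\<in>arcs G. b (tail G e) * r e\<bar> \<le> K * (C * N / z) * (\<Sum>e\<in>arcs G. \<bar>r e\<bar>)"
    by (simp add: sum_distrib_left)
  have "\<bar>(\<Sum>e\<in>arcs G. \<sigma> (tail G e) * W e) - (\<Sum>e\<in>arcs G. b (tail G e) * r e)\<bar> \<le> (\<Sum>e\<in>arcs G. \<delta> e * N)"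
    unfolding sum_subtractf[symmetric] b_def by (intro order_trans[OF sum_abs] sum_mono ov)
  then have "real (card (arcs G)) / 2 \<le> (\<Sum>e\<in>arcs G. \<delta> e * N) + K * (C * N / z) * (\<Sum>e\<in>arcs G. \<bar>r e\<bar>)"
    using 1 2 by linarith
  also have "\<dots> = test_error K z * N"
    unfolding test_error_def \<delta>_def[symmetric] r_def[symmetric] C_def[symmetric]
    by (simp add: distrib_right flip: sum_distrib_right)
  finally show ?thesis by simp
qed

section \<open>The L2 form and the resolvent as a compact symmetric operator\<close>

definition fun_space :: "('e \<times> real \<Rightarrow> real) set" where
  "fun_space = {f. \<forall>e\<in>arcs G. continuous_on {0..1} (\<lambda>x. f (e, x))}"

text \<open>Families over the edges are uncurried to functions of pairs, the vectors of
  \<open>pre_inner_space\<close>.\<close>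

definition fun_ip :: "('e \<times> real \<Rightarrow> real) \<Rightarrow> ('e \<times> real \<Rightarrow> real) \<Rightarrow> real" where
  "fun_ip f g = (\<Sum>e\<in>arcs G. integral {0..1} (\<lambda>x. f (e, x) * g (e, x)))"

lemma fun_spaceD: "f \<in> fun_space \<Longrightarrow> e \<in> arcs G \<Longrightarrow> continuous_on {0..1} (\<lambda>x. f (e, x))"
  by (simp add: fun_space_def)

sublocale pre_inner_space fun_space fun_ip
proof
  fix f g h :: "'e \<times> real \<Rightarrow> real" and a b :: real
  assume f: "f \<in> fun_space"
  show "0 \<le> fun_ip f f"
    unfolding fun_ip_def
    by (intro sum_nonneg integral_nonneg integrable_continuous_real continuous_intros fun_spaceD[OF f]) auto
  assume g: "g \<in> fun_space"
  show "(\<lambda>i. a * f i + b * g i) \<in> fun_space"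
    unfolding fun_space_def by (auto intro!: continuous_intros fun_spaceD[OF f] fun_spaceD[OF g])
  show "fun_ip f g = fun_ip g f" unfolding fun_ip_def by (simp add: mult.commute)
  assume h: "h \<in> fun_space"
  have "integral {0..1} (\<lambda>x. (a * f (e, x) + b * g (e, x)) * h (e, x)) =
    a * integral {0..1} (\<lambda>x. f (e, x) * h (e, x)) + b * integral {0..1} (\<lambda>x. g (e, x) * h (e, x))" if e: "e \<in> arcs G" for e
  proof -
    have i: "(\<lambda>x. a * (f (e, x) * h (e, x))) integrable_on {0..1}" "(\<lambda>x. b * (g (e, x) * h (e, x))) integrable_on {0..1}"
      by (intro integrable_continuous_real continuous_intros fun_spaceD[OF f] fun_spaceD[OF g] fun_spaceD[OF h] e)+
    show ?thesis using integral_add[OF i] by (simp add: algebra_simps)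
  qed
  then show "fun_ip (\<lambda>i. a * f i + b * g i) h = a * fun_ip f h + b * fun_ip g h"
    unfolding fun_ip_def by (simp add: sum.distrib sum_distrib_left)
qed

lemma edge_energy_le:
  assumes f: "f \<in> fun_space" and e: "e \<in> arcs G"
  shows "integral {0..1} (\<lambda>x. f (e, x) * f (e, x)) \<le> fun_ip f f"
  unfolding fun_ip_def
  by (rule member_le_sum[OF e]) (auto intro!: integral_nonneg integrable_continuous_real continuous_intros fun_spaceD[OF f])

lemma fun_ip_null:
  assumes f: "f \<in> fun_space" and "fun_ip f f = 0" and e: "e \<in> arcs G" and x: "x \<in> {0..1}"
  shows "f (e, x) = 0"
proof -
  note c = fun_spaceD[OF f e]
  have "integral {0..1} (\<lambda>x. f (e, x) * f (e, x)) \<ge> 0"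
    by (intro integral_nonneg integrable_continuous_real continuous_intros c) auto
  then have "integral {0..1} (\<lambda>x. f (e, x) * f (e, x)) = 0" using edge_energy_le[OF f e] assms(2) by simp
  moreover have "continuous_on {0..1} (\<lambda>x. f (e, x) * f (e, x))" by (intro continuous_intros c)
  ultimately show ?thesis using x integral_eq_0_iff[of 0 1 "\<lambda>x. f (e, x) * f (e, x)"] by auto
qed

lemma graph_sol_size:
  assumes z: "large z" "sin z = 0"
    and sol: "graph_sol z (\<lambda>e x. \<phi> (e, x)) a (\<lambda>e x. u (e, x)) u'"
    and \<phi>: "\<phi> \<in> fun_space" and u: "u \<in> fun_space" and e: "e \<in> arcs G"
  shows "data_size z (\<lambda>x. u (e, x)) (u' e) (\<lambda>x. \<phi> (e, x)) \<le> sqrt (24 * (fun_ip u u + fun_ip \<phi> \<phi>))"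
proof -
  have z1: "z \<ge> 1" and zQ: "2 * l1 (Q e) \<le> z" "24 * (2 * l1 (Q e) + 1)\<^sup>2 \<le> z\<^sup>2" using z e unfolding large_def by auto
  have "(data_size z (\<lambda>x. u (e, x)) (u' e) (\<lambda>x. \<phi> (e, x)))\<^sup>2 \<le>
      24 * (integral {0..1} (\<lambda>t. u (e, t) * u (e, t)) + integral {0..1} (\<lambda>t. \<phi> (e, t) * \<phi> (e, t)))"
    by (rule schroedinger_sol_energy[OF Q[OF e] z1 zQ(1) z(2) graph_solD(2)[OF sol e] fun_spaceD[OF \<phi> e] zQ(2)])
  also have "\<dots> \<le> 24 * (fun_ip u u + fun_ip \<phi> \<phi>)"
    using edge_energy_le[OF u e] edge_energy_le[OF \<phi> e] by simp
  finally show ?thesis by (rule real_le_rsqrt)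
qed

text \<open>Compactness at fixed \<open>z\<close>: L2 bounds on source and solution bound the data,
  the data bound \<open>u\<close> and \<open>u'\<close> uniformly, and Arzela-Ascoli applies. The
  limit is merely continuous; the eigenvalue equation for it is recovered in
  \<open>compact_symmetric_eigenvector\<close>.\<close>

lemma graph_sol_compact:
  fixes \<phi> u :: "nat \<Rightarrow> 'e \<times> real \<Rightarrow> real"
  assumes z: "large z" "sin z = 0"
    and sol: "\<And>n. graph_sol z (\<lambda>e x. \<phi> n (e, x)) (a n) (\<lambda>e x. u n (e, x)) (u' n)"
    and \<phi>: "\<And>n. \<phi> n \<in> fun_space" and u: "\<And>n. u n \<in> fun_space"
    and K: "\<And>n. fun_ip (\<phi> n) (\<phi> n) \<le> K" "\<And>n. fun_ip (u n) (u n) \<le> K"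
  shows "\<exists>r v. strict_mono (r :: nat \<Rightarrow> nat) \<and> v \<in> fun_space \<and>
    (\<lambda>n. fun_ip (\<lambda>i. 1 * u (r n) i + (-1) * v i) (\<lambda>i. 1 * u (r n) i + (-1) * v i)) \<longlonglongrightarrow> 0"
proof -
  have z1: "z \<ge> 1" and zQ: "\<And>e. e \<in> arcs G \<Longrightarrow> 2 * l1 (Q e) \<le> z" using z unfolding large_def by auto
  \<comment> \<open>48 is twice the 24 of the energy estimate, for two squared norms of at most
    \<open>K\<close>.\<close>
  define M where "M = sqrt (48 * K)"
  have M: "data_size z (\<lambda>x. u n (e, x)) (u' n e) (\<lambda>x. \<phi> n (e, x)) \<le> M" if "e \<in> arcs G" for n e
  proof -
    have "sqrt (24 * (fun_ip (u n) (u n) + fun_ip (\<phi> n) (\<phi> n))) \<le> M"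
      unfolding M_def using K[of n] by simp
    then show ?thesis using graph_sol_size[OF z sol[of n] \<phi> u that] by linarith
  qed
  have bound: "\<bar>u n (e, x)\<bar> \<le> 2 * M" if e: "e \<in> arcs G" and x: "x \<in> {0..1}" for n e x
    using schroedinger_sol_sup_bound[OF Q[OF e] graph_solD(2)[OF sol[of n] e] fun_spaceD[OF \<phi> e] z1 zQ[OF e] x] M[OF e, of n]
    by simp
  \<comment> \<open>A bound for the derivative: initial slope at most \<open>z * M\<close>, source
    at most \<open>M\<close>, sup norm of the solution at most \<open>2 * M\<close>.\<close>
  define L where "L = (z + 1) * M + (\<Sum>e\<in>arcs G. integral {0..1} (\<lambda>t. \<bar>Q e t - z\<^sup>2\<bar>)) * (2 * M)"
  have lip: "\<bar>u n (e, x) - u n (e, y)\<bar> \<le> L * \<bar>x - y\<bar>" if e: "e \<in> arcs G" and xy: "x \<in> {0..1}" "y \<in> {0..1}" for n e x y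
  proof -
    have i: "integral {0..1} (\<lambda>t. \<bar>Q e' t - z\<^sup>2\<bar>) \<ge> 0" if "e' \<in> arcs G" for e'
      using set_integral_diff(1)[OF Q[OF that] absolutely_integrable_on_const[of "{0..1}" "z\<^sup>2"]]
      by (intro integral_nonneg) (auto simp: absolutely_integrable_on_def)
    have P: "l1 (\<lambda>x. \<phi> n (e, x)) \<ge> 0"
      by (intro integral_nonneg integrable_continuous_real continuous_intros fun_spaceD[OF \<phi> e]) auto
    have nn: "\<bar>u n (e, 0)\<bar> \<ge> 0" "\<bar>u' n e 0\<bar> / z \<ge> 0" using z1 by simp_all
    have "\<bar>u' n e 0\<bar> / z \<le> M" "l1 (\<lambda>x. \<phi> n (e, x)) \<le> M" and M0: "M \<ge> 0"
      using M[OF e, of n] P nn by linarith+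
    then have M1: "\<bar>u' n e 0\<bar> + l1 (\<lambda>x. \<phi> n (e, x)) \<le> (z + 1) * M"
      using z1 by (simp add: divide_le_eq algebra_simps)
    have "\<bar>u' n e t\<bar> \<le> L" if t: "t \<in> {0..1}" for t
    proof -
      have "integral {0..1} (\<lambda>t. \<bar>Q e t - z\<^sup>2\<bar>) * (2 * M) \<le> (\<Sum>e\<in>arcs G. integral {0..1} (\<lambda>t. \<bar>Q e t - z\<^sup>2\<bar>)) * (2 * M)"
        using M0 e i by (intro mult_right_mono member_le_sum) auto
      then show ?thesis
        using schroedinger_sol_derivative_bound[OF Q[OF e] graph_solD(2)[OF sol[of n] e] fun_spaceD[OF \<phi> e] bound[OF e] t] M1
        unfolding L_def by linarith
    qed
    then show ?thesis
      using field_differentiable_bound[of "{0..1}" "\<lambda>x. u n (e, x)" "u' n e" L x y]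
        schroedinger_solD(1)[OF graph_solD(2)[OF sol[of n] e]] xy by auto
  qed
  have "\<exists>r g. strict_mono (r :: nat \<Rightarrow> nat) \<and>
    (\<forall>e\<in>arcs G. continuous_on {0..1} (g e) \<and> uniform_limit {0..1} (\<lambda>n x. u (r n) (e, x)) (g e) sequentially)"
    by (rule Arzela_Ascoli_finite_family[of "arcs G" "\<lambda>n e x. u n (e, x)" "2 * M" L]) (use bound lip in auto)
  then obtain r g where r: "strict_mono (r :: nat \<Rightarrow> nat)"
    and cg: "\<And>e. e \<in> arcs G \<Longrightarrow> continuous_on {0..1} (g e)"
    and ug: "\<And>e. e \<in> arcs G \<Longrightarrow> uniform_limit {0..1} (\<lambda>n x. u (r n) (e, x)) (g e) sequentially"
    by blast
  define v where "v = (\<lambda>(e, x). g e x)"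
  have v: "v \<in> fun_space" using cg by (simp add: v_def fun_space_def)
  have "(\<lambda>n. integral {0..1} (\<lambda>x. (u (r n) (e, x) - g e x) * (u (r n) (e, x) - g e x))) \<longlonglongrightarrow> 0" if e: "e \<in> arcs G" for e
  proof (rule tendstoI)
    fix \<epsilon> :: real assume \<epsilon>: "\<epsilon> > 0"
    have "\<forall>\<^sub>F n in sequentially. \<forall>x\<in>{0..1}. dist (u (r n) (e, x)) (g e x) < sqrt (\<epsilon> / 2)"
      using ug[OF e] \<epsilon> unfolding uniform_limit_iff by simp
    then show "\<forall>\<^sub>F n in sequentially. dist (integral {0..1} (\<lambda>x. (u (r n) (e, x) - g e x) * (u (r n) (e, x) - g e x))) 0 < \<epsilon>"
    proof eventually_elim
      case (elim n)
      have c: "continuous_on {0..1} (\<lambda>x. (u (r n) (e, x) - g e x) * (u (r n) (e, x) - g e x))"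
        by (intro continuous_intros fun_spaceD[OF u e] cg[OF e])
      have "integral {0..1} (\<lambda>x. (u (r n) (e, x) - g e x) * (u (r n) (e, x) - g e x)) \<le> integral {0..1} (\<lambda>x::real. \<epsilon> / 2)"
      proof (rule integral_le)
        fix x :: real assume "x \<in> {0..1}"
        then have "\<bar>u (r n) (e, x) - g e x\<bar> \<le> sqrt (\<epsilon> / 2)" using elim by (auto simp: dist_real_def less_imp_le)
        then have "(u (r n) (e, x) - g e x)\<^sup>2 \<le> (sqrt (\<epsilon> / 2))\<^sup>2" by (rule power2_le_iff_abs_le[THEN iffD2, rotated]) (use \<epsilon> in simp)
        then show "(u (r n) (e, x) - g e x) * (u (r n) (e, x) - g e x) \<le> \<epsilon> / 2" using \<epsilon> by (simp add: power2_eq_square)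
      qed (auto intro: integrable_continuous_real[OF c])
      moreover have "0 \<le> integral {0..1} (\<lambda>x. (u (r n) (e, x) - g e x) * (u (r n) (e, x) - g e x))"
        by (intro integral_nonneg integrable_continuous_real[OF c]) auto
      ultimately show ?case using \<epsilon> by simp
    qed
  qed
  then have "(\<lambda>n. \<Sum>e\<in>arcs G. integral {0..1} (\<lambda>x. (u (r n) (e, x) - g e x) * (u (r n) (e, x) - g e x))) \<longlonglongrightarrow> (\<Sum>e\<in>arcs G. 0)"
    by (intro tendsto_sum)
  then have "(\<lambda>n. fun_ip (\<lambda>i. 1 * u (r n) i + (-1) * v i) (\<lambda>i. 1 * u (r n) i + (-1) * v i)) \<longlonglongrightarrow> 0"
    by (simp add: fun_ip_def v_def)
  then show ?thesis using r v by blast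
qed

text \<open>If the homogeneous problem has a nonzero solution, \<kappa> = 0 works. Otherwise every
  source is admissible, and \<open>est\<close> says that the solution operator \<open>R\<close> is
  large on \<psi>. An eigenvector with \<open>f = \<kappa> R f\<close> then gives
  \<open>u = R f\<close> with source \<open>\<kappa> u\<close>.\<close>

lemma graph_sol_perturbation:
  assumes z: "large z" "sin z = 0" and \<epsilon>: "\<epsilon> \<ge> 0"
    and \<psi>: "\<psi> \<in> fun_space" "fun_ip \<psi> \<psi> > 0"
    and est: "\<And>a u u'. graph_sol z (\<lambda>e x. \<psi> (e, x)) a (\<lambda>e x. u (e, x)) u' \<Longrightarrow> u \<in> fun_space \<Longrightarrow>
      fun_ip \<psi> \<psi> \<le> \<epsilon>\<^sup>2 * fun_ip u u"
  shows "\<exists>\<kappa> a u u'. \<bar>\<kappa>\<bar> \<le> \<epsilon> \<and> graph_sol z (\<lambda>e x. \<kappa> * u e x) a u u' \<and> (\<exists>e\<in>arcs G. \<exists>x\<in>{0..1}. u e x \<noteq> 0)"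
proof (cases "\<forall>a u u' e x. graph_sol z (\<lambda>e x. 0) a u u' \<longrightarrow> e \<in> arcs G \<longrightarrow> x \<in> {0..1} \<longrightarrow> u e x = 0")
  case False
  then obtain a u u' e x where "graph_sol z (\<lambda>e x. 0) a u u'" "e \<in> arcs G" "x \<in> {0..1}" "u e x \<noteq> 0" by blast
  then show ?thesis using \<epsilon> by (intro exI[of _ 0] exI[of _ a] exI[of _ u] exI[of _ u'] conjI bexI[of _ e] bexI[of _ x]) simp_all
next
  case True
  \<comment> \<open>Any choice of solutions will do: the Lagrange identity makes every such choice
    symmetric.\<close>
  define R where "R \<phi> = (\<lambda>(e, x). (SOME u. \<exists>a u'. graph_sol z (\<lambda>e x. \<phi> (e, x)) a u u') e x)" for \<phi>
  have R: "\<exists>a u'. graph_sol z (\<lambda>e x. \<phi> (e, x)) a (\<lambda>e x. R \<phi> (e, x)) u'" if \<phi>: "\<phi> \<in> fun_space" for \<phi>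
  proof -
    have "\<exists>a u u'. graph_sol z (\<lambda>e x. \<phi> (e, x)) a u u'"
      by (rule graph_sol_exists[OF z(1)]) (use True fun_spaceD[OF \<phi>] in auto)
    then have "\<exists>u a u'. graph_sol z (\<lambda>e x. \<phi> (e, x)) a u u'" by blast
    then have "\<exists>a u'. graph_sol z (\<lambda>e x. \<phi> (e, x)) a (SOME u. \<exists>a u'. graph_sol z (\<lambda>e x. \<phi> (e, x)) a u u') u'"
      by (rule someI_ex)
    then show ?thesis by (simp add: R_def)
  qed
  have RX: "R \<phi> \<in> fun_space" if \<phi>: "\<phi> \<in> fun_space" for \<phi>
  proof -
    obtain a u' where s: "graph_sol z (\<lambda>e x. \<phi> (e, x)) a (\<lambda>e x. R \<phi> (e, x)) u'" using R[OF \<phi>] by blast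
    have "continuous_on {0..1} (\<lambda>x. R \<phi> (e, x))" if e: "e \<in> arcs G" for e
      by (rule schroedinger_sol_continuous(1)[OF Q[OF e] graph_solD(2)[OF s e] fun_spaceD[OF \<phi> e]])
    then show ?thesis by (simp add: fun_space_def)
  qed
  have sym: "fun_ip (R f) g = fun_ip f (R g)" if f: "f \<in> fun_space" and g: "g \<in> fun_space" for f g
  proof -
    obtain a u' b w' where s: "graph_sol z (\<lambda>e x. f (e, x)) a (\<lambda>e x. R f (e, x)) u'"
      "graph_sol z (\<lambda>e x. g (e, x)) b (\<lambda>e x. R g (e, x)) w'" using R[OF f] R[OF g] by blast
    show ?thesis unfolding fun_ip_def
      by (rule graph_sol_symmetric[OF s fun_spaceD[OF f] fun_spaceD[OF g]])
  qed
  have cpt: "\<exists>r u. strict_mono (r :: nat \<Rightarrow> nat) \<and> u \<in> fun_space \<and>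
      (\<lambda>n. fun_ip (\<lambda>i. 1 * R (\<phi> (r n)) i + (-1) * u i) (\<lambda>i. 1 * R (\<phi> (r n)) i + (-1) * u i)) \<longlonglongrightarrow> 0"
    if \<phi>: "\<And>n::nat. \<phi> n \<in> fun_space" and K: "\<And>n. fun_ip (\<phi> n) (\<phi> n) \<le> K" "\<And>n. fun_ip (R (\<phi> n)) (R (\<phi> n)) \<le> K" for \<phi> K
  proof -
    have "\<forall>n. \<exists>a u'. graph_sol z (\<lambda>e x. \<phi> n (e, x)) a (\<lambda>e x. R (\<phi> n) (e, x)) u'"
      using R[OF \<phi>] by blast
    then obtain a u' where s: "\<forall>n. graph_sol z (\<lambda>e x. \<phi> n (e, x)) (a n) (\<lambda>e x. R (\<phi> n) (e, x)) (u' n)"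
      by metis
    show ?thesis
      by (rule graph_sol_compact[OF z s[rule_format] \<phi> RX[OF \<phi>] K])
  qed
  obtain a\<psi> u\<psi> where s\<psi>: "graph_sol z (\<lambda>e x. \<psi> (e, x)) a\<psi> (\<lambda>e x. R \<psi> (e, x)) u\<psi>" using R[OF \<psi>(1)] by blast
  have le: "fun_ip \<psi> \<psi> \<le> \<epsilon>\<^sup>2 * fun_ip (R \<psi>) (R \<psi>)" by (rule est[OF s\<psi> RX[OF \<psi>(1)]])
  have "fun_ip (R \<psi>) (R \<psi>) \<noteq> 0" using le \<psi>(2) by auto
  then have pos: "fun_ip (R \<psi>) (R \<psi>) > 0" using ip_nonneg[OF RX[OF \<psi>(1)]] by simp
  have "\<exists>f \<kappa>. f \<in> fun_space \<and> \<bar>\<kappa>\<bar> \<le> \<epsilon> \<and> fun_ip f f > 0 \<and> (\<forall>g\<in>fun_space. fun_ip f g = \<kappa> * fun_ip (R f) g)"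
  proof (rule compact_symmetric_eigenvector[where R = R])
    show "R f \<in> fun_space" if "f \<in> fun_space" for f by (rule RX[OF that])
    show "fun_ip (R f) g = fun_ip f (R g)" if "f \<in> fun_space" "g \<in> fun_space" for f g by (rule sym[OF that])
    show "\<exists>r u. strict_mono (r :: nat \<Rightarrow> nat) \<and> u \<in> fun_space \<and>
        (\<lambda>n. fun_ip (\<lambda>i. 1 * R (\<phi> (r n)) i + (-1) * u i) (\<lambda>i. 1 * R (\<phi> (r n)) i + (-1) * u i)) \<longlonglongrightarrow> 0"
      if "\<And>n::nat. \<phi> n \<in> fun_space" "\<And>n. fun_ip (\<phi> n) (\<phi> n) \<le> K" "\<And>n. fun_ip (R (\<phi> n)) (R (\<phi> n)) \<le> K" for \<phi> K
      by (rule cpt[OF that])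
    show "\<psi> \<in> fun_space" "0 < fun_ip (R \<psi>) (R \<psi>)" "fun_ip \<psi> \<psi> \<le> \<epsilon>\<^sup>2 * fun_ip (R \<psi>) (R \<psi>)" "0 \<le> \<epsilon>"
      by (rule \<psi>(1) pos le \<epsilon>)+
    fix f \<kappa> assume "f \<in> fun_space" "\<bar>\<kappa>\<bar> \<le> \<epsilon>" "fun_ip f f > 0"
      "\<And>g. g \<in> fun_space \<Longrightarrow> fun_ip f g = \<kappa> * fun_ip (R f) g"
    then show "\<exists>f \<kappa>. f \<in> fun_space \<and> \<bar>\<kappa>\<bar> \<le> \<epsilon> \<and> fun_ip f f > 0 \<and> (\<forall>g\<in>fun_space. fun_ip f g = \<kappa> * fun_ip (R f) g)"
      by (intro exI[of _ f] exI[of _ \<kappa>] conjI ballI)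
  qed
  then obtain f \<kappa> where f: "f \<in> fun_space" "\<bar>\<kappa>\<bar> \<le> \<epsilon>" "fun_ip f f > 0"
    and eig: "\<And>g. g \<in> fun_space \<Longrightarrow> fun_ip f g = \<kappa> * fun_ip (R f) g"
    by blast
  \<comment> \<open>The eigenvector equation holds against test vectors only. Testing it with the
    difference of its two sides, and using continuity, makes it pointwise on the edges.\<close>
  define g where "g = (\<lambda>i. 1 * f i + (- \<kappa>) * R f i)"
  have g: "g \<in> fun_space" unfolding g_def by (intro comb f RX)
  have "fun_ip g g = 1 * fun_ip f g + (- \<kappa>) * fun_ip (R f) g"
    by (subst (1) g_def) (rule ip_lin[OF f(1) RX[OF f(1)] g])
  then have "fun_ip g g = 0" using eig[OF g] by simp
  then have eq: "f (e, x) = \<kappa> * R f (e, x)" if "e \<in> arcs G" "x \<in> {0..1}" for e x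
    using fun_ip_null[OF g _ that] by (simp add: g_def)
  obtain a u' where s: "graph_sol z (\<lambda>e x. f (e, x)) a (\<lambda>e x. R f (e, x)) u'" using R[OF f(1)] by blast
  have "schroedinger_sol (Q e) z (\<lambda>x. \<kappa> * R f (e, x)) (\<lambda>x. R f (e, x)) (u' e)" if "e \<in> arcs G" for e
    by (rule schroedinger_sol_cong[OF graph_solD(2)[OF s that]]) (rule eq[OF that])
  then have "graph_sol z (\<lambda>e x. \<kappa> * R f (e, x)) a (\<lambda>e x. R f (e, x)) u'"
    using graph_solD(1)[OF s] unfolding graph_sol_def by simp
  moreover have "\<exists>e\<in>arcs G. \<exists>x\<in>{0..1}. R f (e, x) \<noteq> 0"
  proof (rule ccontr)
    assume n: "\<not> (\<exists>e\<in>arcs G. \<exists>x\<in>{0..1}. R f (e, x) \<noteq> 0)"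
    have "integral {0..1} (\<lambda>x. f (e, x) * f (e, x)) = integral {0..1} (\<lambda>x::real. 0)" if "e \<in> arcs G" for e
      by (rule integral_cong) (use n that eq[OF that] in auto)
    then have "fun_ip f f = 0" unfolding fun_ip_def by simp
    then show False using f(3) by simp
  qed
  ultimately show ?thesis
    using f(2) by (intro exI[of _ \<kappa>] exI[of _ a] exI[of _ "\<lambda>e x. R f (e, x)"] exI[of _ u']) auto
qed

lemma eventually_large: "\<forall>\<^sub>F n in sequentially. large (real n * pi)"
proof -
  \<comment> \<open>5 because 24 is at most \<open>5\<^sup>2\<close>; the final 1 gives
    \<open>z \<ge> 1\<close>, and the sum dominates each of its terms.\<close>
  define B where "B = (\<Sum>e\<in>arcs G. 5 * (2 * l1 (Q e) + 1)) + 1"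
  have l1: "l1 (Q e) \<ge> 0" if "e \<in> arcs G" for e
    using Q[OF that] by (intro integral_nonneg) (auto simp: absolutely_integrable_on_def)
  have "filterlim (\<lambda>n. real n * pi) at_top sequentially" by real_asymp
  then have "\<forall>\<^sub>F n in sequentially. B \<le> real n * pi" by (simp add: filterlim_at_top)
  then show ?thesis
  proof eventually_elim
    case (elim n)
    define z where "z = real n * pi"
    have elim: "B \<le> z" using elim by (simp only: z_def)
    have s0: "(\<Sum>e\<in>arcs G. 5 * (2 * l1 (Q e) + 1)) \<ge> 0" using l1 by (intro sum_nonneg) auto
    have "2 * l1 (Q e) \<le> z \<and> 24 * (2 * l1 (Q e) + 1)\<^sup>2 \<le> z\<^sup>2" if e: "e \<in> arcs G" for e
    proof -
      define L where "L = l1 (Q e)"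
      have L: "L \<ge> 0" unfolding L_def by (rule l1[OF e])
      have "5 * (2 * L + 1) \<le> (\<Sum>e\<in>arcs G. 5 * (2 * l1 (Q e) + 1))"
        unfolding L_def using l1 by (intro member_le_sum[OF e]) auto
      then have le: "5 * (2 * L + 1) \<le> z" using elim unfolding B_def by linarith
      then have "(5 * (2 * L + 1))\<^sup>2 \<le> z\<^sup>2" using L by (intro power_mono) auto
      moreover have "24 * (2 * L + 1)\<^sup>2 \<le> 5\<^sup>2 * (2 * L + 1)\<^sup>2" by simp
      ultimately have "24 * (2 * L + 1)\<^sup>2 \<le> z\<^sup>2" unfolding power_mult_distrib by linarith
      moreover have "2 * L \<le> z" using le L by simp
      ultimately show ?thesis unfolding L_def by blast
    qed
    then show ?case unfolding large_def z_def[symmetric] using elim s0 unfolding B_def by auto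
  qed
qed

text \<open>The signs are quantified inside the eventual statement because they depend on the parity
  of \<open>n\<close>, whereas the threshold has to be uniform.\<close>

lemma eventually_near_solution:
  assumes mean: "(\<Sum>e\<in>arcs G. integral {0..1} (Q e)) = 0" and \<epsilon>: "\<epsilon> > 0"
  shows "\<forall>\<^sub>F n in sequentially. \<forall>\<sigma>. (\<forall>v. \<bar>\<sigma> v\<bar> = 1) \<longrightarrow>
    (\<forall>e\<in>arcs G. \<sigma> (head G e) = cos (real n * pi) * \<sigma> (tail G e)) \<longrightarrow>
    (\<exists>\<kappa> a u u'. \<bar>\<kappa>\<bar> \<le> \<epsilon> \<and> graph_sol (real n * pi) (\<lambda>e x. \<kappa> * u e x) a u u' \<and> (\<exists>e\<in>arcs G. \<exists>x\<in>{0..1}. u e x \<noteq> 0))"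
proof -
  obtain v0 where v0: "v0 \<in> verts G" using arcs_ne by (metis all_not_in_conv head_in_verts)
  obtain K where K: "K \<ge> 0"
      "\<forall>(a :: 'v \<Rightarrow> real) \<eta>. \<eta> \<ge> 0 \<longrightarrow> (\<forall>e\<in>arcs G. \<bar>a (head G e) - a (tail G e)\<bar> \<le> \<eta>) \<longrightarrow>
        (\<forall>v\<in>verts G. \<bar>a v - a v0\<bar> \<le> K * \<eta>)"
    using connected_variation_bound[OF conn v0] by blast
  have "(\<lambda>n. 24 * (1 + 1 / \<epsilon>\<^sup>2) * (test_error K (real n * pi))\<^sup>2) \<longlonglongrightarrow> 24 * (1 + 1 / \<epsilon>\<^sup>2) * 0\<^sup>2"
    by (intro tendsto_intros test_error_tendsto_0)
  \<comment> \<open>\<open>1 / 2\<close> is the least possible value of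
    \<open>c = card (arcs G) / 2\<close>: if the estimate for \<open>u\<close> failed, the test
    function estimate would give \<open>c * c < c * (1 / 2)\<close>.\<close>
  then have "\<forall>\<^sub>F n in sequentially. 24 * (1 + 1 / \<epsilon>\<^sup>2) * (test_error K (real n * pi))\<^sup>2 < 1 / 2"
    by (rule order_tendstoD(2)) simp
  with eventually_large show ?thesis
  proof eventually_elim
    case (elim n)
    define z where "z = real n * pi"
    have z: "large z" "sin z = 0" using elim by (auto simp: z_def)
    have z1: "z \<ge> 1" using z unfolding large_def by auto
    define c where "c = real (card (arcs G)) / 2"
    have "card (arcs G) \<ge> 1" using arcs_ne by (simp add: Suc_le_eq card_gt_0_iff)
    then have c: "c \<ge> 1 / 2" by (simp add: c_def)
    show ?case
    proof (intro allI impI)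
      fix \<sigma> :: "'v \<Rightarrow> real"
      assume \<sigma>: "\<forall>v. \<bar>\<sigma> v\<bar> = 1" "\<forall>e\<in>arcs G. \<sigma> (head G e) = cos (real n * pi) * \<sigma> (tail G e)"
      have \<sigma>2: "\<sigma> v * \<sigma> v = 1" for v using \<sigma>(1) by (metis abs_mult_self_eq mult_1)
      define \<psi> where "\<psi> = (\<lambda>(e, x). \<sigma> (tail G e) * cos (z * x))"
      have \<psi>: "\<psi> \<in> fun_space" unfolding \<psi>_def fun_space_def by (auto intro!: continuous_intros)
      have "integral {0..1} (\<lambda>x. \<psi> (e, x) * \<psi> (e, x)) = 1 / 2" for e
      proof -
        have "\<psi> (e, x) * \<psi> (e, x) = (\<sigma> (tail G e) * \<sigma> (tail G e)) * (1 * cos (z * x) + 0 * sin (z * x))\<^sup>2" for x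
          by (simp add: \<psi>_def power2_eq_square mult_ac)
        then show ?thesis using integral_trig_square[of z 1 0] z1 z(2) by (simp add: \<sigma>2)
      qed
      then have "fun_ip \<psi> \<psi> = (\<Sum>e\<in>arcs G. 1 / 2)" unfolding fun_ip_def by (simp only:)
      then have ip\<psi>: "fun_ip \<psi> \<psi> = c" by (simp add: c_def)
      have "\<exists>\<kappa> a u u'. \<bar>\<kappa>\<bar> \<le> \<epsilon> \<and> graph_sol z (\<lambda>e x. \<kappa> * u e x) a u u' \<and> (\<exists>e\<in>arcs G. \<exists>x\<in>{0..1}. u e x \<noteq> 0)"
      proof (rule graph_sol_perturbation[OF z _ \<psi>])
        show "\<epsilon> \<ge> 0" "fun_ip \<psi> \<psi> > 0" using \<epsilon> c ip\<psi> by auto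
        fix a u u'
        assume sol: "graph_sol z (\<lambda>e x. \<psi> (e, x)) a (\<lambda>e x. u (e, x)) u'" and u: "u \<in> fun_space"
        define U where "U = fun_ip u u"
        have U: "U \<ge> 0" unfolding U_def by (rule ip_nonneg[OF u])
        have sol': "graph_sol z (\<lambda>e x. \<sigma> (tail G e) * cos (z * x)) a (\<lambda>e x. u (e, x)) u'"
          using sol by (simp add: \<psi>_def)
        have "real (card (arcs G)) / 2 \<le> test_error K z * sqrt (24 * (U + c))"
        proof (rule test_function_estimate[OF z mean v0 K _ _ sol'])
          show "\<bar>\<sigma> v\<bar> = 1" for v using \<sigma>(1) by simp
          show "\<sigma> (head G e) = cos z * \<sigma> (tail G e)" if "e \<in> arcs G" for e using \<sigma>(2) that by (simp add: z_def)
          show "data_size z (\<lambda>x. u (e, x)) (u' e) (\<lambda>x. \<sigma> (tail G e) * cos (z * x)) \<le> sqrt (24 * (U + c))" if "e \<in> arcs G" for e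
            using graph_sol_size[OF z sol \<psi> u that, unfolded ip\<psi>] by (simp add: \<psi>_def U_def)
        qed
        then have "c\<^sup>2 \<le> (test_error K z * sqrt (24 * (U + c)))\<^sup>2"
          unfolding c_def[symmetric] using c by (intro power_mono) auto
        also have "\<dots> = (test_error K z)\<^sup>2 * (24 * (U + c))"
        proof -
          have "0 \<le> 24 * (U + c)" using U c by simp
          then show ?thesis by (simp only: power_mult_distrib real_sqrt_pow2)
        qed
        finally have sq: "c\<^sup>2 \<le> (test_error K z)\<^sup>2 * (24 * (U + c))" .
        show "fun_ip \<psi> \<psi> \<le> \<epsilon>\<^sup>2 * fun_ip u u"
        proof (rule ccontr)
          assume "\<not> fun_ip \<psi> \<psi> \<le> \<epsilon>\<^sup>2 * fun_ip u u"
          then have "U \<le> c / \<epsilon>\<^sup>2" using \<epsilon> by (simp add: ip\<psi> U_def field_simps)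
          then have "U + c \<le> c * (1 + 1 / \<epsilon>\<^sup>2)" by (simp add: algebra_simps)
          then have "(test_error K z)\<^sup>2 * (24 * (U + c)) \<le> (test_error K z)\<^sup>2 * (24 * (c * (1 + 1 / \<epsilon>\<^sup>2)))"
            by (intro mult_left_mono) auto
          also have "\<dots> = c * (24 * (1 + 1 / \<epsilon>\<^sup>2) * (test_error K z)\<^sup>2)" by (simp only: mult_ac)
          also have "\<dots> < c * (1 / 2)" using elim c unfolding z_def by (intro mult_strict_left_mono) auto
          finally have "c * c < c * (1 / 2)" using sq by (simp add: power2_eq_square)
          then show False using c by (simp add: mult_less_cancel_left)
        qed
      qed
      then show "\<exists>\<kappa> a u u'. \<bar>\<kappa>\<bar> \<le> \<epsilon> \<and> graph_sol (real n * pi) (\<lambda>e x. \<kappa> * u e x) a u u' \<and> (\<exists>e\<in>arcs G. \<exists>x\<in>{0..1}. u e x \<noteq> 0)"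
        unfolding z_def .
    qed
  qed
qed

lemma graph_sol_eigenvalue:
  assumes sol: "graph_sol z (\<lambda>e x. \<kappa> * u e x) a u u'"
    and cont: "\<And>e. e \<in> arcs G \<Longrightarrow> continuous_on {0..1} (u e)"
    and nz: "e \<in> arcs G" "x \<in> {0..1}" "u e x \<noteq> 0"
  shows "graph_eigenvalue G (\<lambda>e x. Q e x + m) (of_real (z\<^sup>2 + m + \<kappa>))"
  unfolding graph_eigenvalue_def
proof (rule exI[of _ "\<lambda>e x. complex_of_real (u e x)"], rule exI[of _ "\<lambda>e x. complex_of_real (u' e x)"], intro conjI)
  show "\<forall>e\<in>arcs G. edge_solution (\<lambda>x. Q e x + m) (of_real (z\<^sup>2 + m + \<kappa>)) (\<lambda>x. of_real (u e x)) (\<lambda>x. of_real (u' e x))"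
  proof
    fix e assume e: "e \<in> arcs G"
    note s = graph_solD(2)[OF sol e]
    have c: "continuous_on {0..1} (\<lambda>x. \<kappa> * u e x)" by (intro continuous_intros cont e)
    show "edge_solution (\<lambda>x. Q e x + m) (of_real (z\<^sup>2 + m + \<kappa>)) (\<lambda>x. of_real (u e x)) (\<lambda>x. of_real (u' e x))"
      by (rule edge_solution_of_real[OF rhs_absolutely_integrable[OF Q[OF e] cont[OF e] c, of "z\<^sup>2"]
            schroedinger_solD(1)[OF s] schroedinger_solD(2)[OF s]]) (auto simp: algebra_simps)
  qed
  show "standard_matching G (\<lambda>e x. complex_of_real (u e x)) (\<lambda>e x. complex_of_real (u' e x))"
    by (rule standard_matching_of_real[OF graph_solD(1)[OF sol]])
  show "\<exists>e\<in>arcs G. \<exists>x\<in>{0<..<1}. complex_of_real (u e x) \<noteq> 0"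
  proof (rule ccontr)
    assume n: "\<not> (\<exists>e\<in>arcs G. \<exists>x\<in>{0<..<1}. complex_of_real (u e x) \<noteq> 0)"
    \<comment> \<open>A nonzero value may be known at an end of the edge only, while
      \<open>graph_eigenvalue\<close> asks for an interior point; continuity up to the ends bridges
      the gap.\<close>
    have "u e x = 0"
    proof (rule continuous_constant_on_closure[of "{0<..<1}" "u e"])
      show "continuous_on (closure {0<..<1}) (u e)" using cont[OF nz(1)] by simp
    qed (use n nz in auto)
    then show False using nz(3) by simp
  qed
qed

end

section \<open>Sequences of eigenvalues\<close>

lemma free_eigenvalue:
  assumes G: "fin_digraph G" "arcs G \<noteq> {}" and n: "n \<ge> 1"
    and \<sigma>: "\<And>v. \<bar>\<sigma> v :: real\<bar> = 1" "\<And>e. e \<in> arcs G \<Longrightarrow> \<sigma> (head G e) = cos (real n * pi) * \<sigma> (tail G e)"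
  shows "graph_eigenvalue G (\<lambda>e x. 0) (of_real ((real n * pi)\<^sup>2))"
proof -
  interpret fin_digraph G by fact
  define z where "z = real n * pi"
  define u where "u e x = \<sigma> (tail G e) * cos (z * x)" for e x
  define u' where "u' e x = - z * \<sigma> (tail G e) * sin (z * x)" for e x
  define g where "g e x = (0 - z\<^sup>2) * u e x" for e x
  have du: "(u e has_real_derivative u' e x) (at x within S)" for e x S
    unfolding u_def u'_def by (auto intro!: derivative_eq_intros)
  have du': "(u' e has_real_derivative g e x) (at x within S)" for e x S
    unfolding u_def u'_def g_def by (auto intro!: derivative_eq_intros simp: power2_eq_square)
  have "edge_solution (\<lambda>x. 0) (of_real (z\<^sup>2)) (\<lambda>x. of_real (u e x)) (\<lambda>x. of_real (u' e x))" for e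
  proof (rule edge_solution_of_real[where g = "g e"])
    show "g e absolutely_integrable_on {0..1}"
      unfolding g_def u_def by (intro absolutely_integrable_continuous_real continuous_intros)
    show "(u e has_real_derivative u' e x) (at x within {0..1})" for x by (rule du)
    show "u' e x = u' e 0 + integral {0..x} (g e)" if x: "x \<in> {0..1}" for x
    proof -
      have "(g e has_integral u' e x - u' e 0) {0..x}"
        using x du' by (intro fundamental_theorem_of_calculus)
          (auto simp: has_real_derivative_iff_has_vector_derivative[symmetric])
      then show ?thesis by (simp add: integral_unique)
    qed
  qed (simp add: g_def)
  moreover have "vertex_conditions G \<sigma> u u'"
    using \<sigma>(2) unfolding vertex_conditions_def by (simp add: u_def u'_def z_def mult.commute)
  then have "standard_matching G (\<lambda>e x. complex_of_real (u e x)) (\<lambda>e x. complex_of_real (u' e x))"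
    by (rule standard_matching_of_real)
  moreover obtain e0 where e0: "e0 \<in> arcs G" using G(2) by blast
  \<comment> \<open>At the interior point \<open>1 / (3 * n)\<close> the cosine is
    \<open>cos (pi / 3)\<close>, which is nonzero for every \<open>n\<close>.\<close>
  have "z * (1 / (3 * real n)) = pi / 3" using n by (simp add: z_def)
  then have c: "cos (z * (1 / (3 * real n))) = 1 / 2" by (simp only: cos_60)
  have "u e0 (1 / (3 * real n)) \<noteq> 0" unfolding u_def c using \<sigma>(1)[of "tail G e0"] by auto
  then have "\<exists>e\<in>arcs G. \<exists>x\<in>{0<..<1}. complex_of_real (u e x) \<noteq> 0"
    using e0 n by (intro bexI[of _ e0] bexI[of _ "1 / (3 * real n)"]) auto
  ultimately show ?thesis
    unfolding graph_eigenvalue_def z_def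
    by - (rule exI[of _ "\<lambda>e x. complex_of_real (u e x)"], rule exI[of _ "\<lambda>e x. complex_of_real (u' e x)"], simp)
qed

text \<open>The sequence has to be fixed before \<epsilon>. Taking \<open>\<mu> k\<close> within
  \<open>1 / (k + 1)\<close> of the optimal distance to \<open>t k\<close> achieves this, and also
  gives a value at the early \<open>k\<close> for which nothing close is known.\<close>

lemma nearest_point_sequence:
  fixes t :: "nat \<Rightarrow> real"
  assumes "\<And>\<epsilon>. \<epsilon> > 0 \<Longrightarrow> \<forall>\<^sub>F k in sequentially. \<exists>\<mu>. P \<mu> \<and> \<bar>\<mu> - t k\<bar> \<le> \<epsilon>"
  obtains \<mu> where "\<forall>k. P (\<mu> k)" "(\<lambda>k. \<mu> k - t k) \<longlonglongrightarrow> 0"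
proof -
  obtain \<mu>0 where \<mu>0: "P \<mu>0" using assms[of 1] by (auto simp: eventually_sequentially)
  define d where "d k = (INF \<mu>\<in>Collect P. \<bar>\<mu> - t k\<bar>)" for k
  have bdd: "bdd_below ((\<lambda>\<mu>. \<bar>\<mu> - t k\<bar>) ` Collect P)" for k by (rule bdd_belowI[of _ 0]) auto
  have "\<exists>\<mu>. P \<mu> \<and> \<bar>\<mu> - t k\<bar> < d k + inverse (real (Suc k))" for k
  proof -
    have "(INF \<mu>\<in>Collect P. \<bar>\<mu> - t k\<bar>) < d k + inverse (real (Suc k))" unfolding d_def by simp
    then show ?thesis using cINF_less_iff[OF _ bdd] \<mu>0 by blast
  qed
  then obtain \<mu> where \<mu>: "\<And>k. P (\<mu> k)" "\<And>k. \<bar>\<mu> k - t k\<bar> < d k + inverse (real (Suc k))" by metis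
  have "(\<lambda>k. \<mu> k - t k) \<longlonglongrightarrow> 0"
  proof (rule tendstoI)
    fix \<epsilon> :: real assume \<epsilon>: "\<epsilon> > 0"
    have "\<forall>\<^sub>F k in sequentially. \<exists>\<mu>. P \<mu> \<and> \<bar>\<mu> - t k\<bar> \<le> \<epsilon> / 2" using \<epsilon> by (intro assms) simp
    moreover have "\<forall>\<^sub>F k in sequentially. inverse (real (Suc k)) < \<epsilon> / 2"
      using \<epsilon> by (intro order_tendstoD(2)[OF LIMSEQ_inverse_real_of_nat]) simp
    ultimately show "\<forall>\<^sub>F k in sequentially. dist (\<mu> k - t k) 0 < \<epsilon>"
    proof eventually_elim
      case (elim k)
      then obtain \<nu> where \<nu>: "P \<nu>" "\<bar>\<nu> - t k\<bar> \<le> \<epsilon> / 2" by blast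
      have "d k \<le> \<bar>\<nu> - t k\<bar>" unfolding d_def using \<nu>(1) by (intro cINF_lower[OF bdd]) simp
      then have "\<bar>\<mu> k - t k\<bar> < \<epsilon>" using \<mu>(2)[of k] \<nu>(2) elim(2) by linarith
      then show ?case by simp
    qed
  qed
  with \<mu>(1) show ?thesis by (intro that allI)
qed

text \<open>The map \<open>s\<close> covers \<open>n = 2 k\<close> and \<open>n = k\<close> at once.
  Subtracting the mean from every \<open>q e\<close> gives potentials whose integrals sum to zero
  and moves the spectrum by \<open>m\<close>.\<close>

lemma eigenvalue_sequence:
  fixes G :: "('v, 'e) pre_digraph" and q :: "'e \<Rightarrow> real \<Rightarrow> real" and s :: "nat \<Rightarrow> nat"
  assumes G: "fin_digraph G" "Digraph_Component.connected G" "card (arcs G) \<ge> 1"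
    and q: "\<And>e. e \<in> arcs G \<Longrightarrow> q e absolutely_integrable_on {0<..<1}"
    and s: "filterlim s at_top sequentially"
    and \<sigma>: "\<And>k. \<exists>\<sigma> :: 'v \<Rightarrow> real. (\<forall>v. \<bar>\<sigma> v\<bar> = 1) \<and> (\<forall>e\<in>arcs G. \<sigma> (head G e) = cos (real (s k) * pi) * \<sigma> (tail G e))"
  obtains \<mu> where "\<forall>k. graph_eigenvalue G q (of_real (\<mu> k))"
    and "(\<lambda>k. \<mu> k - ((real (s k) * pi)\<^sup>2 + mean_potential G q)) \<longlonglongrightarrow> 0"
proof -
  define m where "m = mean_potential G q"
  define Q where "Q e x = q e x - m" for e x
  have q01: "q e absolutely_integrable_on {0..1}" if "e \<in> arcs G" for e
    using q[OF that] by (simp add: absolutely_integrable_on_Icc_iff_Ioo)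
  have Q: "Q e absolutely_integrable_on {0..1}" if "e \<in> arcs G" for e
    unfolding Q_def by (rule set_integral_diff(1)[OF q01[OF that]]) (auto intro: absolutely_integrable_on_const)
  have ne: "arcs G \<noteq> {}" using G(3) by auto
  interpret schroedinger_graph G Q
    by (rule schroedinger_graph.intro[OF G(1)], unfold_locales) (use G ne Q in auto)
  have "(\<Sum>e\<in>arcs G. integral {0..1} (Q e)) = (\<Sum>e\<in>arcs G. integral {0<..<1} (q e) - m)"
  proof (rule sum.cong[OF refl])
    fix e assume "e \<in> arcs G"
    then have "q e integrable_on {0..1}" using q01 by (simp add: absolutely_integrable_on_def)
    then have "integral {0..1} (Q e) = integral {0..1} (q e) - integral {0..1} (\<lambda>x::real. m)"
      unfolding Q_def by (intro integral_diff) auto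
    then show "integral {0..1} (Q e) = integral {0<..<1} (q e) - m" by (simp add: integral_open_interval_real)
  qed
  also have "\<dots> = 0" using G(3) by (simp add: sum_subtractf m_def mean_potential_def)
  finally have mean: "(\<Sum>e\<in>arcs G. integral {0..1} (Q e)) = 0" .
  have "\<forall>\<^sub>F k in sequentially. \<exists>\<mu>. graph_eigenvalue G q (of_real \<mu>) \<and> \<bar>\<mu> - ((real (s k) * pi)\<^sup>2 + m)\<bar> \<le> \<epsilon>"
    if \<epsilon>: "\<epsilon> > 0" for \<epsilon>
    using filterlim_iff[THEN iffD1, OF s, rule_format, OF eventually_near_solution[OF mean \<epsilon>]]
  proof eventually_elim
    case (elim k)
    obtain \<kappa> a u u' e x where \<kappa>: "\<bar>\<kappa>\<bar> \<le> \<epsilon>" and sol: "graph_sol (real (s k) * pi) (\<lambda>e x. \<kappa> * u e x) a u u'"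
      and nz: "e \<in> arcs G" "x \<in> {0..1}" "u e x \<noteq> 0"
      using \<sigma>[of k] elim by metis
    have "continuous_on {0..1} (u e)" if "e \<in> arcs G" for e
      using schroedinger_solD(1)[OF graph_solD(2)[OF sol that]]
      by (meson DERIV_continuous continuous_on_eq_continuous_within)
    from graph_sol_eigenvalue[OF sol this nz, of m]
    have "graph_eigenvalue G q (of_real ((real (s k) * pi)\<^sup>2 + m + \<kappa>))" by (simp add: Q_def)
    then show ?case using \<kappa> by (intro exI[of _ "(real (s k) * pi)\<^sup>2 + m + \<kappa>"]) simp
  qed
  then obtain \<mu> where "\<forall>k. graph_eigenvalue G q (of_real (\<mu> k))"
    "(\<lambda>k. \<mu> k - ((real (s k) * pi)\<^sup>2 + m)) \<longlonglongrightarrow> 0"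
    by (rule nearest_point_sequence)
  then show ?thesis using that unfolding m_def by blast
qed

theorem theorem1p1:
  fixes G :: "('v, 'e) pre_digraph"
    and q :: "'e \<Rightarrow> real \<Rightarrow> real"
    and \<Delta> \<Delta>0 :: "complex \<Rightarrow> complex"
  assumes "fin_digraph G"
    and "Digraph_Component.connected G"
    and "card (arcs G) \<ge> 1"
    and "\<And>e. e \<in> arcs G \<Longrightarrow> q e absolutely_integrable_on {0<..<1}"
    and "spectral_determinant G q \<Delta>"
    and "spectral_determinant G (\<lambda>e x. 0) \<Delta>0"
  shows
    "(\<exists>\<mu>::nat \<Rightarrow> real.
        (\<forall>k\<ge>1. \<Delta>0 (of_real ((2 * real k * pi)\<^sup>2)) = 0) \<and>
        (\<forall>k\<ge>1. \<Delta> (of_real (\<mu> k)) = 0) \<and>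
        (\<forall>k\<ge>1. graph_eigenvalue G q (of_real (\<mu> k))) \<and>
        (\<lambda>k. \<mu> k - ((2 * real k * pi)\<^sup>2 + mean_potential G q)) \<in> o(\<lambda>k. 1)) \<and>
     (bipartite G \<longrightarrow>
      (\<exists>\<mu>::nat \<Rightarrow> real.
        (\<forall>k\<ge>1. \<Delta>0 (of_real ((real k * pi)\<^sup>2)) = 0) \<and>
        (\<forall>k\<ge>1. \<Delta> (of_real (\<mu> k)) = 0) \<and>
        (\<forall>k\<ge>1. graph_eigenvalue G q (of_real (\<mu> k))) \<and>
        (\<lambda>k. \<mu> k - ((real k * pi)\<^sup>2 + mean_potential G q)) \<in> o(\<lambda>k. 1)))"
proof -
  have ne: "arcs G \<noteq> {}" using assms(3) by auto
  have main: "\<exists>\<mu>::nat \<Rightarrow> real.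
        (\<forall>k\<ge>1. \<Delta>0 (of_real ((real (s k) * pi)\<^sup>2)) = 0) \<and>
        (\<forall>k\<ge>1. \<Delta> (of_real (\<mu> k)) = 0) \<and>
        (\<forall>k\<ge>1. graph_eigenvalue G q (of_real (\<mu> k))) \<and>
        (\<lambda>k. \<mu> k - ((real (s k) * pi)\<^sup>2 + mean_potential G q)) \<in> o(\<lambda>k. 1)"
    if s: "filterlim s at_top sequentially" "\<And>k. k \<ge> 1 \<Longrightarrow> s k \<ge> 1"
      and \<sigma>: "\<And>k. \<exists>\<sigma> :: 'v \<Rightarrow> real. (\<forall>v. \<bar>\<sigma> v\<bar> = 1) \<and> (\<forall>e\<in>arcs G. \<sigma> (head G e) = cos (real (s k) * pi) * \<sigma> (tail G e))"
    for s :: "nat \<Rightarrow> nat"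
  proof -
    obtain \<mu> where \<mu>: "\<forall>k. graph_eigenvalue G q (of_real (\<mu> k))"
      and lim: "(\<lambda>k. \<mu> k - ((real (s k) * pi)\<^sup>2 + mean_potential G q)) \<longlonglongrightarrow> 0"
      using eigenvalue_sequence[where q = q, OF assms(1-4) s(1) \<sigma>] by blast
    have "graph_eigenvalue G (\<lambda>e x. 0) (of_real ((real (s k) * pi)\<^sup>2))" if "k \<ge> 1" for k
      using free_eigenvalue[OF assms(1) ne s(2)[OF that]] \<sigma>[of k] by blast
    moreover have "(\<lambda>k. \<mu> k - ((real (s k) * pi)\<^sup>2 + mean_potential G q)) \<in> o(\<lambda>k. 1)"
      using lim by (intro smalloI_tendsto) auto
    ultimately show ?thesis
      using \<mu> assms(5,6) unfolding spectral_determinant_def by blast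
  qed
  have \<sigma>_even: "\<exists>\<sigma> :: 'v \<Rightarrow> real. (\<forall>v. \<bar>\<sigma> v\<bar> = 1) \<and> (\<forall>e\<in>arcs G. \<sigma> (head G e) = cos (real (2 * k) * pi) * \<sigma> (tail G e))" for k
    unfolding cos_npi by (intro exI[of _ "\<lambda>v. 1"]) simp
  have double: "filterlim (\<lambda>k::nat. 2 * k) at_top sequentially"
    by (rule filterlim_subseq) (simp add: strict_mono_def)
  have 1: "\<exists>\<mu>::nat \<Rightarrow> real.
        (\<forall>k\<ge>1. \<Delta>0 (of_real ((real (2 * k) * pi)\<^sup>2)) = 0) \<and>
        (\<forall>k\<ge>1. \<Delta> (of_real (\<mu> k)) = 0) \<and>
        (\<forall>k\<ge>1. graph_eigenvalue G q (of_real (\<mu> k))) \<and>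
        (\<lambda>k. \<mu> k - ((real (2 * k) * pi)\<^sup>2 + mean_potential G q)) \<in> o(\<lambda>k. 1)"
    by (rule main[OF double _ \<sigma>_even]) simp
  have 2: "\<exists>\<mu>::nat \<Rightarrow> real.
        (\<forall>k\<ge>1. \<Delta>0 (of_real ((real k * pi)\<^sup>2)) = 0) \<and>
        (\<forall>k\<ge>1. \<Delta> (of_real (\<mu> k)) = 0) \<and>
        (\<forall>k\<ge>1. graph_eigenvalue G q (of_real (\<mu> k))) \<and>
        (\<lambda>k. \<mu> k - ((real k * pi)\<^sup>2 + mean_potential G q)) \<in> o(\<lambda>k. 1)"
    if bip: "bipartite G"
  proof (rule main)
    show "filterlim (\<lambda>k::nat. k) at_top sequentially" by (rule filterlim_ident)
    fix k :: nat
    obtain A B where AB: "A \<union> B = verts G \<and> A \<inter> B = {} \<and>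
        (\<forall>e\<in>arcs G. tail G e \<in> A \<and> head G e \<in> B \<or> tail G e \<in> B \<and> head G e \<in> A)"
      using bip[unfolded bipartite_def] by (elim exE) (rule that)
    have cross: "tail G e \<in> A \<and> head G e \<notin> A \<or> tail G e \<notin> A \<and> head G e \<in> A" if "e \<in> arcs G" for e
      using conjunct1[OF conjunct2[OF AB]] conjunct2[OF conjunct2[OF AB], rule_format, OF that] by blast
    \<comment> \<open>For odd \<open>k\<close> the second colour class gets the sign -1. The sign is
      defined off the graph as well, since every \<open>v\<close> is to have a sign.\<close>
    define \<sigma> :: "'v \<Rightarrow> real" where "\<sigma> v = (if odd k \<and> v \<notin> A then - 1 else 1)" for v
    have "\<sigma> (head G e) = cos (real k * pi) * \<sigma> (tail G e)" if "e \<in> arcs G" for e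
      using cross[OF that] unfolding cos_npi \<sigma>_def by (cases "even k") auto
    moreover have "\<bar>\<sigma> v\<bar> = 1" for v by (simp add: \<sigma>_def)
    ultimately show "\<exists>\<sigma> :: 'v \<Rightarrow> real. (\<forall>v. \<bar>\<sigma> v\<bar> = 1) \<and> (\<forall>e\<in>arcs G. \<sigma> (head G e) = cos (real k * pi) * \<sigma> (tail G e))"
      by blast
  qed
  show ?thesis using 1 2 by simp
qed

end
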